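(* Let $\Lambda$ be a tetrahedral 3-colex with distinguished (outer) rgb-facet, and let $(\mathcal S_3,\mathcal G_3)$ be the 3D gauge color code of $\Lambda$, $(\mathcal S_2,\mathcal G_2)$ the 2D color code of the outer 2-colex, and $(\mathcal S_{\mathrm{in}},\mathcal G_{\mathrm{in}})$ the code of the inner 3-colex. Then the 3D gauge color code can be split by gauge fixing into the outer 2D color code, which keeps the logical qubit, and the inner code, which encodes no logical qubits. Precisely: (i) The operators $X_{\mathrm{out}}=\prod_{v\in\mathcal Q} X_v$ and $Z_{\mathrm{out}}=\prod_{v\in \mathcal Q} Z_v$, where $\mathcal Q$ is the set of all outer qubits, generate (up to phases) a representative group of bare logical operators both for $(\mathcal S_3,\mathcal G_3)$ and for $(\mathcal S_2,\mathcal G_2)$; that is, for each of the two codes $(\mathcal S,\mathcal G)$, the operators $X_{\mathrm{out}},Z_{\mathrm{out}}$ belong to $\mathcal Z(\mathcal G)$, and every element of $\mathcal Z(\mathcal G)$ is, up to a phase and multiplication by an element of $\mathcal S$, equal to exactly one of $\mathbf 1, X_{\mathrm{out}}, Z_{\mathrm{out}}, X_{\mathrm{out}}Z_{\mathrm{out}}$. (ii) $(\mathcal S_{\mathrm{in}},\mathcal G_{\mathrm{in}})$ is a stabilizer subsystem code encoding no logical qubits: $-\mathbf 1\notin\mathcal S_{\mathrm{in}}$, and, up to phases, $\mathcal S_{\mathrm{in}}=\mathcal G_{\mathrm{in}}\cap\mathcal Z(\mathcal G_{\mathrm{in}})=\mathcal Z(\mathcal G_{\mathrm{in}})$. (iii)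 $\mathcal G_2\,\mathcal G_{\mathrm{in}}\subseteq\mathcal G_3$ and $\mathcal S_3\subseteq\mathcal S_2\,\mathcal S_{\mathrm{in}}$ (the latter exactly, with no change of signs).
   Context: Stabilizer subsystem codes. Given a finite set of qubits, $\mathcal Z(\mathcal A)$ denotes the centralizer of $\mathcal A$ in the Pauli group of these qubits. A stabilizer subsystem code is given by subgroups $\mathcal S,\mathcal G$ of the Pauli group with $-\mathbf 1\notin \mathcal S$ and $\mathcal S=\mathcal G\cap\mathcal Z(\mathcal G)$ up to phases. Bare logical operators are the elements of $\mathcal Z(\mathcal G)$; logical operators differing by a stabilizer are equivalent, and a representative group picks one element per class of $\mathcal Z(\mathcal G)/\mathcal S$ (up to phases). A code $(\mathcal S,\mathcal G)$ splits by gauge fixing into codes $(\mathcal S_i,\mathcal G_i)$ on disjoint sets of qubits partitioning the original qubits when $\prod_i\mathcal G_i\subseteq \mathcal G$, $\mathcal S\subseteq\prod_i \mathcal S_i$, and $\prod_i\mathcal L_i$ is a representative group of logical operators of $(\mathcal S,\mathcal G)$, where $\mathcal L_i$ is a representative group for $(\mathcal S_i,\mathcal G_i)$. Operators on a subset of qubits are tensored with identities elsewhere. Colexes. A closed 3-colex $\bar\Lambda$ is a cell decomposition of a closed 3-manifold whose graph of vertices and edges is finite, connected, simple, 4-valent, with edges properly colored by r, g, b, y (the four edges at each vertex have four different colors), such that the plaquettes (2-cells) are exactly the connected components of the two-color subgraphs (e.g. an rg-plaquette is a component of the subgraph of r- and g-edges), and the cells (3-cells) are exactly the connected components of the three-color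 subgraphs (e.g. rgb-cells), the plaquettes contained in each cell forming a 2-sphere. Plaquettes and cells are identified with their vertex sets. A tetrahedral 3-colex $\Lambda$ is obtained from a closed 3-colex $\bar\Lambda$ whose manifold is the 3-sphere by removing one vertex $v_0$ and all edges, plaquettes and cells containing $v_0$; there is one qubit per vertex of $\Lambda$. The outer rgb-facet is $\mathcal Q=B\setminus\{v_0\}$, where $B$ is the rgb-cell of $\bar\Lambda$ containing $v_0$. Vertices (qubits) in $\mathcal Q$ are outer; the other vertices of $\Lambda$ are inner. The outer 2-colex consists of $\mathcal Q$ and of all edges and plaquettes of $\Lambda$ with all vertices in $\mathcal Q$. The inner 3-colex consists of the inner vertices and of all edges, plaquettes and cells of $\Lambda$ with only inner vertices. A cell or plaquette of $\Lambda$ with both inner and outer vertices is called an interface cell or plaquette. Standing geometric assumptions (non-pathological colex): every cell of $\bar\Lambda$ other than $B$ that meets $B$ meets it in the vertex set of exactly one plaquette; and the inner 3-colex is a topological 3-ball whose boundary sphere is divided into disc-shaped regions, one for each cell $c\neq B$ of $\bar\Lambda$ meeting $B$ (the region being the set of inner vertices of $c$), the regions meeting along open arcs that meet at points. Codes. For a set $A$ of vertices, $X_A=\prod_{v\in A}X_v$ and $Z_A=\prod_{v\in A}Z_v$. $\mathcal G_3$ is generated by $X_p,Z_p$ for all plaquettes $p$ of $\Lambda$; $\mathcal S_3$ by $X_c,Z_c$ for all cells $c$ of $\Lambda$. Both $\mathcal G_2$ and $\mathcal S_2$ are generated by $X_p,Z_p$ for all plaquettes $p$ of the outer 2-colex.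 $\mathcal G_{\mathrm{in}}$ is generated by $X_p,Z_p$ for all plaquettes $p$ of the inner 3-colex; $\mathcal S_{\mathrm{in}}$ is generated by $X_c,Z_c$ for all cells $c$ of the inner 3-colex together with the restrictions to the inner qubits of $X_c,Z_c$ for all interface cells $c$. *)

theory Defs
  imports "HOL-Analysis.Analysis" "HOL-Algebra.Generated_Groups" "HOL-Algebra.Bij"
begin

section \<open>Colexes\<close>

datatype color = Red | Green | Blue | Yellow

record 'v colored_graph =
  verts :: "'v set"
  edges :: "'v set set"
  colour :: "'v set \<Rightarrow> color"

definition adj :: "'v colored_graph \<Rightarrow> color set \<Rightarrow> ('v \<times> 'v) set" where
  "adj K T = {(u, w). {u, w} \<in> edges K \<and> colour K {u, w} \<in> T}"

definition component :: "'v colored_graph \<Rightarrow> color set \<Rightarrow> 'v \<Rightarrow> 'v set" where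
  "component K T v = (adj K T)\<^sup>* `` {v}"

definition plaquettes :: "'v colored_graph \<Rightarrow> 'v set set" where
  "plaquettes K = {component K T v | T v. card T = 2 \<and> v \<in> verts K}"

definition cells :: "'v colored_graph \<Rightarrow> 'v set set" where
  "cells K = {component K T v | T v. card T = 3 \<and> v \<in> verts K}"

text \<open>
  The faces of all dimensions of the cell decomposition. A \<open>k\<close>-dimensional face is a connected
  component of the subgraph of some \<open>k\<close> colors: a vertex for \<open>k = 0\<close>, an edge for \<open>k = 1\<close>,
  a plaquette for \<open>k = 2\<close>, a cell for \<open>k = 3\<close>. The color set is kept as a label,
  and incidence means inclusion of both the color sets and the vertex sets.
\<close>

type_synonym 'v face = "color set \<times> 'v set"

definition faces :: "'v colored_graph \<Rightarrow> 'v face set" where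
  "faces K = {(T, component K T v) | T v. card T \<le> 3 \<and> v \<in> verts K}"

definition face_le :: "'v face \<Rightarrow> 'v face \<Rightarrow> bool" where
  "face_le a b \<longleftrightarrow> fst a \<subseteq> fst b \<and> snd a \<subseteq> snd b"

text \<open>
  The space underlying a set of faces closed under passing to smaller faces, as its barycentric
  subdivision (the order complex of the face poset): points are given by barycentric coordinates
  supported on chains of faces, with the product topology.
\<close>

definition realization :: "'v face set \<Rightarrow> ('v face \<Rightarrow> real) set" where
  "realization F = {x. (\<forall>a. 0 \<le> x a) \<and> (\<forall>a. x a \<noteq> 0 \<longrightarrow> a \<in> F) \<and>
     (\<forall>a b. x a \<noteq> 0 \<longrightarrow> x b \<noteq> 0 \<longrightarrow> face_le a b \<or> face_le b a) \<and> (\<Sum>a\<in>F. x a) = 1}"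

text \<open>
  The last condition says that the boundary of every 3-cell is a 2-sphere. The realization of all
  faces is then a closed 3-manifold: it is made of balls glued along plaquettes, and the link of
  every vertex is the boundary of a tetrahedron, the four edges at the vertex being its corners.
\<close>

definition closed_3colex :: "'v colored_graph \<Rightarrow> bool" where
  "closed_3colex K \<longleftrightarrow>
     finite (verts K) \<and> verts K \<noteq> {} \<and>
     (\<forall>e\<in>edges K. e \<subseteq> verts K \<and> card e = 2) \<and>
     (\<forall>v\<in>verts K. card {e \<in> edges K. v \<in> e} = 4) \<and>
     (\<forall>v\<in>verts K. inj_on (colour K) {e \<in> edges K. v \<in> e}) \<and>
     (\<forall>u\<in>verts K. \<forall>w\<in>verts K. (u, w) \<in> (adj K UNIV)\<^sup>*) \<and>
     (\<forall>c\<in>faces K. card (fst c) = 3 \<longrightarrow>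
        realization {a \<in> faces K. face_le a c \<and> a \<noteq> c} homeomorphic sphere (0 :: real^3) 1)"

text \<open>
  A tetrahedral 3-colex is represented by the closed 3-colex \<open>K\<close> and the vertex \<open>v0\<close> to be removed.
\<close>

definition tetrahedral_3colex :: "'v colored_graph \<Rightarrow> 'v \<Rightarrow> bool" where
  "tetrahedral_3colex K v0 \<longleftrightarrow>
     closed_3colex K \<and> v0 \<in> verts K \<and> realization (faces K) homeomorphic sphere (0 :: real^4) 1"

definition tet_qubits :: "'v colored_graph \<Rightarrow> 'v \<Rightarrow> 'v set" where
  "tet_qubits K v0 = verts K - {v0}"

definition tet_plaquettes :: "'v colored_graph \<Rightarrow> 'v \<Rightarrow> 'v set set" where
  "tet_plaquettes K v0 = {p \<in> plaquettes K. v0 \<notin> p}"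

definition tet_cells :: "'v colored_graph \<Rightarrow> 'v \<Rightarrow> 'v set set" where
  "tet_cells K v0 = {c \<in> cells K. v0 \<notin> c}"

definition rgb_cell :: "'v colored_graph \<Rightarrow> 'v \<Rightarrow> 'v set" where
  "rgb_cell K v0 = component K {Red, Green, Blue} v0"

definition outer_qubits :: "'v colored_graph \<Rightarrow> 'v \<Rightarrow> 'v set" where
  "outer_qubits K v0 = rgb_cell K v0 - {v0}"

definition inner_qubits :: "'v colored_graph \<Rightarrow> 'v \<Rightarrow> 'v set" where
  "inner_qubits K v0 = tet_qubits K v0 - outer_qubits K v0"

definition outer_plaquettes :: "'v colored_graph \<Rightarrow> 'v \<Rightarrow> 'v set set" where
  "outer_plaquettes K v0 = {p \<in> tet_plaquettes K v0. p \<subseteq> outer_qubits K v0}"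

definition inner_plaquettes :: "'v colored_graph \<Rightarrow> 'v \<Rightarrow> 'v set set" where
  "inner_plaquettes K v0 = {p \<in> tet_plaquettes K v0. p \<subseteq> inner_qubits K v0}"

definition inner_cells :: "'v colored_graph \<Rightarrow> 'v \<Rightarrow> 'v set set" where
  "inner_cells K v0 = {c \<in> tet_cells K v0. c \<subseteq> inner_qubits K v0}"

definition interface_cells :: "'v colored_graph \<Rightarrow> 'v \<Rightarrow> 'v set set" where
  "interface_cells K v0 =
     {c \<in> tet_cells K v0. c \<inter> inner_qubits K v0 \<noteq> {} \<and> c \<inter> outer_qubits K v0 \<noteq> {}}"


section \<open>The standing geometric assumptions\<close>

definition inner_faces :: "'v colored_graph \<Rightarrow> 'v \<Rightarrow> 'v face set" where
  "inner_faces K v0 = {a \<in> faces K. snd a \<subseteq> inner_qubits K v0}"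

text \<open>Unlike the interface cells, these include the cells that contain the removed vertex.\<close>

definition boundary_cells :: "'v colored_graph \<Rightarrow> 'v \<Rightarrow> 'v face set" where
  "boundary_cells K v0 = {c \<in> faces K. card (fst c) = 3 \<and>
     snd c \<noteq> rgb_cell K v0 \<and> snd c \<inter> rgb_cell K v0 \<noteq> {}}"

definition region :: "'v colored_graph \<Rightarrow> 'v \<Rightarrow> 'v face \<Rightarrow> ('v face \<Rightarrow> real) set" where
  "region K v0 c = realization {a \<in> inner_faces K v0. face_le a c}"

definition open_arc :: "(real \<Rightarrow> 'a :: topological_space) \<Rightarrow> 'a set" where
  "open_arc g = path_image g - {pathstart g, pathfinish g}"

definition meet_along_open_arcs :: "'i set \<Rightarrow> ('i \<Rightarrow> 'a :: topological_space set) \<Rightarrow> bool" where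
  "meet_along_open_arcs I R \<longleftrightarrow>
     (\<exists>P A. finite P \<and> finite A \<and>
        (\<forall>g\<in>A. arc g \<and> pathstart g \<in> P \<and> pathfinish g \<in> P \<and> open_arc g \<inter> P = {}) \<and>
        (\<forall>g\<in>A. \<forall>h\<in>A. g \<noteq> h \<longrightarrow> open_arc g \<inter> open_arc h = {}) \<and>
        (\<forall>i\<in>I. \<forall>j\<in>I. i \<noteq> j \<longrightarrow>
           (\<exists>P'\<subseteq>P. \<exists>A'\<subseteq>A. R i \<inter> R j = P' \<union> (\<Union>g\<in>A'. open_arc g))))"

definition nonpathological :: "'v colored_graph \<Rightarrow> 'v \<Rightarrow> bool" where
  "nonpathological K v0 \<longleftrightarrow>
     (\<forall>c\<in>cells K. c \<noteq> rgb_cell K v0 \<longrightarrow> c \<inter> rgb_cell K v0 \<noteq> {} \<longrightarrow>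
        (\<exists>!p. p \<in> plaquettes K \<and> c \<inter> rgb_cell K v0 = p)) \<and>
     (\<exists>f g. homeomorphism (realization (inner_faces K v0)) (cball (0 :: real^3) 1) f g \<and>
        f ` (\<Union>c\<in>boundary_cells K v0. region K v0 c) = sphere 0 1) \<and>
     (\<forall>c\<in>boundary_cells K v0. region K v0 c homeomorphic cball (0 :: real^2) 1) \<and>
     meet_along_open_arcs (boundary_cells K v0) (region K v0)"


section \<open>Pauli operators\<close>

text \<open>
  A state of qubits labelled by \<open>'v\<close> is given by its amplitudes in the computational basis.
  Operators act on all labels at once, so that an operator on a subset of the qubits is
  automatically tensored with identities elsewhere.
\<close>

type_synonym 'v state = "('v \<Rightarrow> bool) \<Rightarrow> complex"
type_synonym 'v operator = "'v state \<Rightarrow> 'v state"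

definition phase :: "complex \<Rightarrow> 'v operator" where
  "phase z = (\<lambda>\<psi> s. z * \<psi> s)"

text \<open>Products of the Pauli matrices \<open>X\<close> (bit flip) and \<open>Z\<close> (sign flip) over a finite set \<open>A\<close>.\<close>

definition X_op :: "'v set \<Rightarrow> 'v operator" where
  "X_op A = (\<lambda>\<psi> s. \<psi> (\<lambda>v. if v \<in> A then \<not> s v else s v))"

definition Z_op :: "'v set \<Rightarrow> 'v operator" where
  "Z_op A = (\<lambda>\<psi> s. (\<Prod>v\<in>A. if s v then - 1 else 1) * \<psi> s)"

abbreviation op_group :: "'v operator monoid" where
  "op_group \<equiv> BijGroup UNIV"

definition pauli :: "'v set \<Rightarrow> 'v operator set" where
  "pauli N = generate op_group
     ({phase \<i>} \<union> (\<lambda>v. X_op {v}) ` N \<union> (\<lambda>v. Z_op {v}) ` N)"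

definition phases :: "'v operator set" where
  "phases = range (\<lambda>k :: nat. phase (\<i> ^ k))"

definition centralizer :: "'v set \<Rightarrow> 'v operator set \<Rightarrow> 'v operator set" where
  "centralizer N A = {P \<in> pauli N. \<forall>Q\<in>A. P \<otimes>\<^bsub>op_group\<^esub> Q = Q \<otimes>\<^bsub>op_group\<^esub> P}"

definition eq_up_to_phases :: "'v operator set \<Rightarrow> 'v operator set \<Rightarrow> bool" where
  "eq_up_to_phases A B \<longleftrightarrow> phases <#>\<^bsub>op_group\<^esub> A = phases <#>\<^bsub>op_group\<^esub> B"


section \<open>Stabilizer subsystem codes\<close>

definition stabilizer_subsystem_code ::
    "'v set \<Rightarrow> 'v operator set \<Rightarrow> 'v operator set \<Rightarrow> bool" where
  "stabilizer_subsystem_code N S G \<longleftrightarrow>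
     subgroup S op_group \<and> S \<subseteq> pauli N \<and>
     subgroup G op_group \<and> G \<subseteq> pauli N \<and>
     phase (- 1) \<notin> S \<and> eq_up_to_phases S (G \<inter> centralizer N G)"

definition logically_equivalent ::
    "'v operator set \<Rightarrow> 'v operator \<Rightarrow> 'v operator \<Rightarrow> bool" where
  "logically_equivalent S P R \<longleftrightarrow>
     (\<exists>w\<in>phases. \<exists>s\<in>S. P = w \<otimes>\<^bsub>op_group\<^esub> s \<otimes>\<^bsub>op_group\<^esub> R)"

definition representative_group ::
    "'v set \<Rightarrow> 'v operator set \<Rightarrow> 'v operator set \<Rightarrow> 'v operator set \<Rightarrow> bool" where
  "representative_group N S G L \<longleftrightarrow>
     subgroup L op_group \<and> L \<subseteq> centralizer N G \<and>
     (\<forall>P\<in>centralizer N G. \<exists>R\<in>L. logically_equivalent S P R \<and>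
        (\<forall>R'\<in>L. logically_equivalent S P R' \<longrightarrow> (\<exists>w\<in>phases. R' = w \<otimes>\<^bsub>op_group\<^esub> R)))"

definition splits_by_gauge_fixing ::
    "'v set \<Rightarrow> 'v operator set \<Rightarrow> 'v operator set \<Rightarrow>
     'v set \<Rightarrow> 'v operator set \<Rightarrow> 'v operator set \<Rightarrow>
     'v set \<Rightarrow> 'v operator set \<Rightarrow> 'v operator set \<Rightarrow> bool" where
  "splits_by_gauge_fixing N S G N1 S1 G1 N2 S2 G2 \<longleftrightarrow>
     stabilizer_subsystem_code N S G \<and>
     stabilizer_subsystem_code N1 S1 G1 \<and> stabilizer_subsystem_code N2 S2 G2 \<and>
     N1 \<union> N2 = N \<and> N1 \<inter> N2 = {} \<and>
     G1 <#>\<^bsub>op_group\<^esub> G2 \<subseteq> G \<and> S \<subseteq> S1 <#>\<^bsub>op_group\<^esub> S2 \<and>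
     (\<exists>L1 L2. representative_group N1 S1 G1 L1 \<and> representative_group N2 S2 G2 L2 \<and>
        representative_group N S G (L1 <#>\<^bsub>op_group\<^esub> L2))"

definition logical_qubit ::
    "'v set \<Rightarrow> 'v operator set \<Rightarrow> 'v operator set \<Rightarrow> 'v operator \<Rightarrow> 'v operator \<Rightarrow> bool" where
  "logical_qubit N S G X Z \<longleftrightarrow>
     X \<in> centralizer N G \<and> Z \<in> centralizer N G \<and>
     (\<forall>P\<in>centralizer N G.
        \<exists>!R. R \<in> {\<one>\<^bsub>op_group\<^esub>, X, Z, X \<otimes>\<^bsub>op_group\<^esub> Z} \<and> logically_equivalent S P R)"


section \<open>The three codes\<close>

definition XZ_group :: "'v set set \<Rightarrow> 'v operator set" where
  "XZ_group A = generate op_group (X_op ` A \<union> Z_op ` A)"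

definition S_3 :: "'v colored_graph \<Rightarrow> 'v \<Rightarrow> 'v operator set" where
  "S_3 K v0 = XZ_group (tet_cells K v0)"

definition G_3 :: "'v colored_graph \<Rightarrow> 'v \<Rightarrow> 'v operator set" where
  "G_3 K v0 = XZ_group (tet_plaquettes K v0)"

definition S_2 :: "'v colored_graph \<Rightarrow> 'v \<Rightarrow> 'v operator set" where
  "S_2 K v0 = XZ_group (outer_plaquettes K v0)"

definition G_2 :: "'v colored_graph \<Rightarrow> 'v \<Rightarrow> 'v operator set" where
  "G_2 K v0 = XZ_group (outer_plaquettes K v0)"

definition S_in :: "'v colored_graph \<Rightarrow> 'v \<Rightarrow> 'v operator set" where
  "S_in K v0 = XZ_group (inner_cells K v0 \<union> (\<lambda>c. c \<inter> inner_qubits K v0) ` interface_cells K v0)"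

definition G_in :: "'v colored_graph \<Rightarrow> 'v \<Rightarrow> 'v operator set" where
  "G_in K v0 = XZ_group (inner_plaquettes K v0)"

end

theory Submission
  imports Defs
begin

text \<open>
  Up to phases, everything is linear algebra over the field with two elements. The point is that a
  set \<open>A\<close> of vertices meeting every plaquette of a simply connected complex evenly is a sum of cells.
  For every color \<open>k\<close>, the jump of \<open>A\<close> across the edges of color \<open>k\<close> is a mod-2 cochain. On a plaquette
  it is exact because \<open>A\<close> is even there, on the boundary sphere of a cell because the sphere is simply
  connected, and globally for the same reason. Its potential \<open>y k\<close> is constant along the edges of all other
  colors, that is, on every cell without the color \<open>k\<close>, and \<open>A\<close> is the sum of the \<open>y k\<close> up to a constant.

  The 3-sphere gives the logical operators of the 3D code, the boundary sphere of the facet those of the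
  2D code, and the inner ball, with the regions connected, shows that the inner code has none.
\<close>

section \<open>Double covers of simply connected spaces\<close>

text \<open>A plaquette is a bare vertex set, so the generators of the outer code include any
  plaquette with yellow edges that happens to lie in the facet. Such a plaquette may have no color
  in common with a facet plaquette, and then commutation rests on knowing which plaquette a cell
  cuts out of \<open>B\<close>. The hypothesis only says that the intersection is some plaquette.
  Its colors are pinned down by the inner vertices of every boundary cell and by the fact that a
  cell never consists of a single one of its plaquettes, which follows from the sphere condition by
  a counting argument.

  Removing \<open>v0\<close> costs one parity. A set of even size that is even on the available
  plaquettes is automatically even on those through \<open>v0\<close>, while \<open>Q\<close> has
  odd size because \<open>B\<close> has even size. So the parity of the size separates stabilizers
  from logical operators, in three dimensions and on the facet alike.

  The exact signs in the stabilizer inclusion come from stabilizer supports overlapping evenly: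
  reordering their generators never creates a sign.\<close>

definition bunit :: "nat \<Rightarrow> nat \<Rightarrow>\<^sub>C real" where
  "bunit n = Bcontfun (\<lambda>i. if i = n then 1 else 0)"

lemma apply_bunit: "apply_bcontfun (bunit n) i = (if i = n then 1 else 0)"
proof -
  have "(\<lambda>i::nat. if i = n then 1 else 0 :: real) \<in> bcontfun"
    by (rule bcontfun_normI[where b = 1]) (auto intro: continuous_on_discrete)
  then show ?thesis
    by (simp add: bunit_def Bcontfun_inverse)
qed

lemma bounded_linear_apply_bcontfun:
  "bounded_linear (\<lambda>z :: 'a::topological_space \<Rightarrow>\<^sub>C 'b::real_normed_vector. apply_bcontfun z i)"
  by (rule bounded_linear_intro[where K = 1]) (auto simp: norm_bounded)

text \<open>
  The signs glue two copies of the members of the cover to a double cover \<open>E\<close> of \<open>Y\<close>, and a section of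
  it is a choice of signs. The lifting theorem of the library is about normed spaces, so \<open>E\<close> is
  realized in \<open>Y\<close> times a space of bounded sequences, with \<open>lam\<close> as coordinates.
\<close>

lemma double_cover_trivial:
  fixes Y :: "'c::real_normed_vector set" and lam :: "'i \<Rightarrow> 'c \<Rightarrow> real" and s :: "'i \<Rightarrow> 'i \<Rightarrow> real"
  assumes fin: "finite F"
    and sc: "simply_connected Y" and lpc: "locally path_connected Y"
    and cont: "\<And>a. a \<in> F \<Longrightarrow> continuous_on Y (lam a)"
    and nonneg: "\<And>a y. a \<in> F \<Longrightarrow> y \<in> Y \<Longrightarrow> 0 \<le> lam a y"
    and cov: "\<And>y. y \<in> Y \<Longrightarrow> \<exists>a\<in>F. 0 < lam a y"
    and conn: "\<And>a. a \<in> F \<Longrightarrow> connected {y \<in> Y. 0 < lam a y}"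
    and sgn: "\<And>a b. s a b = 1 \<or> s a b = - 1"
    and cocycle: "\<And>a b c y. \<lbrakk>a \<in> F; b \<in> F; c \<in> F; y \<in> Y; 0 < lam a y; 0 < lam b y; 0 < lam c y\<rbrakk>
      \<Longrightarrow> s a b * s b c = s a c"
  shows "\<exists>e. (\<forall>a. e a = 1 \<or> e a = - 1) \<and>
    (\<forall>a\<in>F. \<forall>b\<in>F. \<forall>y\<in>Y. 0 < lam a y \<longrightarrow> 0 < lam b y \<longrightarrow> s a b = e a * e b)"
proof -
  obtain ix :: "'i \<Rightarrow> nat" where ix: "inj_on ix F"
    using fin finite_imp_inj_to_nat_seg by blast
  \<comment> \<open>The point over \<open>y\<close> on the positive sheet of \<open>a\<close>,
    recorded by its sign relative to every member \<open>b\<close> of the cover and weighted by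
    \<open>lam b y\<close>. Changing \<open>a\<close> multiplies the whole vector by one sign, so
    the pair of opposite vectors over \<open>y\<close> does not depend on \<open>a\<close>.\<close>
  define sec where "sec a y = (\<Sum>b\<in>F. (lam b y * s a b) *\<^sub>R bunit (ix b))" for a y
  define ev where "ev b z = apply_bcontfun z (ix b)" for b and z :: "nat \<Rightarrow>\<^sub>C real"
  have ev_linear: "bounded_linear (ev b)" for b
    unfolding ev_def[abs_def] by (rule bounded_linear_apply_bcontfun)
  have ev_sec: "ev b (sec a y) = lam b y * s a b" if "b \<in> F" for a b y
  proof -
    have "ev b (sec a y) = (\<Sum>c\<in>F. (lam c y * s a c) * (if ix b = ix c then 1 else 0))"
      unfolding sec_def using bounded_linear.linear[OF ev_linear[of b]]
      by (simp add: linear_sum linear_scale) (simp add: ev_def apply_bunit)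
    also have "\<dots> = (\<Sum>c\<in>F. if c = b then lam b y * s a b else 0)"
      by (rule sum.cong) (use ix that in \<open>auto simp: inj_on_def\<close>)
    finally show ?thesis
      using fin that by simp
  qed
  have refl: "s a a = 1" if "a \<in> F" "y \<in> Y" "0 < lam a y" for a y
    using cocycle[of a a a y] that sgn[of a a] by auto
  have sec_change: "sec a y = s a b *\<^sub>R sec b y"
    if "a \<in> F" "b \<in> F" "y \<in> Y" "0 < lam a y" "0 < lam b y" for a b y
    unfolding sec_def scaleR_sum_right
  proof (rule sum.cong[OF HOL.refl])
    fix c assume "c \<in> F"
    \<comment> \<open>The cocycle identity is available only where \<open>lam c\<close> is positive;
      elsewhere the weight kills the summand.\<close>
    show "(lam c y * s a c) *\<^sub>R bunit (ix c) = s a b *\<^sub>R (lam c y * s b c) *\<^sub>R bunit (ix c)"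
      using cocycle[of a b c y] nonneg[of c y] that \<open>c \<in> F\<close> by (cases "lam c y = 0") auto
  qed
  have sec_cont: "continuous_on Y (sec a)" for a
    unfolding sec_def[abs_def] by (intro continuous_intros cont)
  define E where "E = {(y, t *\<^sub>R sec a y) | y a t. y \<in> Y \<and> a \<in> F \<and> 0 < lam a y \<and> (t = 1 \<or> t = - 1)}"
  have E_at: "\<exists>t. (t = 1 \<or> t = - 1) \<and> z = t *\<^sub>R sec a y"
    if yz: "(y, z) \<in> E" and "a \<in> F" "0 < lam a y" for y z a
  proof -
    obtain b t where b: "z = t *\<^sub>R sec b y" "b \<in> F" "0 < lam b y" "y \<in> Y" "t = 1 \<or> t = - 1"
      using yz unfolding E_def by auto
    have "z = (t * s b a) *\<^sub>R sec a y"
      using b sec_change[of b a y] that by simp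
    moreover have "t * s b a = 1 \<or> t * s b a = - 1"
      using b(5) sgn[of b a] by auto
    ultimately show ?thesis by blast
  qed
  \<comment> \<open>Coordinate \<open>a\<close> vanishes nowhere over the member \<open>a\<close>,
    so its sign tells the two sheets apart there.\<close>
  have ev_E: "ev a z \<noteq> 0 \<longleftrightarrow> 0 < lam a y" if yz: "(y, z) \<in> E" and a: "a \<in> F" for y z a
  proof -
    obtain b t where b: "z = t *\<^sub>R sec b y" "y \<in> Y" "t = 1 \<or> t = - 1"
      using yz unfolding E_def by auto
    have "ev a z = t * (lam a y * s b a)"
      using b(1) ev_sec[OF a, of b y] bounded_linear.linear[OF ev_linear[of a]]
      by (simp add: linear_scale)
    then show ?thesis
      using b(2,3) sgn[of b a] nonneg[OF a, of y] by auto
  qed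
  have "covering_space E fst Y"
  proof
    show "continuous_on E fst"
      by (intro continuous_intros)
    show "fst ` E = Y"
    proof
      show "fst ` E \<subseteq> Y" unfolding E_def by auto
      show "Y \<subseteq> fst ` E"
      proof
        fix y assume "y \<in> Y"
        then obtain a where "a \<in> F" "0 < lam a y" using cov by blast
        then have "(y, 1 *\<^sub>R sec a y) \<in> E" using \<open>y \<in> Y\<close> unfolding E_def by blast
        then show "y \<in> fst ` E" by force
      qed
    qed
    fix y0 assume "y0 \<in> Y"
    then obtain a where a: "a \<in> F" "0 < lam a y0" using cov by blast
    define T where "T = {y \<in> Y. 0 < lam a y}"
    define sheet where "sheet t = {(y, t *\<^sub>R sec a y) | y. y \<in> T}" for t :: real
    \<comment> \<open>As a sign condition on one continuous coordinate, a sheet is visibly open in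
      \<open>E\<close>, and the two sheets are disjoint.\<close>
    have sheet_alt: "sheet t = {x \<in> E. t * ev a (snd x) \<in> {0<..}}" if t: "t = 1 \<or> t = - 1" for t
    proof (intro equalityI subsetI)
      fix x assume "x \<in> sheet t"
      then obtain y where y: "y \<in> Y" "0 < lam a y" "x = (y, t *\<^sub>R sec a y)"
        unfolding sheet_def T_def by blast
      then have "x \<in> E" using t a(1) unfolding E_def by blast
      moreover have "t * ev a (snd x) = t * t * (lam a y * s a a)"
        using y ev_sec[OF a(1), of a y] bounded_linear.linear[OF ev_linear[of a]]
        by (simp add: linear_scale)
      ultimately show "x \<in> {x \<in> E. t * ev a (snd x) \<in> {0<..}}"
        using t refl[of a y] a(1) y by auto
    next
      fix x assume x: "x \<in> {x \<in> E. t * ev a (snd x) \<in> {0<..}}"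
      obtain y z where yz: "x = (y, z)" by (cases x)
      have "0 < lam a y" using ev_E[of y z a] x yz a(1) by auto
      moreover have "y \<in> Y" using x yz unfolding E_def by auto
      moreover obtain t' where t': "t' = 1 \<or> t' = - 1" "z = t' *\<^sub>R sec a y"
        using E_at[of y z a] x yz a(1) calculation by auto
      have "ev a z = t' * lam a y"
        using t' ev_sec[OF a(1), of a y] bounded_linear.linear[OF ev_linear[of a]]
          refl[of a y] a(1) calculation by (simp add: linear_scale)
      then have "0 < t * t' * lam a y" using x yz by (simp add: mult.assoc)
      then have "t = t'" using t t'(1) \<open>0 < lam a y\<close> by auto
      ultimately show "x \<in> sheet t"
        using yz t' unfolding sheet_def T_def by auto
    qed
    have "openin (top_of_set Y) T"
    proof -
      have "T = Y \<inter> lam a -` {0<..}" unfolding T_def by auto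
      then show ?thesis
        using continuous_openin_preimage_gen[OF cont[OF a(1)], of "{0<..}"] by simp
    qed
    moreover have "\<exists>v. \<Union>v = E \<inter> fst -` T \<and> (\<forall>u\<in>v. openin (top_of_set E) u) \<and>
        pairwise disjnt v \<and> (\<forall>u\<in>v. \<exists>q. homeomorphism u T fst q)"
    proof (intro exI[of _ "{sheet 1, sheet (- 1)}"] conjI ballI)
      show "\<Union> {sheet 1, sheet (- 1)} = E \<inter> fst -` T"
      proof (intro equalityI subsetI)
        fix x assume "x \<in> \<Union> {sheet 1, sheet (- 1)}"
        then obtain t where "x \<in> sheet t" "t = 1 \<or> t = - 1" by blast
        then have "x \<in> E" "fst x \<in> T"
          using sheet_alt[of t] by (simp, auto simp: sheet_def)
        then show "x \<in> E \<inter> fst -` T" by simp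
      next
        fix x assume x: "x \<in> E \<inter> fst -` T"
        obtain y z where yz: "x = (y, z)" by (cases x)
        then have "(y, z) \<in> E" "y \<in> T" "0 < lam a y" using x unfolding T_def by auto
        then show "x \<in> \<Union> {sheet 1, sheet (- 1)}"
          using E_at[of y z a] a(1) yz unfolding sheet_def by auto
      qed
      show "pairwise disjnt {sheet 1, sheet (- 1)}"
        unfolding pairwise_def disjnt_def using sheet_alt[of 1] sheet_alt[of "- 1"] by auto
    next
      fix u assume "u \<in> {sheet 1, sheet (- 1)}"
      then obtain t where t: "t = 1 \<or> t = - 1" "u = sheet t" by blast
      have "continuous_on E (\<lambda>x. t * ev a (snd x))"
        by (intro continuous_intros bounded_linear.continuous_on[OF ev_linear])
      then have "openin (top_of_set E) (E \<inter> (\<lambda>x. t * ev a (snd x)) -` {0<..})"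
        by (rule continuous_openin_preimage_gen) simp
      moreover have "u = E \<inter> (\<lambda>x. t * ev a (snd x)) -` {0<..}"
        using sheet_alt t by auto
      ultimately show "openin (top_of_set E) u" by simp
      have "homeomorphism u T fst (\<lambda>y. (y, t *\<^sub>R sec a y))"
        unfolding homeomorphism_def t(2)
      proof (intro conjI)
        show "continuous_on T (\<lambda>y. (y, t *\<^sub>R sec a y))"
          by (intro continuous_intros continuous_on_subset[OF sec_cont]) (auto simp: T_def)
      qed (auto simp: sheet_def image_def intro!: continuous_intros)
      then show "\<exists>q. homeomorphism u T fst q" by blast
    qed
    ultimately show "\<exists>T. y0 \<in> T \<and> openin (top_of_set Y) T \<and>
        (\<exists>v. \<Union>v = E \<inter> fst -` T \<and> (\<forall>u\<in>v. openin (top_of_set E) u) \<and>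
          pairwise disjnt v \<and> (\<forall>u\<in>v. \<exists>q. homeomorphism u T fst q))"
      using a(2) \<open>y0 \<in> Y\<close> by (intro exI[of _ T]) (simp add: T_def)
  qed
  \<comment> \<open>The map that is lifted is the identity of \<open>Y\<close>, so the lift is a
    continuous section.\<close>
  then obtain g where g: "continuous_on Y g" "g \<in> Y \<rightarrow> E" "\<And>y. y \<in> Y \<Longrightarrow> fst (g y) = y"
    using covering_space_lift[of E fst Y Y "\<lambda>y. y"] sc lpc by auto
  \<comment> \<open>On the connected member \<open>a\<close> the coordinate \<open>a\<close> of the
    section never vanishes, so its sign is constant and one positive point decides it. The value - 1
    also serves as the default for an empty member.\<close>
  define e :: "'i \<Rightarrow> real" where
    "e a = (if \<exists>y\<in>Y. 0 < lam a y \<and> 0 < ev a (snd (g y)) then 1 else - 1)" for a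
  have e: "0 < e a * ev a (snd (g y))" if "a \<in> F" "y \<in> Y" "0 < lam a y" for a y
  proof -
    let ?V = "{y \<in> Y. 0 < lam a y}" and ?h = "\<lambda>y. ev a (snd (g y))"
    have "continuous_on ?V ?h"
      by (intro continuous_intros bounded_linear.continuous_on[OF ev_linear]
          continuous_on_subset[OF g(1)]) auto
    then have conn_h: "connected (?h ` ?V)"
      using conn[OF that(1)] connected_continuous_image by blast
    have "0 \<notin> ?h ` ?V"
    proof
      assume "0 \<in> ?h ` ?V"
      then obtain x where x: "x \<in> Y" "0 < lam a x" "?h x = 0" by auto
      then have "(x, snd (g x)) \<in> E" using g(2,3) by (metis PiE prod.collapse)
      then show False using ev_E[of x "snd (g x)" a] x that(1) by simp
    qed
    then have same: "0 < ?h x \<longleftrightarrow> 0 < ?h y" and "?h y \<noteq> 0" if "x \<in> ?V" "y \<in> ?V" for x y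
      using connectedD_interval[OF conn_h, of "?h x" "?h y" 0]
        connectedD_interval[OF conn_h, of "?h y" "?h x" 0] that
      by (auto simp: not_less)
    show ?thesis
      using same[of _ y] \<open>\<And>y x. x \<in> ?V \<Longrightarrow> y \<in> ?V \<Longrightarrow> ?h y \<noteq> 0\<close>[of y y] that unfolding e_def
      by (smt (verit) mem_Collect_eq mult_neg_neg mult_pos_pos)
  qed
  have "s a b = e a * e b" if ab: "a \<in> F" "b \<in> F" "y \<in> Y" "0 < lam a y" "0 < lam b y" for a b y
  proof -
    have "(y, snd (g y)) \<in> E" using g(2,3) ab(3) by (metis PiE prod.collapse)
    then obtain t where t: "t = 1 \<or> t = - 1" "snd (g y) = t *\<^sub>R sec a y"
      using E_at ab by blast
    have "ev c (snd (g y)) = t * (lam c y * s a c)" if "c \<in> F" for c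
      using t(2) ev_sec[OF that, of a y] bounded_linear.linear[OF ev_linear[of c]]
      by (simp add: linear_scale)
    then have "0 < e a * (t * lam a y)" "0 < e b * (t * (lam b y * s a b))"
      using e[of a y] e[of b y] ab refl[of a y] by auto
    then show ?thesis
      using t(1) ab sgn[of a b] unfolding e_def
      by (auto simp: zero_less_mult_iff split: if_splits)
  qed
  moreover have "e a = 1 \<or> e a = - 1" for a unfolding e_def by simp
  ultimately show ?thesis by (intro exI[of _ e]) blast
qed

section \<open>Spans of set families over the field with two elements\<close>

text \<open>Sets stand for their indicator vectors and symmetric difference for addition. Adding one
  generator at a time matches the way products of Pauli generators are built up.\<close>

inductive_set xor_span :: "'a set set \<Rightarrow> 'a set set" for G where
  empty: "{} \<in> xor_span G"
| add: "a \<in> xor_span G \<Longrightarrow> g \<in> G \<Longrightarrow> sym_diff a g \<in> xor_span G"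

lemma sym_diff_assoc: "sym_diff (sym_diff a b) c = sym_diff a (sym_diff b c)"
  by blast

lemma even_card_sym_diff_Int:
  assumes "finite a" "finite b"
  shows "even (card (sym_diff a b \<inter> c)) \<longleftrightarrow> (even (card (a \<inter> c)) \<longleftrightarrow> even (card (b \<inter> c)))"
proof -
  have "card (sym_diff a b \<inter> c) = card ((a \<inter> c) - (b \<inter> c)) + card ((b \<inter> c) - (a \<inter> c))"
    using assms by (subst card_Un_disjoint[symmetric]) (auto intro!: arg_cong[where f = card])
  moreover have "card (a \<inter> c) = card ((a \<inter> c) - (b \<inter> c)) + card (a \<inter> c \<inter> (b \<inter> c))"
    using assms by (subst card_Un_disjoint[symmetric]) (auto intro!: arg_cong[where f = card])
  moreover have "card (b \<inter> c) = card ((b \<inter> c) - (a \<inter> c)) + card (a \<inter> c \<inter> (b \<inter> c))"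
    using assms by (subst card_Un_disjoint[symmetric]) (auto intro!: arg_cong[where f = card])
  ultimately show ?thesis by presburger
qed

lemma even_card_sym_diff:
  "finite a \<Longrightarrow> finite b \<Longrightarrow> even (card (sym_diff a b)) \<longleftrightarrow> (even (card a) \<longleftrightarrow> even (card b))"
  using even_card_sym_diff_Int[of a b UNIV] by simp

lemma xor_span_base: "g \<in> G \<Longrightarrow> g \<in> xor_span G"
  using xor_span.add[OF xor_span.empty] by simp

lemma xor_span_sym_diff:
  assumes "a \<in> xor_span G" "b \<in> xor_span G"
  shows "sym_diff a b \<in> xor_span G"
  using assms(2)
proof induction
  case (add b g)
  then show ?case
    using xor_span.add[of "sym_diff a b" G g] by (simp only: sym_diff_assoc)
qed (use assms in simp)

lemma xor_span_least: "G \<subseteq> xor_span H \<Longrightarrow> xor_span G \<subseteq> xor_span H"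
proof
  fix a assume "G \<subseteq> xor_span H" "a \<in> xor_span G"
  from this(2,1) show "a \<in> xor_span H"
    by induction (auto intro: xor_span.empty xor_span_sym_diff)
qed

lemma xor_span_subset_Pow: "G \<subseteq> Pow N \<Longrightarrow> xor_span G \<subseteq> Pow N"
proof
  fix a assume "G \<subseteq> Pow N" "a \<in> xor_span G"
  from this(2,1) show "a \<in> Pow N" by induction auto
qed

lemma xor_span_even:
  assumes "a \<in> xor_span G" "\<And>g. g \<in> G \<Longrightarrow> finite g" "\<And>g. g \<in> G \<Longrightarrow> even (card (g \<inter> c))"
  shows "finite a \<and> even (card (a \<inter> c))"
  using assms by (induction) (simp_all add: even_card_sym_diff_Int)

lemma xor_span_singleton: "xor_span {q} = {{}, q}"
proof
  show "xor_span {q} \<subseteq> {{}, q}"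
  proof
    fix a assume "a \<in> xor_span {q}"
    then show "a \<in> {{}, q}" by induction auto
  qed
qed (auto intro: xor_span.empty xor_span_base)

lemma xor_span_empty: "xor_span {} = {{}}"
proof
  show "xor_span {} \<subseteq> {{}}"
  proof
    fix a assume "a \<in> xor_span {}"
    then show "a \<in> {{}}" by induction auto
  qed
qed (auto intro: xor_span.empty)

text \<open>The orthogonal complement for the form counting common elements mod 2. An X operator and
  a Z operator commute exactly if their supports are orthogonal for this form.\<close>

definition perp :: "'a set \<Rightarrow> 'a set set \<Rightarrow> 'a set set" where
  "perp N G = {a. a \<subseteq> N \<and> (\<forall>p\<in>G. even (card (a \<inter> p)))}"

lemma perp_sym_diff:
  "finite N \<Longrightarrow> a \<in> perp N G \<Longrightarrow> b \<in> perp N G \<Longrightarrow> sym_diff a b \<in> perp N G"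
  unfolding perp_def by (auto simp: even_card_sym_diff_Int finite_subset)

lemma xor_span_even_pairs:
  assumes "\<And>g. g \<in> G \<Longrightarrow> finite g" "\<And>g h. g \<in> G \<Longrightarrow> h \<in> H \<Longrightarrow> even (card (g \<inter> h))"
    "\<And>h. h \<in> H \<Longrightarrow> finite h" "a \<in> xor_span G" "b \<in> xor_span H"
  shows "even (card (a \<inter> b))"
proof -
  have "even (card (h \<inter> a))" if "h \<in> H" for h
    using xor_span_even[of a G h] assms that by (simp add: Int_commute)
  then show ?thesis
    using xor_span_even[of b H a] assms by (simp add: Int_commute)
qed

text \<open>A sum over colors in the field with two elements is written as the parity of the number
  of colors with value true; this takes out one summand.\<close>

lemma odd_card_split:
  assumes "finite D" "j \<in> D"
  shows "odd (card {k \<in> D. P k}) \<longleftrightarrow> (odd (card {k \<in> D - {j}. P k}) \<noteq> P j)"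
proof -
  have "{k \<in> D. P k} = (if P j then insert j {k \<in> D - {j}. P k} else {k \<in> D - {j}. P k})"
    using assms(2) by auto
  then show ?thesis using assms(1) by simp
qed

lemma odd_card_xor:
  assumes "finite D"
  shows "odd (card {k \<in> D. P k \<noteq> Q k}) \<longleftrightarrow> (odd (card {k \<in> D. P k}) \<noteq> odd (card {k \<in> D. Q k}))"
proof -
  have "{k \<in> D. P k \<noteq> Q k} = sym_diff {k \<in> D. P k} {k \<in> D. Q k}" by auto
  then show ?thesis using assms by (simp add: even_card_sym_diff)
qed

lemma odd_sum_in_span:
  assumes "finite D" "\<And>k. k \<in> D \<Longrightarrow> y k \<in> xor_span G"
  shows "{v. odd (card {k \<in> D. v \<in> y k})} \<in> xor_span G"
  using assms
proof (induction D rule: finite_induct)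
  case (insert j D)
  have "{v. odd (card {k \<in> insert j D. v \<in> y k})}
      = sym_diff {v. odd (card {k \<in> D. v \<in> y k})} (y j)"
    using odd_card_split[of "insert j D" j] insert.hyps by auto
  then show ?case using insert by (simp add: xor_span_sym_diff)
qed (simp add: xor_span.empty)

lemma xor_span_Int: "a \<in> xor_span G \<Longrightarrow> a \<inter> I \<in> xor_span ((\<lambda>g. g \<inter> I) ` G)"
proof (induction rule: xor_span.induct)
  case (add a g)
  then have "sym_diff (a \<inter> I) (g \<inter> I) \<in> xor_span ((\<lambda>g. g \<inter> I) ` G)"
    by (intro xor_span.add) auto
  moreover have "sym_diff (a \<inter> I) (g \<inter> I) = sym_diff a g \<inter> I" by blast
  ultimately show ?case by simp
qed (simp add: xor_span.empty)

lemma xor_span_subset_perp: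
  assumes "finite N" "G \<subseteq> perp N H"
  shows "xor_span G \<subseteq> perp N H"
proof
  fix a assume "a \<in> xor_span G"
  then show "a \<in> perp N H"
  proof induction
    case (add a g)
    then show ?case using perp_sym_diff[OF assms(1) add.IH] assms(2) by blast
  qed (simp add: perp_def)
qed

text \<open>The common algebra of the 3D and the outer code. \<open>Q\<close> is orthogonal to
  \<open>G\<close> but, having odd size, not to itself, so it is not in the span of
  \<open>G\<close>. Adding \<open>Q\<close> to an odd element of the complement makes it even, so
  the complement is the span of \<open>S\<close> and one further coset.\<close>

lemma odd_generator:
  assumes N: "finite N" and Q: "Q \<in> perp N G" "odd (card Q)" and S: "S \<subseteq> perp N G" "S \<subseteq> xor_span G"
    and even: "\<And>A. A \<in> perp N G \<Longrightarrow> even (card A) \<Longrightarrow> A \<in> xor_span S"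
    and G: "G \<subseteq> Pow N"
  shows "Q \<notin> xor_span S" "perp N G = {sym_diff l s | l s. l \<in> {{}, Q} \<and> s \<in> xor_span S}"
    "xor_span S = xor_span G \<inter> perp N G"
proof -
  have fin: "finite g" if "g \<in> G" for g using that G N by (auto intro: finite_subset)
  have finA: "finite A" if "A \<in> perp N G" for A
    using that N unfolding perp_def by (auto intro: finite_subset)
  have SG: "xor_span S \<subseteq> xor_span G" using S(2) by (rule xor_span_least)
  have Q_G: "Q \<notin> xor_span G"
  proof
    assume "Q \<in> xor_span G"
    then have "even (card (Q \<inter> Q))"
      using xor_span_even[of Q G Q] Q(1) fin unfolding perp_def by (auto simp: Int_commute)
    then show False using Q(2) by simp
  qed
  then show "Q \<notin> xor_span S" using SG by blast
  show *: "perp N G = {sym_diff l s | l s. l \<in> {{}, Q} \<and> s \<in> xor_span S}"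
  proof (intro equalityI subsetI)
    fix A assume A: "A \<in> perp N G"
    show "A \<in> {sym_diff l s | l s. l \<in> {{}, Q} \<and> s \<in> xor_span S}"
    proof (cases "even (card A)")
      case True
      have "A = sym_diff {} A" by simp
      then show ?thesis using even[OF A True] by blast
    next
      case False
      have "even (card (sym_diff A Q))"
        using even_card_sym_diff[OF finA[OF A] finA[OF Q(1)]] False Q(2) by simp
      then have "sym_diff A Q \<in> xor_span S"
        using even perp_sym_diff[OF N A Q(1)] by blast
      moreover have "A = sym_diff Q (sym_diff A Q)" by blast
      ultimately show ?thesis by blast
    qed
  next
    fix A assume "A \<in> {sym_diff l s | l s. l \<in> {{}, Q} \<and> s \<in> xor_span S}"
    then obtain l s where A: "A = sym_diff l s" "l \<in> {{}, Q}" "s \<in> xor_span S" by blast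
    have "l \<in> perp N G" using A(2) Q(1) unfolding perp_def by auto
    moreover have "s \<in> perp N G" using A(3) xor_span_subset_perp[OF N S(1)] by blast
    ultimately show "A \<in> perp N G" unfolding A(1) by (rule perp_sym_diff[OF N])
  qed
  show "xor_span S = xor_span G \<inter> perp N G"
  proof (intro equalityI subsetI)
    fix A assume "A \<in> xor_span S"
    then show "A \<in> xor_span G \<inter> perp N G" using SG xor_span_subset_perp[OF N S(1)] by blast
  next
    fix A assume A: "A \<in> xor_span G \<inter> perp N G"
    then obtain l s where ls: "A = sym_diff l s" "l \<in> {{}, Q}" "s \<in> xor_span S"
      unfolding * by blast
    have "l = sym_diff A s" unfolding ls(1) by blast
    then have "l \<in> xor_span G" using A ls(3) SG xor_span_sym_diff by blast
    then have "l = {}" using ls(2) Q_G by blast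
    then show "A \<in> xor_span S" using ls by simp
  qed
qed

section \<open>Pauli operators and CSS codes\<close>

definition zsign :: "'a set \<Rightarrow> ('a \<Rightarrow> bool) \<Rightarrow> complex" where
  "zsign b s = (\<Prod>v\<in>b. if s v then - 1 else 1)"

definition flip :: "'a set \<Rightarrow> ('a \<Rightarrow> bool) \<Rightarrow> 'a \<Rightarrow> bool" where
  "flip a s = (\<lambda>v. if v \<in> a then \<not> s v else s v)"

text \<open>\<open>pauli_op w a b\<close> is \<open>w\<close> times \<open>Z_op b\<close> after \<open>X_op a\<close>.\<close>

definition pauli_op :: "complex \<Rightarrow> 'a set \<Rightarrow> 'a set \<Rightarrow> 'a operator" where
  "pauli_op w a b = (\<lambda>\<psi> s. w * zsign b s * \<psi> (flip a s))"

lemma X_op_pauli_op: "X_op a = pauli_op 1 a {}"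
  unfolding X_op_def pauli_op_def flip_def zsign_def by simp

lemma Z_op_pauli_op: "Z_op b = pauli_op 1 {} b"
  unfolding Z_op_def pauli_op_def flip_def zsign_def by simp

lemma phase_pauli_op: "phase w = pauli_op w {} {}"
  unfolding phase_def pauli_op_def flip_def zsign_def by simp

lemma zsign_flip:
  assumes "finite b"
  shows "zsign b (flip a s) = (- 1) ^ card (a \<inter> b) * zsign b s"
proof -
  have "zsign b (flip a s) = (\<Prod>v\<in>b. (if v \<in> a then - 1 else 1) * (if s v then - 1 else 1))"
    unfolding zsign_def flip_def by (rule prod.cong) auto
  also have "\<dots> = (\<Prod>v\<in>b. if v \<in> a then - 1 else 1) * zsign b s"
    unfolding zsign_def by (rule prod.distrib)
  also have "(\<Prod>v\<in>b. if v \<in> a then - 1 else 1 :: complex) = (\<Prod>v\<in>b \<inter> a. - 1)"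
    by (rule prod.inter_restrict[OF assms, symmetric])
  finally show ?thesis by (simp add: Int_commute)
qed

lemma zsign_sym_diff:
  assumes "finite b" "finite c"
  shows "zsign (sym_diff b c) s = zsign b s * zsign c s"
proof -
  have sq: "zsign (b \<inter> c) s * zsign (b \<inter> c) s = 1"
    unfolding zsign_def prod.distrib[symmetric] by (rule prod.neutral) auto
  have split: "zsign b' s = zsign (b' - c') s * zsign (b' \<inter> c') s" if "finite b'" for b' c' :: "'a set"
    unfolding zsign_def by (subst prod.union_disjoint[symmetric])
      (use that in \<open>auto intro!: prod.cong\<close>)
  have "zsign (sym_diff b c) s = zsign (b - c) s * zsign (c - b) s"
    unfolding zsign_def by (subst prod.union_disjoint) (use assms in auto)
  moreover have "zsign b s * zsign c s
      = zsign (b - c) s * zsign (c - b) s * (zsign (b \<inter> c) s * zsign (b \<inter> c) s)"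
    using split[OF assms(1), of c] split[OF assms(2), of b] by (simp add: Int_commute ac_simps)
  ultimately show ?thesis using sq by simp
qed

lemma flip_flip: "flip a' (flip a s) = flip (sym_diff a a') s"
  unfolding flip_def by auto

lemma pauli_op_comp:
  assumes "finite b" "finite b'"
  shows "pauli_op w a b \<circ> pauli_op w' a' b' = pauli_op (w * w' * (- 1) ^ card (a \<inter> b')) (sym_diff a a') (sym_diff b b')"
  unfolding pauli_op_def o_def
  by (intro ext) (simp add: zsign_flip zsign_sym_diff assms flip_flip ac_simps)

text \<open>Test states recover the data: at the all-false configuration, a constant state shows
  \<open>w\<close> and a state concentrated at one point shows \<open>a\<close>; the configurations
  with one true bit show \<open>b\<close>. Finiteness enters because a product over an infinite set
  is 1, so an infinite \<open>b\<close> would act like the empty set.\<close>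

lemma pauli_op_inj:
  assumes eq: "pauli_op w a b = pauli_op w' a' b'" and "w \<noteq> 0" and fin: "finite b" "finite b'"
  shows "w = w' \<and> a = a' \<and> b = b'"
proof -
  have eq': "w * zsign b s * \<psi> (flip a s) = w' * zsign b' s * \<psi> (flip a' s)" for \<psi> s
    using fun_cong[OF fun_cong[OF eq, of \<psi>], of s] unfolding pauli_op_def .
  have w: "w = w'"
    using eq'[of "\<lambda>_. False" "\<lambda>_. 1"] by (simp add: zsign_def)
  have "flip a (\<lambda>_. False) = flip a' (\<lambda>_. False)"
    using eq'[of "\<lambda>_. False" "\<lambda>t. if t = flip a (\<lambda>_. False) then 1 else 0"] \<open>w \<noteq> 0\<close>
    by (auto simp: zsign_def split: if_splits)
  then have "v \<in> a \<longleftrightarrow> v \<in> a'" for v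
    by (drule_tac x = v in fun_cong) (simp add: flip_def split: if_splits)
  then have a: "a = a'" by blast
  have zs: "zsign c (\<lambda>v. v = u) = (if u \<in> c then - 1 else 1)" if "finite c" for c and u :: 'a
    unfolding zsign_def using that by (simp add: prod.delta)
  have "u \<in> b \<longleftrightarrow> u \<in> b'" for u
    using eq'[of "\<lambda>v. v = u" "\<lambda>_. 1"] w \<open>w \<noteq> 0\<close> zs[OF fin(1), of u] zs[OF fin(2), of u]
    by (auto split: if_splits)
  then show ?thesis using w a by blast
qed

section \<open>Groups of Pauli operators in normal form\<close>

lemma op_group_is_group: "group (op_group :: 'a operator monoid)"
  by (rule group_BijGroup)

lemma one_pauli_op: "\<one>\<^bsub>op_group\<^esub> = pauli_op 1 {} {}"
  unfolding BijGroup_def by (auto simp: fun_eq_iff phase_pauli_op[symmetric] phase_def)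

lemma pauli_op_carrier:
  assumes "w \<noteq> 0" "finite b"
  shows "pauli_op w a b \<in> carrier op_group"
proof -
  \<comment> \<open>Squaring the supports away leaves the sign from moving \<open>Z_op b\<close>
    past \<open>X_op a\<close>; the scalar cancels it together with \<open>w\<close>.\<close>
  let ?v = "(- 1) ^ card (a \<inter> b) / w"
  have "pauli_op w a b \<circ> pauli_op ?v a b = pauli_op 1 {} {}" "pauli_op ?v a b \<circ> pauli_op w a b = pauli_op 1 {} {}"
    using assms by (simp_all add: pauli_op_comp)
  then have "bij (pauli_op w a b)"
    by (intro o_bij[of "pauli_op ?v a b"]) (simp_all add: phase_pauli_op[symmetric] phase_def id_def)
  then show ?thesis
    unfolding BijGroup_def Bij_def by simp
qed

lemma op_mult: "f \<in> carrier op_group \<Longrightarrow> g \<in> carrier op_group \<Longrightarrow> f \<otimes>\<^bsub>op_group\<^esub> g = f \<circ> g"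
  unfolding BijGroup_def by (auto simp: compose_def o_def)

lemma pauli_op_mult:
  assumes "w \<noteq> 0" "w' \<noteq> 0" "finite b" "finite b'"
  shows "pauli_op w a b \<otimes>\<^bsub>op_group\<^esub> pauli_op w' a' b'
    = pauli_op (w * w' * (- 1) ^ card (a \<inter> b')) (sym_diff a a') (sym_diff b b')"
  using assms by (simp add: op_mult pauli_op_carrier pauli_op_comp)

lemma minus_one_power_cases: "(- 1 :: complex) ^ n = 1 \<or> (- 1 :: complex) ^ n = - 1"
  by (cases "even n") auto

text \<open>One family \<open>U\<close> serves for the X and the Z parts, since every code here has
  the same X and Z generators.\<close>

definition pauli_ops :: "complex set \<Rightarrow> 'a set set \<Rightarrow> 'a operator set" where
  "pauli_ops W U = {pauli_op w a b | w a b. w \<in> W \<and> a \<in> U \<and> b \<in> U}"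

text \<open>Bringing a product back to normal form costs the sign of an overlap, so \<open>W\<close>
  has to contain these signs. If all overlaps are even, \<open>W = {1}\<close> is enough.\<close>

lemma pauli_ops_subgroup:
  assumes W: "1 \<in> W" "0 \<notin> W" "\<And>v w. v \<in> W \<Longrightarrow> w \<in> W \<Longrightarrow> v * w \<in> W" "\<And>w. w \<in> W \<Longrightarrow> inverse w \<in> W"
    and U: "{} \<in> U" "\<And>a b. a \<in> U \<Longrightarrow> b \<in> U \<Longrightarrow> sym_diff a b \<in> U" "\<And>a. a \<in> U \<Longrightarrow> finite a"
    and sgn: "\<And>a b. a \<in> U \<Longrightarrow> b \<in> U \<Longrightarrow> (- 1) ^ card (a \<inter> b) \<in> W"
  shows "subgroup (pauli_ops W U) op_group"
proof
  show "pauli_ops W U \<subseteq> carrier op_group"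
    using W(2) U(3) unfolding pauli_ops_def by (auto intro!: pauli_op_carrier)
  show "\<one>\<^bsub>op_group\<^esub> \<in> pauli_ops W U"
    using W(1) U(1) unfolding one_pauli_op pauli_ops_def by blast
next
  fix x y assume "x \<in> pauli_ops W U" "y \<in> pauli_ops W U"
  then obtain w a b w' a' b' where x: "x = pauli_op w a b" "w \<in> W" "a \<in> U" "b \<in> U"
    and y: "y = pauli_op w' a' b'" "w' \<in> W" "a' \<in> U" "b' \<in> U"
    unfolding pauli_ops_def by blast
  have "x \<otimes>\<^bsub>op_group\<^esub> y = pauli_op (w * w' * (- 1) ^ card (a \<inter> b')) (sym_diff a a') (sym_diff b b')"
    unfolding x(1) y(1) by (rule pauli_op_mult) (use x y W(2) U(3) in auto)
  moreover have "w * w' * (- 1) ^ card (a \<inter> b') \<in> W"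
    using x y W(3) sgn by blast
  ultimately show "x \<otimes>\<^bsub>op_group\<^esub> y \<in> pauli_ops W U"
    unfolding pauli_ops_def using x y U(2) by blast
next
  fix x assume "x \<in> pauli_ops W U"
  then obtain w a b where x: "x = pauli_op w a b" "w \<in> W" "a \<in> U" "b \<in> U"
    unfolding pauli_ops_def by blast
  let ?v = "inverse w * (- 1) ^ card (a \<inter> b)"
  have v: "?v \<in> W" using x W(3,4) sgn by blast
  then have nz: "?v \<noteq> 0" "w \<noteq> 0" using W(2) x(2) by metis+
  have "?v * w * (- 1) ^ card (a \<inter> b) = 1"
    using nz(2) minus_one_power_cases[of "card (a \<inter> b)"] by auto
  moreover have "pauli_op ?v a b \<otimes>\<^bsub>op_group\<^esub> x
      = pauli_op (?v * w * (- 1) ^ card (a \<inter> b)) (sym_diff a a) (sym_diff b b)"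
    unfolding x(1) by (rule pauli_op_mult) (use nz x U(3) in auto)
  ultimately have "pauli_op ?v a b \<otimes>\<^bsub>op_group\<^esub> x = \<one>\<^bsub>op_group\<^esub>"
    unfolding one_pauli_op by (simp only: Diff_cancel Un_empty_left)
  then have "inv\<^bsub>op_group\<^esub> x = pauli_op ?v a b"
    by (intro group.inv_equality[OF op_group_is_group])
      (use nz x U(3) in \<open>auto intro: pauli_op_carrier\<close>)
  then show "inv\<^bsub>op_group\<^esub> x \<in> pauli_ops W U"
    unfolding pauli_ops_def using v x by blast
qed

lemma XZ_carrier:
  assumes "\<And>a. a \<in> A \<Longrightarrow> finite a"
  shows "X_op ` A \<union> Z_op ` A \<subseteq> carrier op_group"
  using assms by (auto simp: X_op_pauli_op Z_op_pauli_op intro: pauli_op_carrier)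

lemma XZ_subgroup: "(\<And>a. a \<in> A \<Longrightarrow> finite a) \<Longrightarrow> subgroup (XZ_group A) op_group"
  unfolding XZ_group_def
  by (intro group.generate_is_subgroup[OF op_group_is_group] XZ_carrier)

lemma XZ_group_least:
  assumes "subgroup H op_group" "\<And>a. a \<in> A \<Longrightarrow> pauli_op 1 a {} \<in> H" "\<And>a. a \<in> A \<Longrightarrow> pauli_op 1 {} a \<in> H"
  shows "XZ_group A \<subseteq> H"
  unfolding XZ_group_def
  by (rule group.generate_subgroup_incl[OF op_group_is_group])
    (use assms in \<open>auto simp: X_op_pauli_op Z_op_pauli_op\<close>)

lemma xor_span_finite: "(\<And>a. a \<in> A \<Longrightarrow> finite a) \<Longrightarrow> a \<in> xor_span A \<Longrightarrow> finite a"
  using xor_span_even[of a A "{}"] by simp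

lemma XZ_group_upper:
  assumes "\<And>a. a \<in> A \<Longrightarrow> finite a"
  shows "XZ_group A \<subseteq> pauli_ops {1, - 1} (xor_span A)"
proof (rule XZ_group_least)
  show "subgroup (pauli_ops {1, - 1} (xor_span A)) op_group"
    by (rule pauli_ops_subgroup)
      (use assms minus_one_power_cases in \<open>auto intro: xor_span.empty xor_span_sym_diff xor_span_finite\<close>)
qed (auto simp: pauli_ops_def intro: xor_span.empty xor_span_base)

text \<open>Even overlaps leave no sign behind. This keeps - 1 out of the stabilizer groups and
  makes the stabilizer inclusion exact.\<close>

lemma XZ_group_upper_commuting:
  assumes "\<And>a. a \<in> A \<Longrightarrow> finite a" "\<And>a b. a \<in> A \<Longrightarrow> b \<in> A \<Longrightarrow> even (card (a \<inter> b))"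
  shows "XZ_group A \<subseteq> pauli_ops {1} (xor_span A)"
proof (rule XZ_group_least)
  show "subgroup (pauli_ops {1} (xor_span A)) op_group"
  proof (rule pauli_ops_subgroup)
    fix a b assume "a \<in> xor_span A" "b \<in> xor_span A"
    then have "even (card (a \<inter> b))"
      using xor_span_even_pairs[of A A a b] assms by blast
    then show "(- 1) ^ card (a \<inter> b) \<in> {1 :: complex}" by simp
  qed (use assms in \<open>auto intro: xor_span.empty xor_span_sym_diff xor_span_finite\<close>)
qed (auto simp: pauli_ops_def intro: xor_span.empty xor_span_base)

lemma pauli_op_in_subgroup:
  assumes H: "subgroup H op_group" and fin: "\<And>a. a \<in> A \<Longrightarrow> finite a"
    and X: "\<And>a. a \<in> A \<Longrightarrow> pauli_op 1 a {} \<in> H" and Z: "\<And>a. a \<in> A \<Longrightarrow> pauli_op 1 {} a \<in> H"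
    and ab: "a \<in> xor_span A" "b \<in> xor_span A"
  shows "pauli_op 1 a b \<in> H"
proof -
  have one: "pauli_op 1 {} {} \<in> H"
    using subgroup.one_closed[OF H] by (simp add: one_pauli_op)
  have "pauli_op 1 a {} \<in> H"
    using ab(1)
  proof induction
    case (add a g)
    then show ?case
      using subgroup.m_closed[OF H add.IH X[of g]] by (simp add: pauli_op_mult)
  qed (rule one)
  moreover have "pauli_op 1 {} b \<in> H"
    using ab(2)
  proof induction
    case (add b g)
    then show ?case
      using subgroup.m_closed[OF H add.IH Z[of g]] fin[of g] xor_span_finite[of A b, OF fin]
      by (simp add: pauli_op_mult)
  qed (rule one)
  \<comment> \<open>With the Z factor on the left, the product is already in normal form and carries
    no sign.\<close>
  ultimately show ?thesis
    using subgroup.m_closed[OF H, of "pauli_op 1 {} b" "pauli_op 1 a {}"] xor_span_finite[OF fin ab(2)]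
    by (simp add: pauli_op_mult)
qed

lemma XZ_group_lower:
  assumes "\<And>a. a \<in> A \<Longrightarrow> finite a" "a \<in> xor_span A" "b \<in> xor_span A"
  shows "pauli_op 1 a b \<in> XZ_group A"
proof (rule pauli_op_in_subgroup[of _ A])
  show "pauli_op 1 a {} \<in> XZ_group A" "pauli_op 1 {} a \<in> XZ_group A" if "a \<in> A" for a
    using that unfolding XZ_group_def X_op_pauli_op[symmetric] Z_op_pauli_op[symmetric]
    by (auto intro: generate.incl)
qed (use assms XZ_subgroup in auto)

section \<open>Phases and the full Pauli group\<close>

definition iphases :: "complex set" where
  "iphases = range (\<lambda>k :: nat. \<i> ^ k)"

lemma phases_pauli_op: "phases = {pauli_op w {} {} | w. w \<in> iphases}"
  unfolding phases_def iphases_def phase_pauli_op by blast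

lemma iphases_mult: "v \<in> iphases \<Longrightarrow> w \<in> iphases \<Longrightarrow> v * w \<in> iphases"
  unfolding iphases_def by (auto simp flip: power_add)

lemma iphases_basic: "1 \<in> iphases" "- 1 \<in> iphases" "0 \<notin> iphases" "\<i> \<in> iphases"
proof -
  have "\<i> ^ 0 \<in> iphases" "\<i> ^ 1 \<in> iphases" "\<i> ^ 2 \<in> iphases" unfolding iphases_def by blast+
  then show "1 \<in> iphases" "- 1 \<in> iphases" "\<i> \<in> iphases" by simp_all
  show "0 \<notin> iphases" unfolding iphases_def by auto
qed

lemma iphases_inverse: "w \<in> iphases \<Longrightarrow> inverse w \<in> iphases"
proof -
  assume "w \<in> iphases"
  then obtain k where k: "w = \<i> ^ k" unfolding iphases_def by blast
  have "\<i> ^ 4 = (1 :: complex)"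
    using power_mult[of \<i> 2 2] by simp
  \<comment> \<open>The exponent is chosen so that \<open>k + 3 * k\<close> is a multiple of
    4.\<close>
  moreover have "w * \<i> ^ (3 * k) = (\<i> ^ 4) ^ k"
    by (simp add: k flip: power_add power_mult)
  ultimately have "w * \<i> ^ (3 * k) = 1" by simp
  then have "inverse w = \<i> ^ (3 * k)"
    by (rule inverse_unique)
  then show ?thesis unfolding iphases_def by blast
qed

lemma sign_in_iphases: "(- 1) ^ n \<in> iphases"
  using minus_one_power_cases[of n] iphases_basic by auto

lemma pauli_ops_iphases_subgroup:
  assumes "{} \<in> U" "\<And>a b. a \<in> U \<Longrightarrow> b \<in> U \<Longrightarrow> sym_diff a b \<in> U" "\<And>a. a \<in> U \<Longrightarrow> finite a"
  shows "subgroup (pauli_ops iphases U) op_group"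
  by (rule pauli_ops_subgroup)
    (use assms iphases_basic iphases_mult iphases_inverse sign_in_iphases in auto)

lemma pauli_ops_mono: "W \<subseteq> W' \<Longrightarrow> U \<subseteq> U' \<Longrightarrow> pauli_ops W U \<subseteq> pauli_ops W' U'"
  unfolding pauli_ops_def by blast

lemma pauli_op_scale:
  assumes "w \<noteq> 0" "v \<noteq> 0" "finite b"
  shows "pauli_op w {} {} \<otimes>\<^bsub>op_group\<^esub> pauli_op v a b = pauli_op (w * v) a b"
  using assms by (simp add: pauli_op_mult)

lemma pauli_eq:
  assumes "finite N"
  shows "pauli N = pauli_ops iphases (Pow N)"
proof
  have fin: "\<And>a. a \<in> Pow N \<Longrightarrow> finite a"
    using assms by (auto intro: finite_subset)
  show "pauli N \<subseteq> pauli_ops iphases (Pow N)"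
    unfolding pauli_def
  proof (rule group.generate_subgroup_incl[OF op_group_is_group])
    show "subgroup (pauli_ops iphases (Pow N)) op_group"
      by (rule pauli_ops_iphases_subgroup) (use fin in auto)
  qed (auto simp: pauli_ops_def X_op_pauli_op Z_op_pauli_op phase_pauli_op intro!: iphases_basic exI)
  let ?gens = "{phase \<i>} \<union> (\<lambda>v. X_op {v}) ` N \<union> (\<lambda>v. Z_op {v}) ` N"
  have H: "subgroup (pauli N) op_group"
    unfolding pauli_def
    by (rule group.generate_is_subgroup[OF op_group_is_group])
      (auto simp: X_op_pauli_op Z_op_pauli_op phase_pauli_op intro: pauli_op_carrier)
  have gens: "?gens \<subseteq> pauli N"
    unfolding pauli_def by (auto intro: generate.incl)
  have xor_span: "a \<in> xor_span ((\<lambda>v. {v}) ` N)" if "a \<subseteq> N" for a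
  proof -
    have "finite a" using that assms finite_subset by blast
    then show ?thesis using that
    proof induction
      case (insert v a)
      then show ?case
        using xor_span.add[of a "(\<lambda>v. {v}) ` N" "{v}"] by (simp add: Diff_triv)
    qed (rule xor_span.empty)
  qed
  show "pauli_ops iphases (Pow N) \<subseteq> pauli N"
  proof
    fix x assume "x \<in> pauli_ops iphases (Pow N)"
    then obtain k a b where x: "x = pauli_op (\<i> ^ k) a b" "a \<subseteq> N" "b \<subseteq> N"
      unfolding pauli_ops_def iphases_def by blast
    have "pauli_op (\<i> ^ k) {} {} \<in> pauli N" for k
    proof (induction k)
      case 0
      then show ?case using subgroup.one_closed[OF H] by (simp add: one_pauli_op)
    next
      case (Suc k)
      have "pauli_op \<i> {} {} \<in> pauli N" using gens by (auto simp: phase_pauli_op)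
      from subgroup.m_closed[OF H this Suc] show ?case by (simp add: pauli_op_mult)
    qed
    moreover have "pauli_op 1 a b \<in> pauli N"
    proof (rule pauli_op_in_subgroup[OF H, of "(\<lambda>v. {v}) ` N"])
      show "pauli_op 1 a {} \<in> pauli N" "pauli_op 1 {} a \<in> pauli N" if "a \<in> (\<lambda>v. {v}) ` N" for a
        using gens that by (auto simp: X_op_pauli_op[symmetric] Z_op_pauli_op[symmetric])
    qed (use x xor_span in auto)
    ultimately have "pauli_op (\<i> ^ k) {} {} \<otimes>\<^bsub>op_group\<^esub> pauli_op 1 a b \<in> pauli N"
      by (rule subgroup.m_closed[OF H])
    then show "x \<in> pauli N"
      using x fin[of b] by (simp add: pauli_op_scale)
  qed
qed

section \<open>Commutation, centralizers and equality up to phases\<close>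

lemma pauli_op_commute_iff:
  assumes "w \<noteq> 0" "w' \<noteq> 0" "finite b" "finite b'"
  shows "pauli_op w a b \<otimes>\<^bsub>op_group\<^esub> pauli_op w' a' b' = pauli_op w' a' b' \<otimes>\<^bsub>op_group\<^esub> pauli_op w a b
    \<longleftrightarrow> (even (card (a \<inter> b')) \<longleftrightarrow> even (card (a' \<inter> b)))"
proof -
  have "pauli_op w a b \<otimes>\<^bsub>op_group\<^esub> pauli_op w' a' b' = pauli_op w' a' b' \<otimes>\<^bsub>op_group\<^esub> pauli_op w a b
    \<longleftrightarrow> w * w' * (- 1) ^ card (a \<inter> b') = w' * w * (- 1) ^ card (a' \<inter> b)"
    (is "_ \<longleftrightarrow> ?s = ?t")
  proof
    assume "pauli_op w a b \<otimes>\<^bsub>op_group\<^esub> pauli_op w' a' b' = pauli_op w' a' b' \<otimes>\<^bsub>op_group\<^esub> pauli_op w a b"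
    then have "pauli_op ?s (sym_diff a a') (sym_diff b b') = pauli_op ?t (sym_diff a' a) (sym_diff b' b)"
      using assms by (simp add: pauli_op_mult)
    from pauli_op_inj[OF this] show "?s = ?t" using assms by simp
  next
    assume "?s = ?t"
    then show "pauli_op w a b \<otimes>\<^bsub>op_group\<^esub> pauli_op w' a' b' = pauli_op w' a' b' \<otimes>\<^bsub>op_group\<^esub> pauli_op w a b"
      using assms by (simp add: pauli_op_mult Un_commute mult.commute)
  qed
  also have "\<dots> \<longleftrightarrow> (- 1 :: complex) ^ card (a \<inter> b') = (- 1) ^ card (a' \<inter> b)"
    using assms(1,2) by (simp add: mult.commute)
  also have "\<dots> \<longleftrightarrow> (even (card (a \<inter> b')) \<longleftrightarrow> even (card (a' \<inter> b)))"
    by (cases "even (card (a \<inter> b'))"; cases "even (card (a' \<inter> b))") auto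
  finally show ?thesis .
qed

text \<open>Testing against pure X generators constrains only the Z part and conversely, so both
  supports are subject to the same orthogonality condition, independently of each other.\<close>

lemma centralizer_eq:
  assumes N: "finite N" and A: "A \<subseteq> Pow N"
  shows "centralizer N (XZ_group A) = pauli_ops iphases (perp N A)"
proof -
  have fin: "finite a" if "a \<in> A" for a
    using that A N by (auto intro: finite_subset)
  have finN: "finite a" if "a \<subseteq> N" for a
    using that N by (auto intro: finite_subset)
  show ?thesis
  proof (intro equalityI subsetI)
    fix P assume P: "P \<in> centralizer N (XZ_group A)"
    then obtain w a b where pauli_op: "P = pauli_op w a b" "w \<in> iphases" "a \<subseteq> N" "b \<subseteq> N"
      unfolding centralizer_def pauli_eq[OF N] pauli_ops_def by blast
    have w: "w \<noteq> 0" using pauli_op(2) iphases_basic by metis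
    have "even (card (a \<inter> p)) \<and> even (card (b \<inter> p))" if p: "p \<in> A" for p
    proof -
      have "pauli_op 1 p {} \<in> XZ_group A" "pauli_op 1 {} p \<in> XZ_group A"
        using p by (auto intro!: XZ_group_lower fin intro: xor_span_base xor_span.empty)
      then have "P \<otimes>\<^bsub>op_group\<^esub> pauli_op 1 p {} = pauli_op 1 p {} \<otimes>\<^bsub>op_group\<^esub> P"
        "P \<otimes>\<^bsub>op_group\<^esub> pauli_op 1 {} p = pauli_op 1 {} p \<otimes>\<^bsub>op_group\<^esub> P"
        using P unfolding centralizer_def by blast+
      then show ?thesis
        unfolding pauli_op(1) using w finN[OF pauli_op(4)] fin[OF p]
        by (simp add: pauli_op_commute_iff Int_commute)
    qed
    then show "P \<in> pauli_ops iphases (perp N A)"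
      unfolding pauli_ops_def perp_def using pauli_op by blast
  next
    fix P assume "P \<in> pauli_ops iphases (perp N A)"
    then obtain w a b where pauli_op: "P = pauli_op w a b" "w \<in> iphases" "a \<in> perp N A" "b \<in> perp N A"
      unfolding pauli_ops_def by blast
    have w: "w \<noteq> 0" using pauli_op(2) iphases_basic by metis
    have ab: "a \<subseteq> N" "b \<subseteq> N" using pauli_op unfolding perp_def by auto
    have "P \<otimes>\<^bsub>op_group\<^esub> R = R \<otimes>\<^bsub>op_group\<^esub> P" if R_in: "R \<in> XZ_group A" for R
    proof -
      obtain v c d where R: "R = pauli_op v c d" "v \<in> {1, - 1}" "c \<in> xor_span A" "d \<in> xor_span A"
        using XZ_group_upper[OF fin] R_in unfolding pauli_ops_def by blast
      have "even (card (d \<inter> a))" "even (card (c \<inter> b))" "finite d"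
        using xor_span_even[of d A a] xor_span_even[of c A b] R pauli_op(3,4) fin
        unfolding perp_def by (auto simp: Int_commute)
      then show ?thesis
        unfolding pauli_op(1) R(1) using w R(2) finN[OF ab(2)]
        by (subst pauli_op_commute_iff) (auto simp: Int_commute)
    qed
    then show "P \<in> centralizer N (XZ_group A)"
      unfolding centralizer_def pauli_eq[OF N] using pauli_op ab unfolding pauli_ops_def by blast
  qed
qed

text \<open>Once all phases are allowed only the supports matter, so equality up to phases becomes
  equality of families of sets.\<close>

lemma phases_set_mult:
  assumes "H \<subseteq> pauli_ops iphases U" "\<And>a b. a \<in> U \<Longrightarrow> b \<in> U \<Longrightarrow> pauli_op 1 a b \<in> H"
    "\<And>a. a \<in> U \<Longrightarrow> finite a"
  shows "phases <#>\<^bsub>op_group\<^esub> H = pauli_ops iphases U"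
proof (intro equalityI subsetI)
  fix x assume "x \<in> phases <#>\<^bsub>op_group\<^esub> H"
  then obtain w h where h: "w \<in> iphases" "h \<in> H" "x = pauli_op w {} {} \<otimes>\<^bsub>op_group\<^esub> h"
    unfolding set_mult_def phases_pauli_op by blast
  then obtain v a b where v: "h = pauli_op v a b" "v \<in> iphases" "a \<in> U" "b \<in> U"
    using assms(1) unfolding pauli_ops_def by blast
  have "w \<noteq> 0" "v \<noteq> 0" using h(1) v(2) iphases_basic by metis+
  then have "x = pauli_op (w * v) a b"
    using h(3) v assms(3) by (simp add: pauli_op_scale)
  then show "x \<in> pauli_ops iphases U"
    using iphases_mult[OF h(1) v(2)] v(3,4) unfolding pauli_ops_def by blast
next
  fix x assume "x \<in> pauli_ops iphases U"
  then obtain w a b where x: "x = pauli_op w a b" "w \<in> iphases" "a \<in> U" "b \<in> U"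
    unfolding pauli_ops_def by blast
  have "w \<noteq> 0" using x(2) iphases_basic by metis
  then have "x = pauli_op w {} {} \<otimes>\<^bsub>op_group\<^esub> pauli_op 1 a b"
    using x assms(3) by (simp add: pauli_op_scale)
  then show "x \<in> phases <#>\<^bsub>op_group\<^esub> H"
    unfolding set_mult_def phases_pauli_op using x assms(2) by blast
qed

lemma signs_iphases: "{1, - 1} \<subseteq> iphases" "{1} \<subseteq> iphases"
  using iphases_basic by auto

lemma phases_XZ_group:
  assumes "\<And>a. a \<in> A \<Longrightarrow> finite a"
  shows "phases <#>\<^bsub>op_group\<^esub> XZ_group A = pauli_ops iphases (xor_span A)"
proof (rule phases_set_mult)
  show "XZ_group A \<subseteq> pauli_ops iphases (xor_span A)"
    using XZ_group_upper[OF assms] pauli_ops_mono[OF signs_iphases(1) subset_refl] by blast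
  show "pauli_op 1 a b \<in> XZ_group A" if "a \<in> xor_span A" "b \<in> xor_span A" for a b
    using XZ_group_lower[OF assms that] .
  show "finite a" if "a \<in> xor_span A" for a
    using xor_span_finite[OF assms that] .
qed

lemma phases_centralizer:
  assumes "finite N" "A \<subseteq> Pow N"
  shows "phases <#>\<^bsub>op_group\<^esub> centralizer N (XZ_group A) = pauli_ops iphases (perp N A)"
proof (rule phases_set_mult)
  show "finite a" if "a \<in> perp N A" for a
    using that assms(1) unfolding perp_def by (auto intro: finite_subset)
  show "pauli_op 1 a b \<in> centralizer N (XZ_group A)" if "a \<in> perp N A" "b \<in> perp N A" for a b
    unfolding centralizer_eq[OF assms] pauli_ops_def using that iphases_basic by blast
qed (simp add: centralizer_eq[OF assms])

text \<open>Supports are determined by the operator, so an operator lying in both groups has its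
  supports in both families.\<close>

lemma phases_XZ_centralizer:
  assumes N: "finite N" and A: "A \<subseteq> Pow N"
  shows "phases <#>\<^bsub>op_group\<^esub> (XZ_group A \<inter> centralizer N (XZ_group A))
    = pauli_ops iphases (xor_span A \<inter> perp N A)"
proof -
  have fin: "finite a" if "a \<in> A" for a
    using that A N by (auto intro: finite_subset)
  have finN: "finite a" if "a \<in> perp N A" for a
    using that N unfolding perp_def by (auto intro: finite_subset)
  show ?thesis
  proof (rule phases_set_mult)
    show "XZ_group A \<inter> centralizer N (XZ_group A) \<subseteq> pauli_ops iphases (xor_span A \<inter> perp N A)"
    proof
      fix x assume x: "x \<in> XZ_group A \<inter> centralizer N (XZ_group A)"
      then obtain v c d where v: "x = pauli_op v c d" "v \<in> {1, - 1}" "c \<in> xor_span A" "d \<in> xor_span A"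
        using XZ_group_upper[OF fin] unfolding pauli_ops_def by blast
      obtain w a b where w: "x = pauli_op w a b" "w \<in> iphases" "a \<in> perp N A" "b \<in> perp N A"
        using x unfolding centralizer_eq[OF N A] pauli_ops_def by blast
      have "w \<noteq> 0" using w(2) iphases_basic by metis
      then have "w = v \<and> a = c \<and> b = d"
        using pauli_op_inj[of w a b v c d] v w finN xor_span_finite[OF fin] by auto
      then show "x \<in> pauli_ops iphases (xor_span A \<inter> perp N A)"
        unfolding pauli_ops_def using v w by blast
    qed
    show "pauli_op 1 a b \<in> XZ_group A \<inter> centralizer N (XZ_group A)"
      if "a \<in> xor_span A \<inter> perp N A" "b \<in> xor_span A \<inter> perp N A" for a b
      unfolding centralizer_eq[OF N A] pauli_ops_def
      using that XZ_group_lower[of A a b] fin iphases_basic by blast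
  qed (use finN in auto)
qed

lemma minus_one_notin_XZ_group:
  assumes "\<And>a. a \<in> A \<Longrightarrow> finite a" "\<And>a b. a \<in> A \<Longrightarrow> b \<in> A \<Longrightarrow> even (card (a \<inter> b))"
  shows "phase (- 1) \<notin> XZ_group A"
proof
  assume "phase (- 1) \<in> XZ_group A"
  then obtain a b where "pauli_op (- 1) {} {} = pauli_op 1 a b" "b \<in> xor_span A"
    using XZ_group_upper_commuting[OF assms] unfolding pauli_ops_def phase_pauli_op by blast
  then show False
    using pauli_op_inj[of "- 1" "{}" "{}" 1 a b] xor_span_finite[OF assms(1)] by auto
qed

section \<open>CSS codes and their logical operators\<close>

lemma css_code:
  assumes N: "finite N" and S: "S \<subseteq> Pow N" and G: "G \<subseteq> Pow N"
    and commuting: "\<And>a b. a \<in> S \<Longrightarrow> b \<in> S \<Longrightarrow> even (card (a \<inter> b))"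
    and center: "xor_span S = xor_span G \<inter> perp N G"
  shows "stabilizer_subsystem_code N (XZ_group S) (XZ_group G)"
proof -
  have fin: "finite a" if "a \<in> S \<union> G" for a
    using that S G N by (auto intro: finite_subset)
  have "XZ_group A \<subseteq> pauli N" if "A \<subseteq> Pow N" "\<And>a. a \<in> A \<Longrightarrow> finite a" for A
    unfolding pauli_eq[OF N]
    using XZ_group_upper[of A] that pauli_ops_mono[OF signs_iphases(1) xor_span_subset_Pow[OF that(1)]]
    by blast
  then show ?thesis
    unfolding stabilizer_subsystem_code_def eq_up_to_phases_def
    using S G fin commuting center
    by (simp add: XZ_subgroup minus_one_notin_XZ_group phases_XZ_group
        phases_XZ_centralizer[OF N G])
qed

lemma logically_equivalent_pauli_op:
  assumes w: "w \<in> iphases" "v \<in> iphases" and fin: "\<And>a. a \<in> S \<Longrightarrow> finite a"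
    and fab: "finite a" "finite b" "finite c" "finite d"
  shows "logically_equivalent (XZ_group S) (pauli_op w a b) (pauli_op v c d) \<longleftrightarrow>
    sym_diff a c \<in> xor_span S \<and> sym_diff b d \<in> xor_span S"
proof
  have nz: "w \<noteq> 0" "v \<noteq> 0" using w iphases_basic by metis+
  {
    assume "logically_equivalent (XZ_group S) (pauli_op w a b) (pauli_op v c d)"
    then obtain u t p q where u: "u \<in> iphases" "t \<in> {1, - 1}" "p \<in> xor_span S" "q \<in> xor_span S"
      and eq: "pauli_op w a b = pauli_op u {} {} \<otimes>\<^bsub>op_group\<^esub> pauli_op t p q \<otimes>\<^bsub>op_group\<^esub> pauli_op v c d"
      using XZ_group_upper[OF fin] unfolding logically_equivalent_def phases_pauli_op pauli_ops_def
      by blast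
    have nz': "u \<noteq> 0" "t \<noteq> 0" using u(1,2) iphases_basic by (metis, auto)
    have fq: "finite q" using xor_span_finite[OF fin u(4)] .
    have "pauli_op w a b = pauli_op (u * t * v * (- 1) ^ card (p \<inter> d)) (sym_diff p c) (sym_diff q d)"
      unfolding eq using nz nz' fab fq by (simp add: pauli_op_scale pauli_op_mult)
    then have "a = sym_diff p c \<and> b = sym_diff q d"
      using pauli_op_inj nz(1) fab fq by blast
    then have "sym_diff a c = p" "sym_diff b d = q" by blast+
    then show "sym_diff a c \<in> xor_span S \<and> sym_diff b d \<in> xor_span S" using u by simp
  }
  assume pq: "sym_diff a c \<in> xor_span S \<and> sym_diff b d \<in> xor_span S"
  let ?p = "sym_diff a c" and ?q = "sym_diff b d"
  \<comment> \<open>Corrects the coefficient from \<open>v\<close> to \<open>w\<close> and cancels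
    the sign from moving the Z part of the stabilizer representative into normal form with the other
    factor.\<close>
  let ?u = "w * inverse v * (- 1) ^ card (?p \<inter> d)"
  have u: "?u \<in> iphases"
    by (intro iphases_mult iphases_inverse w sign_in_iphases)
  have "pauli_op ?u {} {} \<otimes>\<^bsub>op_group\<^esub> pauli_op 1 ?p ?q \<otimes>\<^bsub>op_group\<^esub> pauli_op v c d
      = pauli_op (?u * v * (- 1) ^ card (?p \<inter> d)) (sym_diff ?p c) (sym_diff ?q d)"
    using nz fab u by (simp add: pauli_op_scale pauli_op_mult)
  also have "\<dots> = pauli_op w a b"
  proof -
    have "sym_diff ?p c = a" "sym_diff ?q d = b" by blast+
    moreover have "?u * v * (- 1) ^ card (?p \<inter> d) = w"
      using nz(2) minus_one_power_cases[of "card (?p \<inter> d)"] by auto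
    ultimately show ?thesis by (simp only:)
  qed
  finally have "pauli_op w a b = pauli_op ?u {} {} \<otimes>\<^bsub>op_group\<^esub> pauli_op 1 ?p ?q \<otimes>\<^bsub>op_group\<^esub> pauli_op v c d" ..
  moreover have "pauli_op 1 ?p ?q \<in> XZ_group S"
    using XZ_group_lower[of S ?p ?q] fin pq by blast
  moreover have "pauli_op ?u {} {} \<in> phases"
    unfolding phases_pauli_op using u by blast
  ultimately show "logically_equivalent (XZ_group S) (pauli_op w a b) (pauli_op v c d)"
    unfolding logically_equivalent_def
    by (intro bexI[of _ "pauli_op ?u {} {}"] bexI[of _ "pauli_op 1 ?p ?q"])
qed

text \<open>Two representatives of one class differ by an element of both spans, so
  \<open>indep\<close> leaves only a phase between them. The empty family \<open>L\<close> is the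
  case without logical qubits.\<close>

lemma css_representative_group:
  assumes N: "finite N" and S: "S \<subseteq> Pow N" and G: "G \<subseteq> Pow N" and L: "L \<subseteq> Pow N"
    and indep: "xor_span L \<inter> xor_span S = {{}}"
    and perp: "perp N G = {sym_diff l s | l s. l \<in> xor_span L \<and> s \<in> xor_span S}"
  shows "representative_group N (XZ_group S) (XZ_group G) (XZ_group L)"
proof -
  have finS: "finite a" if "a \<in> S" for a
    using that S N finite_subset[of a N] by blast
  have finL: "finite a" if "a \<in> L" for a
    using that L N finite_subset[of a N] by blast
  have perpI: "l \<in> perp N G" if "l \<in> xor_span L" for l
    unfolding perp using that xor_span.empty[of S] by force
  show ?thesis
    unfolding representative_group_def
  proof (intro conjI ballI)
    show "subgroup (XZ_group L) op_group"
      using XZ_subgroup finL by blast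
    show "XZ_group L \<subseteq> centralizer N (XZ_group G)"
      unfolding centralizer_eq[OF N G]
      using XZ_group_upper[OF finL] pauli_ops_mono[OF signs_iphases(1), of "xor_span L" "perp N G"] perpI
      by blast
    fix P assume "P \<in> centralizer N (XZ_group G)"
    then obtain w a b where P: "P = pauli_op w a b" "w \<in> iphases" "a \<in> perp N G" "b \<in> perp N G"
      unfolding centralizer_eq[OF N G] pauli_ops_def by blast
    have fab: "finite a" "finite b"
      using P(3,4) N finite_subset[of _ N] unfolding perp_def by blast+
    obtain l s where l: "a = sym_diff l s" "l \<in> xor_span L" "s \<in> xor_span S" using P(3) unfolding perp by blast
    obtain m t where m: "b = sym_diff m t" "m \<in> xor_span L" "t \<in> xor_span S" using P(4) unfolding perp by blast
    have flm: "finite l" "finite m" using xor_span_finite[OF finL] l m by auto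
    have "logically_equivalent (XZ_group S) P (pauli_op 1 l m)"
      unfolding P(1)
    proof (subst logically_equivalent_pauli_op)
      have "sym_diff a l = s" "sym_diff b m = t" using l(1) m(1) by blast+
      then show "sym_diff a l \<in> xor_span S \<and> sym_diff b m \<in> xor_span S" using l m by simp
    qed (use P(2) iphases_basic finS fab flm in auto)
    moreover have "\<exists>w\<in>phases. R' = w \<otimes>\<^bsub>op_group\<^esub> pauli_op 1 l m"
      if R': "R' \<in> XZ_group L" and le: "logically_equivalent (XZ_group S) P R'" for R'
    proof -
      obtain v c d where v: "R' = pauli_op v c d" "v \<in> {1, - 1}" "c \<in> xor_span L" "d \<in> xor_span L"
        using XZ_group_upper[OF finL] R' unfolding pauli_ops_def by blast
      have fcd: "finite c" "finite d" using xor_span_finite[OF finL] v by auto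
      have "sym_diff a c \<in> xor_span S \<and> sym_diff b d \<in> xor_span S"
        using le unfolding P(1) v(1)
        by (subst (asm) logically_equivalent_pauli_op)
          (use P(2) v(2) signs_iphases finS fab fcd in auto)
      then have "sym_diff s (sym_diff a c) \<in> xor_span S" "sym_diff t (sym_diff b d) \<in> xor_span S"
        using l m by (auto intro: xor_span_sym_diff)
      moreover have "sym_diff s (sym_diff a c) = sym_diff l c"
        "sym_diff t (sym_diff b d) = sym_diff m d"
        using l(1) m(1) by blast+
      ultimately have "sym_diff l c \<in> xor_span L \<inter> xor_span S" "sym_diff m d \<in> xor_span L \<inter> xor_span S"
        using xor_span_sym_diff[of l L c] xor_span_sym_diff[of m L d] l m v by auto
      then have "l = c" "m = d" unfolding indep by blast+
      then have "R' = pauli_op v {} {} \<otimes>\<^bsub>op_group\<^esub> pauli_op 1 l m"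
        using v(1,2) flm by (auto simp: pauli_op_scale)
      then show ?thesis
        unfolding phases_pauli_op using v(2) signs_iphases by blast
    qed
    ultimately show "\<exists>R\<in>XZ_group L. logically_equivalent (XZ_group S) P R \<and>
        (\<forall>R'\<in>XZ_group L. logically_equivalent (XZ_group S) P R' \<longrightarrow>
          (\<exists>w\<in>phases. R' = w \<otimes>\<^bsub>op_group\<^esub> R))"
      using XZ_group_lower[OF finL l(2) m(2)] by blast
  qed
qed

lemma css_logical_qubit:
  assumes N: "finite N" and S: "S \<subseteq> Pow N" and G: "G \<subseteq> Pow N" and Q: "Q \<subseteq> N"
    and notin: "Q \<notin> xor_span S"
    and perp: "perp N G = {sym_diff l s | l s. l \<in> {{}, Q} \<and> s \<in> xor_span S}"
  shows "logical_qubit N (XZ_group S) (XZ_group G) (X_op Q) (Z_op Q)"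
proof -
  have finS: "finite a" if "a \<in> S" for a
    using that S N finite_subset[of a N] by blast
  have finQ: "finite Q" using Q N finite_subset by blast
  have "Q \<noteq> {}" using notin xor_span.empty by metis
  have 0: "{} \<in> perp N G" unfolding perp_def by simp
  have 1: "Q \<in> perp N G"
    unfolding perp using xor_span.empty[of S] by force
  have XZ: "X_op Q \<otimes>\<^bsub>op_group\<^esub> Z_op Q = pauli_op ((- 1) ^ card Q) Q Q"
    unfolding X_op_pauli_op Z_op_pauli_op using finQ by (simp add: pauli_op_mult)
  \<comment> \<open>The four candidates are indexed by whether \<open>Q\<close> occurs in the X part
    and in the Z part. The product of both carries a reordering sign, which does not affect its
    class.\<close>
  define op where "op i j = (if i then if j then pauli_op ((- 1) ^ card Q) Q Q else pauli_op 1 Q {}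
    else if j then pauli_op 1 {} Q else pauli_op 1 {} {})" for i j
  define sup where "sup i = (if i then Q else {})" for i
  have op: "\<exists>v\<in>iphases. op i j = pauli_op v (sup i) (sup j)" for i j
    unfolding op_def sup_def using sign_in_iphases iphases_basic(1) by auto
  have ops: "{\<one>\<^bsub>op_group\<^esub>, X_op Q, Z_op Q, X_op Q \<otimes>\<^bsub>op_group\<^esub> Z_op Q}
      = {op i j | i j. True}" (is "?R = _")
    unfolding XZ unfolding X_op_pauli_op Z_op_pauli_op one_pauli_op op_def by (auto; metis)
  show ?thesis
    unfolding logical_qubit_def
  proof (intro conjI ballI)
    show "X_op Q \<in> centralizer N (XZ_group G)" "Z_op Q \<in> centralizer N (XZ_group G)"
      unfolding centralizer_eq[OF N G] pauli_ops_def X_op_pauli_op Z_op_pauli_op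
      using 0 1 iphases_basic by blast+
    fix P assume "P \<in> centralizer N (XZ_group G)"
    then obtain w a b where P: "P = pauli_op w a b" "w \<in> iphases" "a \<in> perp N G" "b \<in> perp N G"
      unfolding centralizer_eq[OF N G] pauli_ops_def by blast
    have fab: "finite a" "finite b"
      using P(3,4) N finite_subset[of _ N] unfolding perp_def by blast+
    have le: "logically_equivalent (XZ_group S) P (op i j) \<longleftrightarrow>
        sym_diff a (sup i) \<in> xor_span S \<and> sym_diff b (sup j) \<in> xor_span S" for i j
    proof -
      obtain v where "v \<in> iphases" "op i j = pauli_op v (sup i) (sup j)" using op by blast
      then show ?thesis
        unfolding P(1) using logically_equivalent_pauli_op[of w v S a b "sup i" "sup j"] P(2) finS fab finQ
        by (simp add: sup_def)
    qed
    have unique: "\<exists>!i. sym_diff c (sup i) \<in> xor_span S" if c: "c \<in> perp N G" for c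
    proof -
      obtain l s where l: "c = sym_diff l s" "l \<in> {{}, Q}" "s \<in> xor_span S" using c unfolding perp by blast
      have excl: "\<not> (sym_diff c (sup True) \<in> xor_span S \<and> sym_diff c (sup False) \<in> xor_span S)"
      proof
        assume "sym_diff c (sup True) \<in> xor_span S \<and> sym_diff c (sup False) \<in> xor_span S"
        then have "sym_diff (sym_diff c (sup True)) (sym_diff c (sup False)) \<in> xor_span S"
          using xor_span_sym_diff by blast
        moreover have "sym_diff (sym_diff c (sup True)) (sym_diff c (sup False)) = Q"
          unfolding sup_def by auto
        ultimately show False using notin by simp
      qed
      have "sym_diff c (sup (l = Q)) = s"
        using l(1,2) unfolding sup_def by auto
      then have ex: "sym_diff c (sup (l = Q)) \<in> xor_span S" using l(3) by simp
      show ?thesis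
      proof (intro ex1I[of _ "l = Q"] ex)
        fix i assume "sym_diff c (sup i) \<in> xor_span S"
        with ex excl show "i = (l = Q)" by (cases i; cases "l = Q") simp_all
      qed
    qed
    obtain i where i: "sym_diff a (sup i) \<in> xor_span S"
      "\<And>i'. sym_diff a (sup i') \<in> xor_span S \<Longrightarrow> i' = i"
      using unique[OF P(3)] by blast
    obtain j where j: "sym_diff b (sup j) \<in> xor_span S"
      "\<And>j'. sym_diff b (sup j') \<in> xor_span S \<Longrightarrow> j' = j"
      using unique[OF P(4)] by blast
    show "\<exists>!R. R \<in> ?R \<and> logically_equivalent (XZ_group S) P R"
      unfolding ops
    proof (rule ex1I[of _ "op i j"])
      show "op i j \<in> {op i j |i j. True} \<and> logically_equivalent (XZ_group S) P (op i j)"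
        using le i j by blast
      fix R assume "R \<in> {op i j |i j. True} \<and> logically_equivalent (XZ_group S) P R"
      then show "R = op i j" using le i(2) j(2) by blast
    qed
  qed
qed

section \<open>Order complexes of face posets\<close>

abbreviation comparable :: "'v face \<Rightarrow> 'v face \<Rightarrow> bool" where
  "comparable a b \<equiv> face_le a b \<or> face_le b a"

lemma realization_sum: "x \<in> realization F \<Longrightarrow> (\<Sum>a\<in>F. x a) = 1"
  unfolding realization_def by blast

lemma realization_nonneg: "x \<in> realization F \<Longrightarrow> 0 \<le> x a"
  unfolding realization_def by blast

lemma realization_chain:
  "x \<in> realization F \<Longrightarrow> x a \<noteq> 0 \<Longrightarrow> x b \<noteq> 0 \<Longrightarrow> comparable a b"
  unfolding realization_def by blast

text \<open>The midpoint of an edge of the order complex. Written as a sum of two halves, it also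
  covers \<open>a = b\<close>, where it is a vertex.\<close>

lemma realization_edge_point:
  assumes "finite F" "a \<in> F" "b \<in> F" "comparable a b"
  shows "(\<lambda>c. (if c = a then 1 / 2 else 0) + (if c = b then 1 / 2 else 0)) \<in> realization F"
  using assms unfolding realization_def face_le_def
  by (auto simp: sum.distrib split: if_splits)

text \<open>The open star of \<open>a\<close> is star-shaped: moving towards the vertex
  \<open>a\<close> never enlarges the support of a point, so the supporting chain remains a
  chain.\<close>

lemma realization_star_connected:
  assumes "finite F" "a \<in> F"
  shows "connected {x \<in> realization F. 0 < x a}"
proof -
  let ?V = "{x \<in> realization F. 0 < x a}"
  define seg where "seg x t c = (1 - t) * x c + t * (if c = a then 1 else 0 :: real)" for x t c
  have seg_in: "seg x t \<in> ?V" if x: "x \<in> ?V" and t: "0 \<le> t" "t \<le> 1" for x t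
  proof -
    have xa: "x a \<noteq> 0" "x \<in> realization F" using x by auto
    have supp: "x c \<noteq> 0" if "seg x t c \<noteq> 0" for c
      using that xa unfolding seg_def by (auto split: if_splits)
    have "(\<Sum>c\<in>F. seg x t c) = (1 - t) * (\<Sum>c\<in>F. x c) + t"
      using assms unfolding seg_def sum.distrib
      by (simp add: sum_distrib_left[symmetric] sum.delta)
    then have "(\<Sum>c\<in>F. seg x t c) = 1"
      using realization_sum[OF xa(2)] by simp
    moreover have "0 \<le> seg x t c" for c
      using t realization_nonneg[OF xa(2)] unfolding seg_def by simp
    moreover have "0 < seg x t a"
      using x t unfolding seg_def
      by (cases "t = 1") (auto intro: add_pos_nonneg)
    moreover have "c \<in> F" if "seg x t c \<noteq> 0" for c
      using supp[OF that] xa(2) unfolding realization_def by blast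
    moreover have "comparable c d" if "seg x t c \<noteq> 0" "seg x t d \<noteq> 0" for c d
      using realization_chain[OF xa(2) supp supp] that by blast
    ultimately show ?thesis
      unfolding realization_def by simp
  qed
  have "connected (\<Union>x\<in>?V. seg x ` {0..1})"
  proof (rule connected_Union)
    fix s assume "s \<in> (\<lambda>x. seg x ` {0..1}) ` ?V"
    then obtain x where s: "s = seg x ` {0..1}" by blast
    have "continuous_on {0..1} (seg x)"
      unfolding seg_def
      by (intro continuous_on_coordinatewise_then_product continuous_intros)
    then show "connected s"
      unfolding s by (rule connected_continuous_image) simp
  next
    have "(\<lambda>c. if c = a then 1 else 0) \<in> seg x ` {0..1}" for x
      by (rule image_eqI[of _ _ 1]) (auto simp: seg_def)
    then show "\<Inter> ((\<lambda>x. seg x ` {0..1}) ` ?V) \<noteq> {}" by blast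
  qed
  moreover have "(\<Union>x\<in>?V. seg x ` {0..1}) = ?V"
  proof
    show "(\<Union>x\<in>?V. seg x ` {0..1}) \<subseteq> ?V" using seg_in by auto
    have "x \<in> seg x ` {0..1}" for x
      by (rule image_eqI[of _ _ 0]) (auto simp: seg_def)
    then show "?V \<subseteq> (\<Union>x\<in>?V. seg x ` {0..1})" by blast
  qed
  ultimately show ?thesis by simp
qed

text \<open>The barycentric coordinates are the functions \<open>lam\<close> of the double cover,
  and their positive sets are the open stars of the faces. Two stars meet exactly if the faces are
  comparable, so a cocycle on comparable pairs is the transition cocycle of a double cover.\<close>

lemma realization_cocycle_trivial:
  fixes Y :: "'c::real_normed_vector set" and G :: "'v face \<Rightarrow> 'v face \<Rightarrow> bool"
  assumes fin: "finite F" and homeo: "realization F homeomorphic Y"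
    and Y: "simply_connected Y" "locally path_connected Y"
    and cocycle: "\<And>a b c. \<lbrakk>a \<in> F; b \<in> F; c \<in> F; comparable a b; comparable b c; comparable a c\<rbrakk>
      \<Longrightarrow> (G a b \<noteq> G b c) = G a c"
  shows "\<exists>e :: 'v face \<Rightarrow> bool. \<forall>a\<in>F. \<forall>b\<in>F. comparable a b \<longrightarrow> G a b = (e a \<noteq> e b)"
proof -
  obtain h g where hg: "homeomorphism (realization F) Y h g"
    using homeo unfolding homeomorphic_def by blast
  then have h: "h ` realization F = Y" "continuous_on (realization F) h"
    and g: "g ` Y = realization F" "continuous_on Y g"
    and gh: "\<And>x. x \<in> realization F \<Longrightarrow> g (h x) = x" "\<And>y. y \<in> Y \<Longrightarrow> h (g y) = y"
    unfolding homeomorphism_def by auto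
  define s :: "'v face \<Rightarrow> 'v face \<Rightarrow> real" where "s a b = (if G a b then - 1 else 1)" for a b
  have "\<exists>e. (\<forall>a. e a = 1 \<or> e a = - 1) \<and>
    (\<forall>a\<in>F. \<forall>b\<in>F. \<forall>y\<in>Y. 0 < g y a \<longrightarrow> 0 < g y b \<longrightarrow> s a b = e a * e b)"
  proof (rule double_cover_trivial[OF fin Y])
    show "continuous_on Y (\<lambda>y. g y a)" for a
      using g(2) by (rule continuous_on_product_then_coordinatewise)
    show "0 \<le> g y a" if "y \<in> Y" for y a
      using g(1) that realization_nonneg by blast
    show "\<exists>a\<in>F. 0 < g y a" if "y \<in> Y" for y
    proof (rule ccontr)
      assume "\<not> (\<exists>a\<in>F. 0 < g y a)"
      then have "(\<Sum>a\<in>F. g y a) \<le> 0" by (intro sum_nonpos) auto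
      moreover have "g y \<in> realization F" using g(1) that by blast
      ultimately show False using realization_sum by fastforce
    qed
    show "connected {y \<in> Y. 0 < g y a}" if "a \<in> F" for a
    proof -
      have "{y \<in> Y. 0 < g y a} = h ` {x \<in> realization F. 0 < x a}"
      proof (intro equalityI subsetI)
        fix y assume "y \<in> {y \<in> Y. 0 < g y a}"
        then show "y \<in> h ` {x \<in> realization F. 0 < x a}"
          using g(1) gh(2)[of y] by (intro image_eqI[of _ _ "g y"]) auto
      next
        fix y assume "y \<in> h ` {x \<in> realization F. 0 < x a}"
        then show "y \<in> {y \<in> Y. 0 < g y a}" using h(1) gh(1) by auto
      qed
      then show ?thesis
        using realization_star_connected[OF fin that]
        by (auto intro!: connected_continuous_image continuous_on_subset[OF h(2)])
    qed
    show "s a b = 1 \<or> s a b = - 1" for a b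
      unfolding s_def by simp
    show "s a b * s b c = s a c"
      if "a \<in> F" "b \<in> F" "c \<in> F" "y \<in> Y" "0 < g y a" "0 < g y b" "0 < g y c" for a b c y
    proof -
      have "g y \<in> realization F" using g(1) that(4) by blast
      then have "comparable a b" "comparable b c" "comparable a c"
        using that realization_chain[of "g y" F] by auto
      then show ?thesis
        using cocycle[OF that(1-3)] unfolding s_def by auto
    qed
  qed
  then obtain e :: "'v face \<Rightarrow> real" where e: "\<And>a. e a = 1 \<or> e a = - 1"
    "\<And>a b y. a \<in> F \<Longrightarrow> b \<in> F \<Longrightarrow> y \<in> Y \<Longrightarrow> 0 < g y a \<Longrightarrow> 0 < g y b \<Longrightarrow> s a b = e a * e b"
    by blast
  show ?thesis
  proof (intro exI[of _ "\<lambda>a. e a = 1"] ballI impI)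
    fix a b assume ab: "a \<in> F" "b \<in> F" "comparable a b"
    \<comment> \<open>A point in both open stars, needed because the signs are only compared at
      points.\<close>
    let ?x = "\<lambda>c. (if c = a then 1 / 2 else 0) + (if c = b then 1 / 2 else 0 :: real)"
    have x: "?x \<in> realization F"
      by (rule realization_edge_point[OF fin ab])
    then have "h ?x \<in> Y" "g (h ?x) = ?x" using h(1) gh(1) by auto
    then have "s a b = e a * e b"
      using e(2)[of a b "h ?x"] ab(1,2) by simp
    then show "G a b = ((e a = 1) \<noteq> (e b = 1))"
      using e(1)[of a] e(1)[of b] unfolding s_def by (auto split: if_splits)
  qed
qed

text \<open>The total weight \<open>f\<close> of the faces satisfying \<open>P\<close> is
  continuous. Since \<open>P\<close> is constant on the chain supporting a point, \<open>f\<close>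
  takes only the values 0 and 1.\<close>

lemma realization_connected:
  fixes P :: "'v face \<Rightarrow> bool"
  assumes fin: "finite F" and conn: "connected (realization F)"
    and P: "\<And>a b. a \<in> F \<Longrightarrow> b \<in> F \<Longrightarrow> face_le a b \<Longrightarrow> P a = P b"
    and ab: "a \<in> F" "b \<in> F"
  shows "P a = P b"
proof (rule ccontr)
  assume "P a \<noteq> P b"
  define f where "f x = (\<Sum>c\<in>F. of_bool (P c) * x c)" for x :: "'v face \<Rightarrow> real"
  have "continuous_on (realization F) f"
    unfolding f_def
    by (intro continuous_intros continuous_on_product_then_coordinatewise[OF continuous_on_id])
  then have conn_f: "connected (f ` realization F)"
    using conn connected_continuous_image by blast
  define pt where "pt d = (\<lambda>c. (if c = d then 1 / 2 else 0) + (if c = d then 1 / 2 else 0 :: real))"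
    for d :: "'v face"
  have "of_bool (P d) \<in> f ` realization F" if d: "d \<in> F" for d
  proof (rule image_eqI)
    show "pt d \<in> realization F"
      using realization_edge_point[OF fin d d] unfolding pt_def face_le_def by simp
    have "pt d = (\<lambda>c. if c = d then 1 else 0)" unfolding pt_def by auto
    then show "of_bool (P d) = f (pt d)"
      using fin d by (simp add: f_def if_distrib[of "\<lambda>x. _ * x"] cong: if_cong)
  qed
  then have "{of_bool (P a), of_bool (P b)} \<subseteq> f ` realization F"
    using ab by blast
  moreover have "{of_bool (P a), of_bool (P b)} = {0, 1 :: real}"
    using \<open>P a \<noteq> P b\<close> by (cases "P a") auto
  ultimately have "0 \<in> f ` realization F" "1 \<in> f ` realization F"
    by blast+
  then have "1 / 2 \<in> f ` realization F"
    using connectedD_interval[OF conn_f, of 0 1 "1 / 2"] by simp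
  then obtain x where x: "x \<in> realization F" "f x = 1 / 2" by auto
  have "(\<Sum>c\<in>F. x c) \<noteq> 0" using realization_sum[OF x(1)] by simp
  then obtain d where d: "d \<in> F" "x d \<noteq> 0" using sum.neutral by metis
  have "of_bool (P c) * x c = of_bool (P d) * x c" if "c \<in> F" for c
    using realization_chain[OF x(1), of c d] P[of c d] P[of d c] d that by (cases "x c = 0") auto
  then have "f x = of_bool (P d) * (\<Sum>c\<in>F. x c)"
    unfolding f_def sum_distrib_left by (rule sum.cong[OF refl])
  then show False
    using x(2) realization_sum[OF x(1)] by (cases "P d") auto
qed

section \<open>Colored graphs\<close>

lemma UNIV_color: "UNIV = {Red, Green, Blue, Yellow}"
  using color.exhaust by blast

lemma finite_colors [simp]: "finite (T :: color set)"
  by (rule finite_subset[OF subset_UNIV]) (simp add: UNIV_color)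

lemma card_UNIV_color: "card (UNIV :: color set) = 4"
  by (simp add: UNIV_color)

lemma common_color:
  assumes "4 < card T + card (T' :: color set)"
  shows "\<exists>k. k \<in> T \<and> k \<in> T'"
proof (rule ccontr)
  assume "\<not> (\<exists>k. k \<in> T \<and> k \<in> T')"
  then have "card (T \<union> T') = card T + card T'" by (intro card_Un_disjoint) auto
  moreover have "card (T \<union> T') \<le> 4"
    using card_mono[OF finite_colors[of UNIV] subset_UNIV] by (simp add: card_UNIV_color)
  ultimately show False using assms by simp
qed

lemma card_Int_colors: "card T + card (T' :: color set) \<le> 4 + card (T \<inter> T')"
proof -
  have "card (T \<union> T') \<le> 4"
    using card_mono[OF finite_colors[of UNIV] subset_UNIV] by (simp add: card_UNIV_color)
  then show ?thesis using card_Un_Int[of T T'] by simp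
qed

abbreviation RGB :: "color set" where
  "RGB \<equiv> {Red, Green, Blue}"

lemma RGB_Yellow: "k \<in> RGB \<longleftrightarrow> k \<noteq> Yellow"
  by (cases k) auto

lemma UNIV_minus_Yellow: "UNIV - {Yellow} = RGB"
  using RGB_Yellow by blast

lemma pair_eq_RGB_minus:
  assumes "T \<subseteq> RGB" "card T = 2"
  shows "\<exists>k\<in>RGB. T = RGB - {k}"
proof -
  have "card (RGB - T) = 1"
    using card_Diff_subset[OF finite_colors assms(1)] assms(2) by simp
  then obtain k where "RGB - T = {k}" by (rule card_1_singletonE)
  then show ?thesis using assms(1) by blast
qed

text \<open>A cell of any colors is thus partitioned by plaquettes without yellow edges. These never
  cross from the facet to the inner vertices, so the two parts of a cut cell are sums of
  plaquettes.\<close>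

lemma pair_in_RGB:
  assumes "card T = 3"
  shows "\<exists>T'\<subseteq>T. T' \<subseteq> RGB \<and> card T' = 2"
proof -
  have "2 \<le> card (T \<inter> RGB)" using card_Int_colors[of T RGB] assms by simp
  then obtain T' where "T' \<subseteq> T \<inter> RGB" "card T' = 2"
    using obtain_subset_with_card_n by metis
  then show ?thesis by blast
qed

text \<open>Applied to the matching by the edges of one color: \<open>R\<close> consists of one end
  of every edge.\<close>

lemma involution_transversal:
  assumes "finite S" "\<And>v. v \<in> S \<Longrightarrow> f v \<in> S" "\<And>v. v \<in> S \<Longrightarrow> f (f v) = v"
    "\<And>v. v \<in> S \<Longrightarrow> f v \<noteq> v"
  shows "\<exists>R\<subseteq>S. R \<inter> f ` R = {} \<and> R \<union> f ` R = S"
  using assms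
proof (induction "card S" arbitrary: S rule: less_induct)
  case less
  show ?case
  proof (cases "S = {}")
    case False
    then obtain v where v: "v \<in> S" by blast
    let ?S = "S - {v, f v}"
    have "card ?S < card S"
      using v less.prems(1) by (intro psubset_card_mono) auto
    moreover have "f u \<in> ?S" if "u \<in> ?S" for u
      using that less.prems(2,3) v by (metis Diff_iff insert_iff singletonD)
    ultimately obtain R where R: "R \<subseteq> ?S" "R \<inter> f ` R = {}" "R \<union> f ` R = ?S"
      using less.hyps[of ?S] less.prems by auto
    have fR: "f ` R \<subseteq> ?S" using R(3) by blast
    show ?thesis
    proof (intro exI[of _ "insert v R"] conjI)
      show "insert v R \<subseteq> S" using R v by blast
      show "insert v R \<inter> f ` insert v R = {}" using R(1,2) fR less.prems(4)[OF v] by auto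
      show "insert v R \<union> f ` insert v R = S" using R(3) v less.prems(2)[OF v] by auto
    qed
  qed blast
qed

locale colex =
  fixes K :: "'v colored_graph"
  assumes closed: "closed_3colex K"
begin

text \<open>The edges of one color form a perfect matching, so the graph amounts to four involutions
  without fixed points, and components are orbits.\<close>

definition nb :: "color \<Rightarrow> 'v \<Rightarrow> 'v" where
  "nb k v = (THE w. (v, w) \<in> adj K {k})"

abbreviation comp :: "color set \<Rightarrow> 'v \<Rightarrow> 'v set" where
  "comp T v \<equiv> component K T v"

text \<open>Among sets of vertices of \<open>K\<close> these are the unions of
  \<open>T\<close>-components.\<close>

definition stable :: "color set \<Rightarrow> 'v set \<Rightarrow> bool" where
  "stable T S \<longleftrightarrow> (\<forall>v\<in>S. \<forall>k\<in>T. nb k v \<in> S)"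

lemma finite_verts: "finite (verts K)"
  using closed unfolding closed_3colex_def by blast

lemma edgeD: "e \<in> edges K \<Longrightarrow> e \<subseteq> verts K \<and> card e = 2"
  using closed unfolding closed_3colex_def by blast

lemma adj_ex1:
  assumes "v \<in> verts K"
  shows "\<exists>!w. (v, w) \<in> adj K {k}"
proof -
  let ?E = "{e \<in> edges K. v \<in> e}"
  have inj: "inj_on (colour K) ?E" and "card ?E = 4"
    using closed assms unfolding closed_3colex_def by blast+
  then have "card (colour K ` ?E) = card (UNIV :: color set)"
    by (simp add: card_image card_UNIV_color)
  then have "colour K ` ?E = UNIV"
    by (intro card_subset_eq) auto
  then have "k \<in> colour K ` ?E" by simp
  then obtain e where e: "e \<in> ?E" "colour K e = k" by blast
  then have ve: "card e = 2" "v \<in> e" using edgeD by auto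
  then obtain x y where xy: "e = {x, y}"
    by (meson card_2_iff)
  obtain w where w: "e = {v, w}"
  proof
    show "e = {v, if v = x then y else x}" using xy ve(2) by auto
  qed
  show ?thesis
  proof
    show "(v, w) \<in> adj K {k}" using e w unfolding adj_def by simp
    fix u assume "(v, u) \<in> adj K {k}"
    then have "{v, u} = {v, w}"
      using inj_onD[OF inj, of "{v, u}" "{v, w}"] e w unfolding adj_def by auto
    then show "u = w" by (auto simp: doubleton_eq_iff)
  qed
qed

lemma nb_adj: "v \<in> verts K \<Longrightarrow> (v, nb k v) \<in> adj K {k}"
  unfolding nb_def using adj_ex1 by (rule theI')

lemma nb_unique: "(v, w) \<in> adj K {k} \<Longrightarrow> nb k v = w"
proof -
  assume a: "(v, w) \<in> adj K {k}"
  then have "v \<in> verts K" using edgeD unfolding adj_def by blast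
  then show ?thesis using adj_ex1 nb_adj a by blast
qed

lemma adj_iff: "(u, w) \<in> adj K T \<longleftrightarrow> u \<in> verts K \<and> (\<exists>k\<in>T. w = nb k u)"
proof
  assume a: "(u, w) \<in> adj K T"
  then have "(u, w) \<in> adj K {colour K {u, w}}" "u \<in> verts K" "colour K {u, w} \<in> T"
    using edgeD unfolding adj_def by auto
  then show "u \<in> verts K \<and> (\<exists>k\<in>T. w = nb k u)" using nb_unique by metis
next
  assume "u \<in> verts K \<and> (\<exists>k\<in>T. w = nb k u)"
  then obtain k where "k \<in> T" "w = nb k u" "(u, nb k u) \<in> adj K {k}" using nb_adj by blast
  then show "(u, w) \<in> adj K T" unfolding adj_def by simp
qed

lemma nb_verts: "v \<in> verts K \<Longrightarrow> nb k v \<in> verts K"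
  using nb_adj[of v k] edgeD unfolding adj_def by blast

lemma nb_nb: "v \<in> verts K \<Longrightarrow> nb k (nb k v) = v"
  using nb_adj[of v k] by (intro nb_unique) (simp add: adj_def insert_commute)

lemma nb_neq: "v \<in> verts K \<Longrightarrow> nb k v \<noteq> v"
  using nb_adj[of v k] edgeD[of "{v, nb k v}"] unfolding adj_def by auto

lemma nb_inj: "v \<in> verts K \<Longrightarrow> nb k v = nb j v \<Longrightarrow> k = j"
  using nb_adj[of v k] nb_adj[of v j] unfolding adj_def by auto

lemma comp_self: "v \<in> comp T v"
  unfolding component_def by simp

lemma comp_step: "u \<in> comp T v \<Longrightarrow> u \<in> verts K \<Longrightarrow> k \<in> T \<Longrightarrow> nb k u \<in> comp T v"
  unfolding component_def
  using adj_iff[of u "nb k u" T] by (auto intro: rtrancl_into_rtrancl[of v u])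

lemma comp_induct [consumes 2, case_names base step]:
  assumes "u \<in> comp T v" "v \<in> verts K" "P v"
    and step: "\<And>u k. u \<in> comp T v \<Longrightarrow> u \<in> verts K \<Longrightarrow> k \<in> T \<Longrightarrow> P u \<Longrightarrow> P (nb k u)"
  shows "P u"
proof -
  have "(v, u) \<in> (adj K T)\<^sup>*" using assms(1) unfolding component_def by simp
  then have "u \<in> verts K \<and> P u"
  proof induction
    case (step y z)
    obtain k where "k \<in> T" "z = nb k y" using step.hyps(2) adj_iff by blast
    moreover have "y \<in> comp T v" using step.hyps(1) unfolding component_def by simp
    ultimately show ?case
      using assms(4)[of y k] step.IH nb_verts by simp
  qed (use assms in simp)
  then show ?thesis ..
qed

lemma comp_verts:
  assumes "v \<in> verts K"
  shows "comp T v \<subseteq> verts K"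
proof
  fix u assume "u \<in> comp T v"
  then show "u \<in> verts K" using assms
    by (induction rule: comp_induct) (use assms in \<open>auto intro: nb_verts\<close>)
qed

lemma comp_stable: "v \<in> verts K \<Longrightarrow> stable T (comp T v)"
  unfolding stable_def using comp_verts comp_step by blast

lemma comp_least:
  assumes "v \<in> verts K" "v \<in> S" "stable T S"
  shows "comp T v \<subseteq> S"
proof
  fix u assume "u \<in> comp T v"
  then show "u \<in> S" using assms(1)
    by (induction rule: comp_induct) (use assms in \<open>auto simp: stable_def\<close>)
qed

lemma stable_mono: "stable T S \<Longrightarrow> T' \<subseteq> T \<Longrightarrow> stable T' S"
  unfolding stable_def by blast

lemma stable_Int: "stable T S \<Longrightarrow> stable T S' \<Longrightarrow> stable T (S \<inter> S')"
  unfolding stable_def by blast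

lemma stable_verts: "stable T (verts K)"
  unfolding stable_def using nb_verts by blast

lemma stable_Diff: "stable T S \<Longrightarrow> S \<subseteq> verts K \<Longrightarrow> stable T S' \<Longrightarrow> stable T (S - S')"
  unfolding stable_def using nb_nb by (metis Diff_iff subsetD)

lemma comp_mono: "T' \<subseteq> T \<Longrightarrow> v \<in> verts K \<Longrightarrow> comp T' v \<subseteq> comp T v"
  using comp_least[OF _ comp_self stable_mono[OF comp_stable]] by blast

lemma comp_sub: "v \<in> verts K \<Longrightarrow> u \<in> comp T v \<Longrightarrow> T' \<subseteq> T \<Longrightarrow> comp T' u \<subseteq> comp T v"
  using comp_least[of u "comp T v" T'] comp_verts stable_mono[OF comp_stable] by blast

lemma comp_sym: "u \<in> comp T v \<Longrightarrow> v \<in> verts K \<Longrightarrow> v \<in> comp T u"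
proof (induction rule: comp_induct)
  case (step u k)
  have "u \<in> comp T (nb k u)"
    using comp_step[OF comp_self[of "nb k u"]] step nb_verts nb_nb by metis
  then have "comp T u \<subseteq> comp T (nb k u)"
    using comp_sub[of "nb k u" u T T] step nb_verts by simp
  then show ?case using step by blast
qed (rule comp_self)

lemma comp_eq: "u \<in> comp T v \<Longrightarrow> v \<in> verts K \<Longrightarrow> comp T u = comp T v"
  using comp_sub[of v u T T] comp_sub[of u v T T] comp_sym comp_verts by blast

lemma comp_empty: "comp {} v = {v}"
proof -
  have "adj K {} = {}" unfolding adj_def by auto
  then show ?thesis unfolding component_def by simp
qed

lemma comp_edge:
  assumes "v \<in> verts K"
  shows "comp {k} v = {v, nb k v}"
proof
  show "comp {k} v \<subseteq> {v, nb k v}"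
    by (rule comp_least[OF assms]) (use assms in \<open>auto simp: stable_def nb_nb\<close>)
  show "{v, nb k v} \<subseteq> comp {k} v"
    using comp_self comp_step[OF comp_self assms] by auto
qed

lemma even_stable:
  assumes "S \<subseteq> verts K" "stable {k} S"
  shows "even (card S)"
proof -
  have fin: "finite S" using assms(1) finite_verts finite_subset by blast
  obtain R where R: "R \<subseteq> S" "R \<inter> nb k ` R = {}" "R \<union> nb k ` R = S"
    using involution_transversal[OF fin, of "nb k"] assms nb_nb nb_neq
    unfolding stable_def by (metis insertI1 subsetD)
  have "inj_on (nb k) R"
    by (rule inj_on_inverseI[of _ "nb k"]) (use R assms nb_nb in auto)
  then have "card S = card R + card R"
    using R fin finite_subset[OF R(1) fin]
    by (metis card_Un_disjoint card_image finite_imageI)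
  then show ?thesis by simp
qed

lemma even_stable_color:
  assumes "S \<subseteq> verts K" "stable T S" "k \<in> T"
  shows "even (card S)"
  using even_stable[OF assms(1), of k] stable_mono[OF assms(2), of "{k}"] assms(3) by blast

text \<open>Components are disjoint, so their union is their sum; they are peeled off one by
  one.\<close>

lemma stable_in_comps_span:
  assumes "S \<subseteq> verts K" "stable T S"
  shows "S \<in> xor_span (comp T ` S)"
proof -
  have "finite S" using assms(1) finite_verts finite_subset by blast
  then show ?thesis using assms
  proof (induction "card S" arbitrary: S rule: less_induct)
    case less
    show ?case
    proof (cases "S = {}")
      case False
      then obtain v where v: "v \<in> S" "v \<in> verts K" using less.prems by blast
      have sub: "comp T v \<subseteq> S" using comp_least v less.prems by blast
      let ?S = "S - comp T v"
      have "card ?S < card S"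
        using v comp_self less.prems(1) by (intro psubset_card_mono) auto
      then have "?S \<in> xor_span (comp T ` ?S)"
        using less.hyps[of ?S] less.prems stable_Diff[OF less.prems(3,2) comp_stable[OF v(2)]]
        by auto
      moreover have "xor_span (comp T ` ?S) \<subseteq> xor_span (comp T ` S)"
        by (rule xor_span_least) (auto intro: xor_span_base)
      ultimately have "sym_diff ?S (comp T v) \<in> xor_span (comp T ` S)"
        using v by (intro xor_span.add) auto
      moreover have "sym_diff ?S (comp T v) = S" using sub by blast
      ultimately show ?thesis by simp
    qed (simp add: xor_span.empty)
  qed
qed

section \<open>Faces\<close>

lemma finite_faces: "finite (faces K)"
proof (rule finite_subset)
  show "faces K \<subseteq> UNIV \<times> Pow (verts K)"
    unfolding faces_def using comp_verts by auto
  show "finite ((UNIV :: color set set) \<times> Pow (verts K))"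
    using finite_verts finite_colors[of UNIV]
    by (simp add: Finite_Set.finite_set)
qed

lemma face_compI: "card T \<le> 3 \<Longrightarrow> v \<in> verts K \<Longrightarrow> (T, comp T v) \<in> faces K"
  unfolding faces_def by blast

lemma face_eq_comp:
  assumes "a \<in> faces K" "u \<in> snd a"
  shows "snd a = comp (fst a) u \<and> u \<in> verts K"
  using assms comp_eq comp_verts unfolding faces_def by fastforce

lemma face_nonempty: "a \<in> faces K \<Longrightarrow> snd a \<noteq> {}"
  unfolding faces_def using comp_self by fastforce

lemma face_card: "a \<in> faces K \<Longrightarrow> card (fst a) \<le> 3"
  unfolding faces_def by auto

lemma subface:
  assumes "a \<in> faces K" "u \<in> snd a" "T \<subseteq> fst a"
  shows "(T, comp T u) \<in> faces K \<and> face_le (T, comp T u) a"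
proof -
  have "card T \<le> 3"
    using card_mono[OF finite_colors assms(3)] face_card[OF assms(1)] by simp
  then show ?thesis
    using face_eq_comp[OF assms(1,2)] assms(3) comp_mono face_compI
    unfolding face_le_def by auto
qed

text \<open>The subcomplexes of the cell decomposition, so that the vertices and edges of a face are
  at hand whenever the face is.\<close>

definition down_closed :: "'v face set \<Rightarrow> bool" where
  "down_closed F \<longleftrightarrow> F \<subseteq> faces K \<and> (\<forall>a\<in>F. \<forall>b\<in>faces K. face_le b a \<longrightarrow> b \<in> F)"

text \<open>
  \<open>\<phi> k u\<close> is the value of a mod-2 cochain on the edge of color \<open>k\<close> at \<open>u\<close>.
\<close>

definition exact_on :: "(color \<Rightarrow> 'v \<Rightarrow> bool) \<Rightarrow> 'v face \<Rightarrow> ('v \<Rightarrow> bool) \<Rightarrow> bool" where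
  "exact_on \<phi> a \<psi> \<longleftrightarrow> (\<forall>u\<in>snd a. \<forall>k\<in>fst a. (\<psi> u \<noteq> \<psi> (nb k u)) = \<phi> k u)"

text \<open>
  Potentials on two incident faces differ by a constant; these constants form a cocycle on the
  order complex.
\<close>

lemma locally_exact_imp_exact:
  fixes Y :: "'c::real_normed_vector set"
  assumes F: "down_closed F" and homeo: "realization F homeomorphic Y"
    and Y: "simply_connected Y" "locally path_connected Y"
    and local: "\<And>a. a \<in> F \<Longrightarrow> \<exists>\<psi>. exact_on \<phi> a \<psi>"
  shows "\<exists>\<psi>. \<forall>a\<in>F. exact_on \<phi> a \<psi>"
proof -
  have faces: "F \<subseteq> faces K" using F unfolding down_closed_def by blast
  have fin: "finite F" using finite_subset[OF faces finite_faces] .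
  obtain \<Psi> where \<Psi>: "\<And>a. a \<in> F \<Longrightarrow> exact_on \<phi> a (\<Psi> a)"
    using local by metis
  have const: "(\<Psi> a u \<noteq> \<Psi> b u) = (\<Psi> a v \<noteq> \<Psi> b v)"
    if ab: "a \<in> F" "b \<in> F" "face_le a b" and uv: "u \<in> snd a" "v \<in> snd a" for a b u v
  proof -
    have a: "snd a = comp (fst a) v" "v \<in> verts K"
      using face_eq_comp[of a v] faces ab(1) uv(2) by auto
    have "u \<in> comp (fst a) v" using uv(1) a(1) by simp
    then show ?thesis using a(2)
    proof (induction rule: comp_induct)
      case (step u k)
      have "(\<Psi> a u \<noteq> \<Psi> a (nb k u)) = \<phi> k u"
        using \<Psi>[OF ab(1)] step a(1) unfolding exact_on_def by blast
      moreover have "(\<Psi> b u \<noteq> \<Psi> b (nb k u)) = \<phi> k u"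
        using \<Psi>[OF ab(2)] step a(1) ab(3) unfolding exact_on_def face_le_def by blast
      ultimately show ?case using step.IH by blast
    qed simp
  qed
  \<comment> \<open>For comparable faces the choice of the common vertex does not matter, and one
    exists because the smaller face is nonempty.\<close>
  define G where "G a b \<longleftrightarrow> (\<exists>v\<in>snd a \<inter> snd b. \<Psi> a v \<noteq> \<Psi> b v)" for a b
  have G: "G a b = (\<Psi> a v \<noteq> \<Psi> b v)"
    if "a \<in> F" "b \<in> F" "comparable a b" "v \<in> snd a" "v \<in> snd b" for a b v
    using const[of a b _ v] const[of b a _ v] that unfolding G_def face_le_def by blast
  have "\<exists>e :: 'v face \<Rightarrow> bool. \<forall>a\<in>F. \<forall>b\<in>F. comparable a b \<longrightarrow> G a b = (e a \<noteq> e b)"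
  proof (rule realization_cocycle_trivial[OF fin homeo Y])
    fix a b c assume abc: "a \<in> F" "b \<in> F" "c \<in> F"
      and cmp: "comparable a b" "comparable b c" "comparable a c"
    have "I \<noteq> {}" if "I \<in> {snd a, snd b, snd c}" for I
      using that face_nonempty[of a] face_nonempty[of b] face_nonempty[of c] abc faces by auto
    \<comment> \<open>Pairwise comparable faces form a chain, so the smallest one is their
      intersection.\<close>
    moreover have "snd a \<inter> snd b \<inter> snd c \<in> {snd a, snd b, snd c}"
      using cmp unfolding face_le_def by (auto simp: Int_absorb1 Int_absorb2)
    ultimately have "snd a \<inter> snd b \<inter> snd c \<noteq> {}" by simp
    then obtain v where v: "v \<in> snd a" "v \<in> snd b" "v \<in> snd c"
      by blast
    show "(G a b \<noteq> G b c) = G a c"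
      using G[OF abc(1,2) cmp(1) v(1,2)] G[OF abc(2,3) cmp(2) v(2,3)] G[OF abc(1,3) cmp(3) v(1,3)]
      by blast
  qed
  then obtain e :: "'v face \<Rightarrow> bool" where e: "\<And>a b. a \<in> F \<Longrightarrow> b \<in> F \<Longrightarrow> comparable a b \<Longrightarrow> G a b = (e a \<noteq> e b)"
    by blast
  \<comment> \<open>After correction by \<open>e\<close> the potentials agree on comparable faces.
    The vertex face lies below every face through \<open>v\<close>, so its value is the common
    one.\<close>
  define \<psi> where "\<psi> v = (\<Psi> ({}, {v}) v \<noteq> e ({}, {v}))" for v
  have \<psi>: "\<psi> u = (\<Psi> a u \<noteq> e a)" if a: "a \<in> F" "u \<in> snd a" for a u
  proof -
    have "({}, {u}) \<in> faces K" "face_le ({}, {u}) a"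
      using subface[of a u "{}"] faces a by (auto simp: comp_empty)
    moreover from this have "({}, {u}) \<in> F" using F a unfolding down_closed_def by blast
    ultimately show ?thesis
      using e[of "({}, {u})" a] G[of "({}, {u})" a u] a unfolding \<psi>_def by auto
  qed
  have "exact_on \<phi> a \<psi>" if "a \<in> F" for a
    unfolding exact_on_def
  proof (intro ballI)
    fix u k assume u: "u \<in> snd a" "k \<in> fst a"
    then have "nb k u \<in> snd a"
      using face_eq_comp[of a u] faces that comp_step[OF comp_self] by auto
    then show "(\<psi> u \<noteq> \<psi> (nb k u)) = \<phi> k u"
      using \<psi>[OF that, of u] \<psi>[OF that, of "nb k u"] u \<Psi>[OF that] unfolding exact_on_def by auto
  qed
  then show ?thesis by blast
qed

section \<open>Sets that are even on all plaquettes\<close>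

lemma stable_sym_diff:
  "stable T S \<Longrightarrow> S \<subseteq> verts K \<Longrightarrow> stable T S' \<Longrightarrow> S' \<subseteq> verts K \<Longrightarrow> stable T (sym_diff S S')"
  using stable_Diff[of T S S'] stable_Diff[of T S' S] unfolding stable_def by blast

text \<open>The one-dimensional case: an even set of vertices of a cycle is a sum of edges.\<close>

lemma even_split:
  assumes v: "v \<in> verts K" and A: "A \<subseteq> comp {k, l} v" and even: "even (card A)"
  shows "\<exists>x y. x \<subseteq> verts K \<and> y \<subseteq> verts K \<and> stable {k} x \<and> stable {l} y \<and> A = sym_diff x y"
proof -
  define S where "S B \<longleftrightarrow>
    (\<exists>x y. x \<subseteq> verts K \<and> y \<subseteq> verts K \<and> stable {k} x \<and> stable {l} y \<and> B = sym_diff x y)" for B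
  have S_add: "S (sym_diff B B')" if B: "S B" "S B'" for B B'
  proof -
    obtain x y where xy: "x \<subseteq> verts K" "y \<subseteq> verts K" "stable {k} x" "stable {l} y" "B = sym_diff x y"
      using B(1) unfolding S_def by auto
    obtain x' y' where xy': "x' \<subseteq> verts K" "y' \<subseteq> verts K" "stable {k} x'" "stable {l} y'"
      "B' = sym_diff x' y'"
      using B(2) unfolding S_def by auto
    have "sym_diff B B' = sym_diff (sym_diff x x') (sym_diff y y')"
      unfolding xy(5) xy'(5) by blast
    moreover have "sym_diff x x' \<subseteq> verts K" "sym_diff y y' \<subseteq> verts K"
      using xy xy' by blast+
    moreover have "stable {k} (sym_diff x x')" "stable {l} (sym_diff y y')"
      using stable_sym_diff xy xy' by auto
    ultimately show ?thesis unfolding S_def by blast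
  qed
  have S_edge: "S {u, nb j u}" if "u \<in> verts K" "j \<in> {k, l}" for u j
  proof -
    have "stable {j} {u, nb j u}" "{u, nb j u} \<subseteq> verts K"
      using that nb_nb nb_verts unfolding stable_def by auto
    moreover have "stable T {}" for T unfolding stable_def by simp
    ultimately have
      "j = k \<Longrightarrow> {u, nb j u} \<subseteq> verts K \<and> {} \<subseteq> verts K \<and> stable {k} {u, nb j u} \<and> stable {l} {}
        \<and> {u, nb j u} = sym_diff {u, nb j u} {}"
      "j = l \<Longrightarrow> {} \<subseteq> verts K \<and> {u, nb j u} \<subseteq> verts K \<and> stable {k} {} \<and> stable {l} {u, nb j u}
        \<and> {u, nb j u} = sym_diff {} {u, nb j u}"
      by auto
    then show ?thesis using that(2) unfolding S_def by blast
  qed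
  have S_empty: "S {}"
    using S_add[OF S_edge S_edge, of v k v k] v by simp
  \<comment> \<open>The edges of a path from \<open>v\<close> to \<open>u\<close> telescope to its
    two ends.\<close>
  have S_pair: "S (sym_diff {v} {u})" if "u \<in> comp {k, l} v" for u
    using that v
  proof (induction rule: comp_induct)
    case (step u j)
    have "sym_diff (sym_diff {v} {u}) {u, nb j u} = sym_diff {v} {nb j u}"
      using nb_neq[OF step(2), of j] by auto
    then show ?case using S_add[OF step.IH S_edge[OF step(2,3)]] by simp
  qed (simp add: S_empty)
  have fin: "finite A"
    using finite_subset[OF A finite_subset[OF comp_verts[OF v] finite_verts]] .
  \<comment> \<open>Every subset of the cycle is a sum of pairs with \<open>v\<close>, up to a
    leftover \<open>v\<close> that depends on the parity of its size.\<close>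
  from fin A have "S (if even (card A) then A else sym_diff A {v})"
  proof induction
    case (insert u B)
    let ?B = "if even (card B) then B else sym_diff B {v}"
    have "S (sym_diff ?B (sym_diff {v} {u}))"
      using S_add S_pair insert by blast
    moreover have "sym_diff ?B (sym_diff {v} {u})
        = (if even (card (insert u B)) then insert u B else sym_diff (insert u B) {v})"
      using insert.hyps by (cases "u = v") auto
    ultimately show ?case by simp
  qed (simp add: S_empty)
  then show ?thesis using even unfolding S_def by simp
qed

text \<open>The coboundary of the indicator of \<open>A\<close>, kept on the edges of color
  \<open>k\<close> and set to zero on all others. The full coboundary is exact for free; this part
  of it is not.\<close>

definition cut :: "color \<Rightarrow> 'v set \<Rightarrow> color \<Rightarrow> 'v \<Rightarrow> bool" where
  "cut k A j u \<longleftrightarrow> j = k \<and> (u \<in> A) \<noteq> (nb k u \<in> A)"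

text \<open>On a plaquette of colors \<open>l\<close> and \<open>k\<close>, evenness splits
  \<open>A\<close> into an \<open>l\<close>-stable part \<open>x\<close> and a
  \<open>k\<close>-stable part. The part \<open>x\<close> jumps only across edges of color
  \<open>k\<close>, and there exactly as \<open>A\<close> does, so it is the potential.\<close>

lemma cut_exact_on_low:
  assumes a: "a \<in> faces K" "card (fst a) \<le> 2"
    and even: "card (fst a) = 2 \<Longrightarrow> even (card (A \<inter> snd a))"
  shows "\<exists>\<psi>. exact_on (cut k A) a \<psi>"
proof (cases "k \<in> fst a")
  case False
  then have "exact_on (cut k A) a (\<lambda>_. False)"
    unfolding exact_on_def cut_def by auto
  then show ?thesis by blast
next
  case k: True
  obtain v where v: "v \<in> snd a" using face_nonempty[OF a(1)] by blast
  have a_comp: "snd a = comp (fst a) v" "v \<in> verts K" using face_eq_comp[OF a(1) v] by auto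
  show ?thesis
  proof (cases "fst a = {k}")
    case True
    then have "exact_on (cut k A) a (\<lambda>u. u \<in> A)"
      unfolding exact_on_def cut_def by auto
    then show ?thesis by blast
  next
    case False
    then obtain l where l: "l \<in> fst a" "l \<noteq> k" using k by blast
    have "{k, l} = fst a"
      using card_seteq[of "fst a" "{k, l}"] k l a(2) by auto
    moreover have "card {k, l} = 2" using l by simp
    ultimately have kl: "fst a = {l, k}" "card (fst a) = 2" by auto
    obtain x y where xy: "x \<subseteq> verts K" "y \<subseteq> verts K" "stable {l} x" "stable {k} y"
      "A \<inter> snd a = sym_diff x y"
      using even_split[OF a_comp(2), of "A \<inter> snd a" l k] even[OF kl(2)] a_comp(1) kl(1) by auto
    have st: "(nb j u \<in> z) = (u \<in> z)" if "stable {j} z" "z \<subseteq> verts K" "u \<in> verts K" for j z u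
      using that nb_nb[of u j] unfolding stable_def by auto
    have "exact_on (cut k A) a (\<lambda>u. u \<in> x)"
      unfolding exact_on_def
    proof (intro ballI)
      fix u j assume u: "u \<in> snd a" "j \<in> fst a"
      have uv: "u \<in> verts K" using face_eq_comp[OF a(1) u(1)] by simp
      have nbu: "nb j u \<in> snd a"
        using face_eq_comp[OF a(1) u(1)] comp_step[OF comp_self] u(2) by auto
      have "(u \<in> A) = ((u \<in> x) \<noteq> (u \<in> y))" "(nb j u \<in> A) = ((nb j u \<in> x) \<noteq> (nb j u \<in> y))"
        using xy(5) u(1) nbu by blast+
      moreover have "(nb l u \<in> x) = (u \<in> x)" "(nb k u \<in> y) = (u \<in> y)"
        using st xy uv by auto
      ultimately show "((u \<in> x) \<noteq> (nb j u \<in> x)) = cut k A j u"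
        using u(2) kl(1) l(2) unfolding cut_def by auto
    qed
    then show ?thesis by blast
  qed
qed

section \<open>Potentials on cells and on whole complexes\<close>

definition proper_faces :: "'v face \<Rightarrow> 'v face set" where
  "proper_faces c = {a \<in> faces K. face_le a c \<and> a \<noteq> c}"

lemma same_colors_face_eq:
  assumes "a \<in> faces K" "c \<in> faces K" "face_le a c" "fst a = fst c"
  shows "a = c"
proof -
  obtain u where u: "u \<in> snd a" using face_nonempty[OF assms(1)] by blast
  then have "u \<in> snd c" using assms(3) unfolding face_le_def by blast
  then have "snd a = snd c"
    using face_eq_comp[OF assms(1) u] face_eq_comp[OF assms(2)] assms(4) by simp
  then show ?thesis using assms(4) by (simp add: prod_eq_iff)
qed

lemma down_closed_proper_faces: "c \<in> faces K \<Longrightarrow> down_closed (proper_faces c)"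
  unfolding down_closed_def
proof (intro conjI ballI impI)
  fix a b assume c: "c \<in> faces K" and a: "a \<in> proper_faces c" and b: "b \<in> faces K" "face_le b a"
  have "a \<noteq> c" "face_le a c" "a \<in> faces K" using a unfolding proper_faces_def by auto
  moreover have "b \<noteq> c"
  proof
    assume "b = c"
    then have "a = c"
      using calculation b unfolding face_le_def by (auto simp: prod_eq_iff)
    then show False using calculation by simp
  qed
  ultimately show "b \<in> proper_faces c"
    using b unfolding proper_faces_def face_le_def by auto
qed (auto simp: proper_faces_def)

lemma proper_facesI:
  assumes "c \<in> faces K" "u \<in> snd c" "T \<subset> fst c"
  shows "(T, comp T u) \<in> proper_faces c"
  using subface[OF assms(1,2), of T] assms(3) unfolding proper_faces_def by auto

lemma proper_faces_colors:
  assumes "c \<in> faces K" "a \<in> proper_faces c"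
  shows "fst a \<subset> fst c"
  using same_colors_face_eq[of a c] assms unfolding proper_faces_def face_le_def by blast

lemma cell_boundary_sphere:
  "c \<in> faces K \<Longrightarrow> card (fst c) = 3 \<Longrightarrow>
    realization (proper_faces c) homeomorphic sphere (0 :: real^3) 1"
  using closed unfolding closed_3colex_def proper_faces_def by blast

lemma sphere_topology:
  "simply_connected (sphere (0 :: real^3) 1)" "locally path_connected (sphere (0 :: real^3) 1)"
  "simply_connected (sphere (0 :: real^4) 1)" "locally path_connected (sphere (0 :: real^4) 1)"
  by (simp_all add: simply_connected_sphere locally_path_connected_sphere)

text \<open>All edges of a cell lie in its boundary sphere, so a potential glued there from the
  plaquettes is a potential on the cell.\<close>

lemma cut_exact_on_cell:
  assumes c: "c \<in> faces K" "card (fst c) = 3"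
    and even: "\<And>T u. T \<subseteq> fst c \<Longrightarrow> card T = 2 \<Longrightarrow> u \<in> snd c \<Longrightarrow> even (card (A \<inter> comp T u))"
  shows "\<exists>\<psi>. exact_on (cut k A) c \<psi>"
proof -
  have "\<exists>\<psi>. \<forall>a\<in>proper_faces c. exact_on (cut k A) a \<psi>"
  proof (rule locally_exact_imp_exact[OF down_closed_proper_faces[OF c(1)]
      cell_boundary_sphere[OF c] sphere_topology(1,2)])
    fix a assume a: "a \<in> proper_faces c"
    then have af: "a \<in> faces K" "face_le a c" unfolding proper_faces_def by auto
    obtain u where u: "u \<in> snd a" using face_nonempty[OF af(1)] by blast
    have "card (fst a) < 3"
      using psubset_card_mono[OF finite_colors proper_faces_colors[OF c(1) a]] c(2) by simp
    moreover have "even (card (A \<inter> snd a))" if "card (fst a) = 2"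
      using even[of "fst a" u] face_eq_comp[OF af(1) u] u af(2) that unfolding face_le_def by auto
    ultimately show "\<exists>\<psi>. exact_on (cut k A) a \<psi>"
      using cut_exact_on_low[OF af(1)] by auto
  qed
  then obtain \<psi> where \<psi>: "\<And>a. a \<in> proper_faces c \<Longrightarrow> exact_on (cut k A) a \<psi>" by blast
  have "exact_on (cut k A) c \<psi>"
    unfolding exact_on_def
  proof (intro ballI)
    fix u j assume u: "u \<in> snd c" "j \<in> fst c"
    have "fst c \<noteq> {j}" using c(2) by auto
    then have "({j}, comp {j} u) \<in> proper_faces c"
      using proper_facesI[OF c(1) u(1), of "{j}"] u(2) by blast
    then show "(\<psi> u \<noteq> \<psi> (nb j u)) = cut k A j u"
      using \<psi> comp_self unfolding exact_on_def by fastforce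
  qed
  then show ?thesis by blast
qed

lemma cut_exact:
  fixes Y :: "'c::real_normed_vector set"
  assumes F: "down_closed F" and homeo: "realization F homeomorphic Y"
    and Y: "simply_connected Y" "locally path_connected Y"
    and even: "\<And>a. a \<in> F \<Longrightarrow> card (fst a) = 2 \<Longrightarrow> even (card (A \<inter> snd a))"
  shows "\<exists>\<psi>. \<forall>a\<in>F. exact_on (cut k A) a \<psi>"
proof (rule locally_exact_imp_exact[OF F homeo Y])
  fix a assume a: "a \<in> F"
  then have af: "a \<in> faces K" using F unfolding down_closed_def by blast
  show "\<exists>\<psi>. exact_on (cut k A) a \<psi>"
  proof (cases "card (fst a) = 3")
    case True
    show ?thesis
    proof (rule cut_exact_on_cell[OF af True])
      fix T u assume T: "T \<subseteq> fst a" "card T = 2" "u \<in> snd a"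
      then have "(T, comp T u) \<in> F"
        using subface[OF af T(3,1)] F a unfolding down_closed_def by blast
      then show "even (card (A \<inter> comp T u))" using even T(2) by fastforce
    qed
  next
    case False
    then show ?thesis
      using cut_exact_on_low[OF af] face_card[OF af] even[OF a] by auto
  qed
qed

text \<open>
  \<open>y k\<close> is a potential of the cochain \<open>cut k A\<close>. The sum of all \<open>y k\<close> jumps exactly where \<open>A\<close> does, so it
  is \<open>A\<close> up to a constant.
\<close>

lemma decomposition:
  fixes Y :: "'c::real_normed_vector set"
  assumes F: "down_closed F" and homeo: "realization F homeomorphic Y"
    and Y: "simply_connected Y" "locally path_connected Y"
    and even: "\<And>a. a \<in> F \<Longrightarrow> card (fst a) = 2 \<Longrightarrow> even (card (A \<inter> snd a))"
    and D: "D \<noteq> {}"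
    and edge: "\<And>u j. u \<in> W \<Longrightarrow> j \<in> D \<Longrightarrow> nb j u \<in> W \<Longrightarrow> ({j}, comp {j} u) \<in> F"
    and conn: "\<And>f :: 'v \<Rightarrow> bool. (\<And>u j. u \<in> W \<Longrightarrow> j \<in> D \<Longrightarrow> nb j u \<in> W \<Longrightarrow> f u = f (nb j u)) \<Longrightarrow>
      \<forall>u\<in>W. \<forall>v\<in>W. f u = f v"
  shows "\<exists>y. (\<forall>k\<in>D. \<forall>u\<in>W. \<forall>j\<in>D - {k}. nb j u \<in> W \<longrightarrow> (u \<in> y k \<longleftrightarrow> nb j u \<in> y k)) \<and>
    (\<forall>v\<in>W. v \<in> A \<longleftrightarrow> odd (card {k \<in> D. v \<in> y k}))"
proof -
  obtain \<psi> where \<psi>: "\<And>k a. a \<in> F \<Longrightarrow> exact_on (cut k A) a (\<psi> k)"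
    using cut_exact[OF F homeo Y even] by metis
  have step: "(\<psi> k u \<noteq> \<psi> k (nb j u)) = cut k A j u"
    if "u \<in> W" "j \<in> D" "nb j u \<in> W" for k u j
    using \<psi>[OF edge[OF that]] comp_self unfolding exact_on_def by fastforce
  \<comment> \<open>The difference of \<open>A\<close> and the sum of the potentials. Across an edge
    of color \<open>j\<close> only the potential of color \<open>j\<close> can jump, and it jumps
    with \<open>A\<close>.\<close>
  define f where "f v \<longleftrightarrow> (v \<in> A) \<noteq> odd (card {k \<in> D. \<psi> k v})" for v
  have f_const: "\<forall>u\<in>W. \<forall>v\<in>W. f u = f v"
  proof (rule conn)
    fix u j assume u: "u \<in> W" "j \<in> D" "nb j u \<in> W"
    have "\<psi> k u = \<psi> k (nb j u)" if "k \<noteq> j" for k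
      using step[OF u, of k] that unfolding cut_def by auto
    then have "{k \<in> D - {j}. \<psi> k u} = {k \<in> D - {j}. \<psi> k (nb j u)}" by blast
    then show "f u = f (nb j u)"
      using step[OF u, of j] odd_card_split[of D j "\<lambda>k. \<psi> k u"]
        odd_card_split[of D j "\<lambda>k. \<psi> k (nb j u)"] u(2)
      unfolding f_def cut_def by auto
  qed
  obtain k0 where k0: "k0 \<in> D" using D by blast
  define c where "c \<longleftrightarrow> (\<exists>v\<in>W. f v)"
  have c: "f v = c" if "v \<in> W" for v using f_const that unfolding c_def by blast
  \<comment> \<open>The leftover constant is absorbed into one arbitrary color, which does not
    change where that potential jumps.\<close>
  define y where "y k = {v. \<psi> k v \<noteq> (k = k0 \<and> c)}" for k
  show ?thesis
  proof (intro exI[of _ y] conjI ballI impI)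
    fix k u j assume "k \<in> D" "u \<in> W" "j \<in> D - {k}" "nb j u \<in> W"
    then show "u \<in> y k \<longleftrightarrow> nb j u \<in> y k"
      using step[of u j k] unfolding y_def cut_def by auto
  next
    fix v assume v: "v \<in> W"
    have "{k \<in> D. k = k0 \<and> c} = (if c then {k0} else {})" using k0 by auto
    then have "odd (card {k \<in> D. v \<in> y k}) \<longleftrightarrow> (odd (card {k \<in> D. \<psi> k v}) \<noteq> c)"
      unfolding y_def mem_Collect_eq
      using odd_card_xor[of D "\<lambda>k. \<psi> k v" "\<lambda>k. k = k0 \<and> c"] by simp
    then show "v \<in> A \<longleftrightarrow> odd (card {k \<in> D. v \<in> y k})"
      using c[OF v] unfolding f_def by auto
  qed
qed

section \<open>Even sets in a component as sums of faces of codimension one\<close>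

lemma comp_decomposition:
  fixes Y :: "'c::real_normed_vector set"
  assumes F: "down_closed F" and homeo: "realization F homeomorphic Y"
    and Y: "simply_connected Y" "locally path_connected Y"
    and v: "v \<in> verts K" and D: "2 \<le> card D"
    and F_comp: "\<And>a. a \<in> F \<Longrightarrow> fst a \<subseteq> D \<and> snd a \<subseteq> comp D v"
    and comp_F: "\<And>k u. k \<in> D \<Longrightarrow> u \<in> comp D v \<Longrightarrow> ({k}, comp {k} u) \<in> F"
    and A: "A \<subseteq> comp D v"
    and even: "\<And>T u. T \<subseteq> D \<Longrightarrow> card T = 2 \<Longrightarrow> u \<in> comp D v \<Longrightarrow> even (card (A \<inter> comp T u))"
  shows "\<exists>y. (\<forall>k\<in>D. y k \<subseteq> comp D v \<and> stable (D - {k}) (y k)) \<and>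
    (\<forall>u\<in>comp D v. u \<in> A \<longleftrightarrow> odd (card {k \<in> D. u \<in> y k}))"
proof -
  let ?W = "comp D v"
  have nbW: "nb j u \<in> ?W" if "u \<in> ?W" "j \<in> D" for u j
    using comp_step that comp_verts[OF v] by blast
  have "\<exists>y. (\<forall>k\<in>D. \<forall>u\<in>?W. \<forall>j\<in>D - {k}. nb j u \<in> ?W \<longrightarrow> (u \<in> y k \<longleftrightarrow> nb j u \<in> y k)) \<and>
    (\<forall>v\<in>?W. v \<in> A \<longleftrightarrow> odd (card {k \<in> D. v \<in> y k}))"
  proof (rule decomposition[OF F homeo Y])
    fix a assume a: "a \<in> F" "card (fst a) = 2"
    then have af: "a \<in> faces K" using F unfolding down_closed_def by blast
    obtain u where u: "u \<in> snd a" using face_nonempty[OF af] by blast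
    then show "even (card (A \<inter> snd a))"
      using even[of "fst a" u] F_comp[OF a(1)] a(2) face_eq_comp[OF af u] by auto
  next
    show "D \<noteq> {}" using D by auto
  next
    fix f :: "'v \<Rightarrow> bool"
    assume f: "\<And>u j. u \<in> ?W \<Longrightarrow> j \<in> D \<Longrightarrow> nb j u \<in> ?W \<Longrightarrow> f u = f (nb j u)"
    have "f u = f v" if "u \<in> ?W" for u
      using that v by (induction rule: comp_induct) (use f nbW in auto)
    then show "\<forall>u\<in>?W. \<forall>v\<in>?W. f u = f v" by simp
  qed (rule comp_F)
  then obtain y where y0:
    "\<forall>k\<in>D. \<forall>u\<in>?W. \<forall>j\<in>D - {k}. nb j u \<in> ?W \<longrightarrow> (u \<in> y k \<longleftrightarrow> nb j u \<in> y k)"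
    "\<forall>v\<in>?W. v \<in> A \<longleftrightarrow> odd (card {k \<in> D. v \<in> y k})"
    by blast
  have y: "u \<in> y k \<longleftrightarrow> nb j u \<in> y k" if "k \<in> D" "u \<in> ?W" "j \<in> D - {k}" for k u j
    using y0(1) nbW[of u j] that by simp
  show ?thesis
  proof (intro exI[of _ "\<lambda>k. y k \<inter> ?W"] conjI ballI)
    show "stable (D - {k}) (y k \<inter> ?W)" if "k \<in> D" for k
      using y[OF that] nbW unfolding stable_def by blast
    show "u \<in> A \<longleftrightarrow> odd (card {k \<in> D. u \<in> y k \<inter> ?W})" if "u \<in> ?W" for u
      using y0(2) that by simp
  qed simp
qed

text \<open>
  Evenness on the faces through \<open>v0\<close> comes for free, since the faces of given colors partition
  \<open>comp D v0\<close>; complementing an even number of summands makes all of them avoid \<open>v0\<close>.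
\<close>

lemma punctured_decomposition:
  fixes Y :: "'c::real_normed_vector set"
  assumes F: "down_closed F" and homeo: "realization F homeomorphic Y"
    and Y: "simply_connected Y" "locally path_connected Y"
    and v0: "v0 \<in> verts K" and D: "2 \<le> card D"
    and F_comp: "\<And>a. a \<in> F \<Longrightarrow> fst a \<subseteq> D \<and> snd a \<subseteq> comp D v0"
    and comp_F: "\<And>k u. k \<in> D \<Longrightarrow> u \<in> comp D v0 \<Longrightarrow> ({k}, comp {k} u) \<in> F"
    and A: "A \<subseteq> comp D v0 - {v0}" and even_A: "even (card A)"
    and even: "\<And>T u. T \<subseteq> D \<Longrightarrow> card T = 2 \<Longrightarrow> u \<in> comp D v0 \<Longrightarrow> v0 \<notin> comp T u \<Longrightarrow>
      even (card (A \<inter> comp T u))"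
  shows "A \<in> xor_span {comp (D - {k}) u | k u. k \<in> D \<and> u \<in> comp D v0 \<and> v0 \<notin> comp (D - {k}) u}"
    (is "A \<in> xor_span ?G")
proof -
  let ?W = "comp D v0"
  have W: "?W \<subseteq> verts K" "stable D ?W" using comp_verts[OF v0] comp_stable[OF v0] by auto
  have finA: "finite A" using A W(1) finite_verts by (meson Diff_subset finite_subset subset_trans)
  have even_v0: "even (card (A \<inter> comp T v0))" if T: "T \<subseteq> D" "card T = 2" for T
  proof -
    let ?R = "?W - comp T v0"
    have st: "stable T ?R"
      using stable_Diff[OF stable_mono[OF W(2) T(1)] W(1) comp_stable[OF v0]] .
    have "even (card (?R \<inter> A))"
    proof -
      have "even (card (g \<inter> A))" "finite g" if g: "g \<in> comp T ` ?R" for g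
      proof -
        obtain u where u: "u \<in> ?R" "g = comp T u" using g by blast
        then have "v0 \<notin> comp T u" using comp_sym W(1) by blast
        then show "even (card (g \<inter> A))" using even[OF T, of u] u by (simp add: Int_commute)
        show "finite g" using u comp_verts[of u T] W(1) finite_verts finite_subset by blast
      qed
      then show ?thesis
        using xor_span_even[OF stable_in_comps_span[OF _ st], of A] W(1) by blast
    qed
    moreover have "card A = card (A \<inter> comp T v0) + card (?R \<inter> A)"
      using A finA by (subst card_Un_disjoint[symmetric]) (auto intro!: arg_cong[where f = card])
    ultimately show ?thesis using even_A by simp
  qed
  have "\<exists>y. (\<forall>k\<in>D. y k \<subseteq> ?W \<and> stable (D - {k}) (y k)) \<and>
    (\<forall>u\<in>?W. u \<in> A \<longleftrightarrow> odd (card {k \<in> D. u \<in> y k}))"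
  proof (rule comp_decomposition[OF F homeo Y v0 D F_comp comp_F])
    show "A \<subseteq> ?W" using A by blast
    fix T u assume T: "T \<subseteq> D" "card T = 2" and u: "u \<in> ?W"
    show "even (card (A \<inter> comp T u))"
    proof (cases "v0 \<in> comp T u")
      case True
      then have "comp T v0 = comp T u" using comp_eq u W(1) by blast
      then show ?thesis using even_v0[OF T] by simp
    qed (rule even[OF T u])
  qed
  then obtain y where y: "\<And>k. k \<in> D \<Longrightarrow> y k \<subseteq> ?W" "\<And>k. k \<in> D \<Longrightarrow> stable (D - {k}) (y k)"
    "\<And>u. u \<in> ?W \<Longrightarrow> u \<in> A \<longleftrightarrow> odd (card {k \<in> D. u \<in> y k})"
    by blast
  define z where "z k = (if v0 \<in> y k then ?W - y k else y k)" for k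
  have "z k \<in> xor_span ?G" if k: "k \<in> D" for k
  proof -
    have z: "z k \<subseteq> ?W" "v0 \<notin> z k" using y(1)[OF k] unfolding z_def by auto
    have st: "stable (D - {k}) (z k)"
      unfolding z_def
      using y(2)[OF k] stable_Diff[OF stable_mono[OF W(2), of "D - {k}"] W(1)] by auto
    have "comp (D - {k}) ` z k \<subseteq> xor_span ?G"
    proof
      fix g assume "g \<in> comp (D - {k}) ` z k"
      then obtain u where u: "u \<in> z k" "g = comp (D - {k}) u" by blast
      then have "comp (D - {k}) u \<subseteq> z k" using comp_least st z(1) W(1) by blast
      then have "g \<in> ?G" using u z k by blast
      then show "g \<in> xor_span ?G" by (rule xor_span_base)
    qed
    then have "xor_span (comp (D - {k}) ` z k) \<subseteq> xor_span ?G" by (rule xor_span_least)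
    then show ?thesis
      using stable_in_comps_span[OF _ st] z(1) W(1) by blast
  qed
  then have "{u. odd (card {k \<in> D. u \<in> z k})} \<in> xor_span ?G"
    by (rule odd_sum_in_span[OF finite_colors])
  moreover have "{u. odd (card {k \<in> D. u \<in> z k})} = A"
  proof (rule Set.set_eqI)
    fix u
    show "u \<in> {u. odd (card {k \<in> D. u \<in> z k})} \<longleftrightarrow> u \<in> A"
    proof (cases "u \<in> ?W")
      case True
      have "{k \<in> D. u \<in> z k} = {k \<in> D. (u \<in> y k) \<noteq> (v0 \<in> y k)}"
        using True unfolding z_def by auto
      then show ?thesis
        using odd_card_xor[of D "\<lambda>k. u \<in> y k" "\<lambda>k. v0 \<in> y k"] y(3)[OF True]
          y(3)[of v0] comp_self A by auto
    next
      case False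
      then have empty: "{k \<in> D. u \<in> z k} = {}" using y(1) unfolding z_def by auto
      have "u \<notin> A" using False A by blast
      then show ?thesis unfolding mem_Collect_eq empty by simp
    qed
  qed
  ultimately show ?thesis by simp
qed

text \<open>More than four colors in total force a shared one, whose edges match the vertices of the
  intersection in pairs.\<close>

lemma even_Int_stable:
  assumes "S \<subseteq> verts K" "stable T S" "stable T' S'" "4 < card T + card T'"
  shows "even (card (S \<inter> S'))"
proof -
  obtain k where k: "k \<in> T" "k \<in> T'" using common_color[OF assms(4)] by blast
  then have "stable {k} (S \<inter> S')"
    using assms(2,3) unfolding stable_def by blast
  then show ?thesis using even_stable[of "S \<inter> S'" k] assms(1) by blast
qed

lemma stable_Un_colors: "stable T S \<Longrightarrow> stable T' S \<Longrightarrow> stable (T \<union> T') S"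
  unfolding stable_def by blast

lemma comp_UNIV:
  assumes "v \<in> verts K"
  shows "comp UNIV v = verts K"
proof
  show "comp UNIV v \<subseteq> verts K" using comp_verts[OF assms] .
  show "verts K \<subseteq> comp UNIV v"
    using closed assms unfolding closed_3colex_def component_def by blast
qed

text \<open>Balls, discs and spheres are connected as spaces; this turns it into connectedness of
  the vertices by edges of the faces.\<close>

lemma connected_faces_const:
  fixes f :: "'v \<Rightarrow> bool"
  assumes F: "down_closed F" and conn: "connected (realization F)"
    and f: "\<And>a u j. a \<in> F \<Longrightarrow> u \<in> snd a \<Longrightarrow> j \<in> fst a \<Longrightarrow> f u = f (nb j u)"
    and ab: "a \<in> F" "u \<in> snd a" "b \<in> F" "v \<in> snd b"
  shows "f u = f v"
proof -
  have Ff: "F \<subseteq> faces K" using F unfolding down_closed_def by blast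
  have const: "f x = f y" if a: "a \<in> F" "x \<in> snd a" "y \<in> snd a" for a x y
  proof -
    have a_comp: "snd a = comp (fst a) y" "y \<in> verts K" using face_eq_comp[of a y] a Ff by auto
    have "x \<in> comp (fst a) y" using a(2) a_comp(1) by simp
    then show ?thesis using a_comp(2)
      by (induction rule: comp_induct) (use f[OF a(1)] a_comp(1) in auto)
  qed
  have P: "(\<exists>x\<in>snd a. f x) = f y" if "a \<in> F" "y \<in> snd a" for a y
    using const that by blast
  have "(\<exists>x\<in>snd a. f x) = (\<exists>x\<in>snd b. f x)"
  proof (rule realization_connected[OF finite_subset[OF Ff finite_faces] conn _ ab(1,3)])
    fix a b assume ab: "a \<in> F" "b \<in> F" "face_le a b"
    obtain y where y: "y \<in> snd a" using face_nonempty ab Ff by blast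
    then have "y \<in> snd b" using ab(3) unfolding face_le_def by blast
    then show "(\<exists>x\<in>snd a. f x) = (\<exists>x\<in>snd b. f x)" using P ab y by simp
  qed
  then show ?thesis using P ab by simp
qed

section \<open>No cell is a single plaquette\<close>

lemma card_plaquette:
  assumes "u \<in> verts K" "i \<noteq> j"
  shows "4 \<le> card (comp {i, j} u)"
proof -
  have v: "nb i u \<in> verts K" "nb j u \<in> verts K" using nb_verts assms by auto
  \<comment> \<open>An edge has one color, so two colors never lead to the same neighbor: there are
    no plaquettes with two vertices.\<close>
  have "nb i u \<noteq> nb j u" using nb_inj assms by blast
  moreover have "nb i (nb j u) \<noteq> u" using nb_nb[OF v(2), of i] calculation by auto
  moreover have "nb i (nb j u) \<noteq> nb i u"
    using nb_nb[OF v(2), of i] nb_nb[OF assms(1), of i] nb_neq[OF assms(1), of j] by auto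
  moreover have "nb i u \<noteq> u" "nb j u \<noteq> u" "nb i (nb j u) \<noteq> nb j u"
    using nb_neq assms v by auto
  ultimately have "card {u, nb i u, nb j u, nb i (nb j u)} = 4" by auto
  moreover have "{u, nb i u, nb j u, nb i (nb j u)} \<subseteq> comp {i, j} u"
    using comp_self comp_step[OF comp_self assms(1)] comp_step[of "nb j u" "{i, j}" u i] v by auto
  moreover have "finite (comp {i, j} u)"
    using comp_verts[OF assms(1)] finite_verts finite_subset by blast
  ultimately show ?thesis using card_mono by metis
qed

lemma card_comps:
  assumes S: "S \<subseteq> verts K" "stable {i, j} S" and ij: "i \<noteq> j"
  shows "4 * card (comp {i, j} ` S) \<le> card S"
proof -
  have "\<Union> (comp {i, j} ` S) = S"
    using comp_self comp_least S by blast
  then have "card S = sum card (comp {i, j} ` S)"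
    using card_Union_disjoint[of "comp {i, j} ` S"] S comp_eq comp_verts finite_verts
    by (smt (verit, best) disjoint_iff disjnt_def finite_subset imageE pairwise_def subset_iff)
  moreover have "card (comp {i, j} ` S) * 4 \<le> sum card (comp {i, j} ` S)"
    using sum_bounded_below[of "comp {i, j} ` S" 4 card] card_plaquette ij S(1) by auto
  ultimately show ?thesis by simp
qed

text \<open>
  Otherwise the plaquettes of the other two color pairs and the edges of the third color \<open>m\<close> form
  a graph all of whose vertices have degree at least two. It has a cycle, and choosing one end of
  every edge of the cycle gives a set that is even on all plaquettes but is not a sum of them.
\<close>

lemma cell_not_plaquette:
  assumes v: "v \<in> verts K" and ijm: "i \<noteq> j" "i \<noteq> m" "j \<noteq> m"
  shows "comp {i, j} v \<noteq> comp {i, j, m} v"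
proof
  define D where "D = {i, j, m}"
  let ?B = "comp D v"
  assume "comp {i, j} v = comp {i, j, m} v"
  then have single: "comp {i, j} v = ?B" by (simp add: D_def)
  let ?c = "(D, ?B)"
  have c: "?c \<in> faces K" "card (fst ?c) = 3" using face_compI[of D v] v ijm by (auto simp: D_def)
  have B: "?B \<subseteq> verts K" "stable D ?B" using comp_verts comp_stable v by auto
  have finB: "finite ?B" using B(1) finite_verts finite_subset by blast
  have single': "comp {i, j} u = ?B" if "u \<in> ?B" for u
    using comp_eq[of u "{i, j}" v] that v single by simp
  \<comment> \<open>The summands of colors \<open>i\<close> and \<open>j\<close> are stable under
    \<open>m\<close> anyway. The summand of color \<open>m\<close> is a union of
    \<open>{i, j}\<close>-plaquettes, hence empty or all of the cell. So a set that is even on all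
    plaquettes is closed under edges of color \<open>m\<close>.\<close>
  have even_stable_m: "stable {m} A"
    if A: "A \<subseteq> ?B" and even: "\<And>T u. T \<subseteq> D \<Longrightarrow> card T = 2 \<Longrightarrow> u \<in> ?B \<Longrightarrow> even (card (A \<inter> comp T u))"
    for A
  proof -
    have "\<exists>y. (\<forall>k\<in>D. y k \<subseteq> ?B \<and> stable (D - {k}) (y k)) \<and>
      (\<forall>u\<in>?B. u \<in> A \<longleftrightarrow> odd (card {k \<in> D. u \<in> y k}))"
    proof (rule comp_decomposition[OF down_closed_proper_faces[OF c(1)] cell_boundary_sphere[OF c]
          sphere_topology(1,2) v _ _ _ A even])
      show "2 \<le> card D" using ijm by (simp add: D_def)
      show "fst a \<subseteq> D \<and> snd a \<subseteq> ?B" if "a \<in> proper_faces ?c" for a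
        using that unfolding proper_faces_def face_le_def by auto
      show "({k}, comp {k} u) \<in> proper_faces ?c" if "k \<in> D" "u \<in> ?B" for k u
        using proper_facesI[OF c(1), of u "{k}"] that ijm by (auto simp: D_def)
    qed auto
    then obtain y where y: "\<And>k. k \<in> D \<Longrightarrow> y k \<subseteq> ?B" "\<And>k. k \<in> D \<Longrightarrow> stable (D - {k}) (y k)"
      "\<And>u. u \<in> ?B \<Longrightarrow> u \<in> A \<longleftrightarrow> odd (card {k \<in> D. u \<in> y k})"
      by blast
    have "stable {m} (y k)" if k: "k \<in> D" for k
    proof (cases "k = m")
      case True
      have "stable {i, j} (y m)"
        using stable_mono[OF y(2)[of m], of "{i, j}"] ijm by (auto simp: D_def)
      then have "?B \<subseteq> y m" if "u \<in> y m" for u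
        using comp_least[of u "y m" "{i, j}"] single'[of u] that y(1)[of m] B(1) by (auto simp: D_def)
      then have "y m = {} \<or> y m = ?B" using y(1)[of m] D_def by blast
      then show ?thesis using True B(2) unfolding stable_def D_def by auto
    next
      case False
      then show ?thesis using stable_mono[OF y(2)[OF k], of "{m}"] by (auto simp: D_def)
    qed
    then have st: "\<And>u k. k \<in> D \<Longrightarrow> u \<in> y k \<Longrightarrow> nb m u \<in> y k" unfolding stable_def by simp
    have same: "(nb m u \<in> y k) = (u \<in> y k)" if "u \<in> ?B" "k \<in> D" for u k
      using st[of k u] st[of k "nb m u"] that nb_nb[of u m] B(1) by auto
    have "nb m u \<in> A" if u: "u \<in> A" for u
    proof -
      have uB: "u \<in> ?B" "nb m u \<in> ?B" using u A B(2) unfolding stable_def by (auto simp: D_def)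
      have "{k \<in> D. nb m u \<in> y k} = {k \<in> D. u \<in> y k}" using same[OF uB(1)] by blast
      then show ?thesis using y(3)[OF uB(1)] y(3)[OF uB(2)] u by simp
    qed
    then show ?thesis unfolding stable_def by simp
  qed
  have m_closed: "\<And>u. u \<in> ?B \<Longrightarrow> nb m u \<in> ?B" using B(2) unfolding stable_def by (auto simp: D_def)
  \<comment> \<open>With only one end of each edge of color \<open>m\<close> in \<open>R\<close>, no
    nonempty subset of \<open>R\<close> is closed under these edges. It remains to find one that is
    even on all plaquettes.\<close>
  have "\<exists>R\<subseteq>?B. R \<inter> nb m ` R = {} \<and> R \<union> nb m ` R = ?B"
    by (rule involution_transversal[OF finB]) (use m_closed nb_nb nb_neq B(1) in auto)
  then obtain R where R: "R \<subseteq> ?B" "R \<inter> nb m ` R = {}" "R \<union> nb m ` R = ?B" by blast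
  have finR: "finite R" using R(1) finB finite_subset by blast
  have "inj_on (nb m) R"
    by (rule inj_on_inverseI[of _ "nb m"]) (use R(1) B(1) nb_nb in auto)
  then have card_B: "card ?B = 2 * card R"
    using card_Un_disjoint[OF finR _ R(2)] finR R(3) by (simp add: card_image)
  let ?P = "\<lambda>l. comp {l, m} ` ?B"
  have finP: "finite (?P l)" for l using finB by simp
  \<comment> \<open>A plaquette has at least four vertices, so the plaquettes of colors
    \<open>{i, m}\<close> and \<open>{j, m}\<close> together number at most half the vertices, which
    is the size of \<open>R\<close>.\<close>
  have "4 * card (?P i) \<le> card ?B" "4 * card (?P j) \<le> card ?B"
    using card_comps[OF B(1), of i m] card_comps[OF B(1), of j m] stable_mono[OF B(2)] ijm
    by (auto simp: D_def)
  then have count: "card (?P i) + card (?P j) \<le> card R" using card_B by simp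
  define odds where "odds A l = {p \<in> ?P l. odd (card (A \<inter> p))}" for A l
  let ?h = "\<lambda>A. (odds A i, odds A j)"
  have fin_p: "finite p" if p: "p \<in> ?P l" for p l
  proof -
    obtain u where "u \<in> ?B" "p = comp {l, m} u" using p by blast
    then show ?thesis
      using finite_subset[OF comp_verts[of u "{l, m}"] finite_verts] B(1) by blast
  qed
  have part: "even (card (A \<inter> S))"
    if S: "S \<subseteq> ?B" "stable {l, m} S" and ev: "\<And>p. p \<in> comp {l, m} ` S \<Longrightarrow> even (card (A \<inter> p))"
    for A S l
  proof -
    have "S \<in> xor_span (comp {l, m} ` S)" using stable_in_comps_span S B(1) by blast
    then show ?thesis
      using xor_span_even[of S "comp {l, m} ` S" A] ev fin_p[of _ l] S(1)
      by (auto simp: Int_commute)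
  qed
  \<comment> \<open>There are at least as many subsets of \<open>R\<close> as parity patterns, so
    injectivity would make every pattern occur. But being odd on a single
    \<open>{i, m}\<close>-plaquette and even on all \<open>{j, m}\<close>-plaquettes is impossible:
    both families partition the cell and must give the same total parity.\<close>
  have "\<not> inj_on ?h (Pow R)"
  proof
    assume inj: "inj_on ?h (Pow R)"
    have sub: "?h ` Pow R \<subseteq> Pow (?P i) \<times> Pow (?P j)" unfolding odds_def by blast
    have "card (Pow (?P i) \<times> Pow (?P j)) = 2 ^ (card (?P i) + card (?P j))"
      using finP by (simp add: card_Pow card_cartesian_product power_add)
    also have "\<dots> \<le> 2 ^ card R" using count by simp
    also have "\<dots> = card (?h ` Pow R)" using inj finR by (simp add: card_image card_Pow)
    finally have "card (Pow (?P i) \<times> Pow (?P j)) \<le> card (?h ` Pow R)" .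
    then have onto: "?h ` Pow R = Pow (?P i) \<times> Pow (?P j)"
      by (rule card_seteq[OF _ sub, rotated]) (use finP in simp)
    have "comp {i, m} v \<in> ?P i" by (rule imageI) (rule comp_self)
    then have "({comp {i, m} v}, {}) \<in> ?h ` Pow R" unfolding onto by simp
    then obtain A where A: "A \<subseteq> R" "odds A i = {comp {i, m} v}" "odds A j = {}" by auto
    have finA: "finite A" using A(1) finR finite_subset by blast
    have AB: "A \<inter> ?B = A" using A(1) R(1) by blast
    have "even (card (A \<inter> ?B))"
      by (rule part[of _ j]) (use A(3) stable_mono[OF B(2)] in \<open>auto simp: odds_def D_def\<close>)
    moreover
    let ?p = "comp {i, m} v"
    have p: "?p \<subseteq> ?B" "stable {i, m} ?p" using comp_mono[of "{i, m}" D] v comp_stable by (auto simp: D_def)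
    have "even (card (A \<inter> (?B - ?p)))"
    proof (rule part[of _ i])
      show "stable {i, m} (?B - ?p)"
        using stable_Diff[OF _ B(1) p(2)] stable_mono[OF B(2)] by (auto simp: D_def)
      fix q assume "q \<in> comp {i, m} ` (?B - ?p)"
      then obtain u where u: "u \<in> ?B - ?p" "q = comp {i, m} u" by blast
      then have "q \<noteq> ?p" using comp_self by blast
      then have "q \<notin> odds A i" using A(2) by simp
      then show "even (card (A \<inter> q))" using u unfolding odds_def by blast
    qed simp
    moreover have "odd (card (A \<inter> ?p))" using A(2) unfolding odds_def by blast
    moreover have "card A = card (A \<inter> ?p) + card (A \<inter> (?B - ?p))"
      using AB finA by (subst card_Un_disjoint[symmetric]) (auto intro!: arg_cong[where f = card])
    ultimately show False using AB by simp
  qed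
  then obtain A1 A2 where A12: "A1 \<subseteq> R" "A2 \<subseteq> R" "A1 \<noteq> A2" "odds A1 i = odds A2 i" "odds A1 j = odds A2 j"
    unfolding inj_on_def by blast
  \<comment> \<open>Equal patterns cancel, so the difference is even on all plaquettes containing
    edges of color \<open>m\<close>. It is therefore even on the whole cell, which is the only
    plaquette of colors \<open>{i, j}\<close>.\<close>
  let ?A = "sym_diff A1 A2"
  have fin12: "finite A1" "finite A2" using A12(1,2) finite_subset[OF _ finR] by auto
  have even_im: "even (card (?A \<inter> comp {l, m} u))" if l: "l \<in> {i, j}" and u: "u \<in> ?B" for l u
  proof -
    have "odds A1 l = odds A2 l" using l A12 by blast
    then have "comp {l, m} u \<in> odds A1 l \<longleftrightarrow> comp {l, m} u \<in> odds A2 l" by simp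
    then have "even (card (A1 \<inter> comp {l, m} u)) = even (card (A2 \<inter> comp {l, m} u))"
      using u unfolding odds_def by blast
    then show ?thesis using even_card_sym_diff_Int[OF fin12] by simp
  qed
  have "stable {m} ?A"
  proof (rule even_stable_m)
    show "?A \<subseteq> ?B" using A12 R(1) by blast
    fix T u assume T: "T \<subseteq> D" "card T = 2" and u: "u \<in> ?B"
    have "T = {i, j} \<or> T = {i, m} \<or> T = {j, m}"
    proof -
      obtain a b where "T = {a, b}" "a \<noteq> b" using T(2) by (meson card_2_iff)
      then show ?thesis using T(1) by (auto simp: D_def)
    qed
    moreover have "even (card (?A \<inter> comp {i, j} u))"
    proof -
      have "even (card (?A \<inter> ?B))"
        by (rule part[of _ i]) (use even_im stable_mono[OF B(2)] in \<open>auto simp: D_def\<close>)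
      then show ?thesis using single'[OF u] by simp
    qed
    ultimately show "even (card (?A \<inter> comp T u))" using even_im[OF _ u] by auto
  qed
  moreover obtain u where u: "u \<in> ?A" using A12(3) by blast
  ultimately have "nb m u \<in> R" "u \<in> R" using A12(1,2) unfolding stable_def by blast+
  then show False using R(2) by blast
qed

end

section \<open>Tetrahedral colexes\<close>

locale tetrahedral = colex K for K :: "'v colored_graph" +
  fixes v0 :: 'v
  assumes tetra: "tetrahedral_3colex K v0" and nonpath: "nonpathological K v0"
begin

abbreviation "B \<equiv> rgb_cell K v0"
abbreviation "N \<equiv> tet_qubits K v0"
abbreviation "Q \<equiv> outer_qubits K v0"
abbreviation "I \<equiv> inner_qubits K v0"
abbreviation "tetP \<equiv> tet_plaquettes K v0"
abbreviation "tetC \<equiv> tet_cells K v0"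
abbreviation "outP \<equiv> outer_plaquettes K v0"
abbreviation "inP \<equiv> inner_plaquettes K v0"
abbreviation "inS \<equiv> inner_cells K v0 \<union> (\<lambda>c. c \<inter> I) ` interface_cells K v0"

lemma v0: "v0 \<in> verts K"
  using tetra unfolding tetrahedral_3colex_def by blast

lemma B_verts: "B \<subseteq> verts K" and B_stable: "stable RGB B" and v0_B: "v0 \<in> B"
  unfolding rgb_cell_def using comp_verts comp_stable v0 comp_self by auto

lemma N_eq: "N = verts K - {v0}"
  unfolding tet_qubits_def ..

lemma Q_eq: "Q = B - {v0}"
  unfolding outer_qubits_def ..

lemma I_eq: "I = verts K - B"
  unfolding inner_qubits_def tet_qubits_def outer_qubits_def using v0_B by blast

lemma finite_B: "finite B"
  using B_verts finite_verts finite_subset by blast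

lemma finite_qubits: "finite N" "finite Q" "finite I"
  using finite_verts finite_B by (auto simp: N_eq Q_eq I_eq)

lemma I_stable: "stable RGB I"
  unfolding I_eq using stable_Diff stable_verts B_stable by blast

lemma B_least: "u \<in> B \<Longrightarrow> u \<in> S \<Longrightarrow> stable RGB S \<Longrightarrow> B \<subseteq> S"
proof -
  assume u: "u \<in> B" "u \<in> S" "stable RGB S"
  then have "B = comp RGB u" unfolding rgb_cell_def using comp_eq[of u RGB v0] v0 by simp
  then show ?thesis using comp_least[of u S RGB] u B_verts by blast
qed

lemma tetPI: "card T = 2 \<Longrightarrow> u \<in> verts K \<Longrightarrow> v0 \<notin> comp T u \<Longrightarrow> comp T u \<in> tetP"
  unfolding tet_plaquettes_def plaquettes_def by blast

lemma tetPE: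
  assumes "p \<in> tetP"
  obtains T u where "card T = 2" "u \<in> verts K" "p = comp T u" "v0 \<notin> p" "p \<subseteq> verts K" "stable T p"
  using assms comp_verts comp_stable unfolding tet_plaquettes_def plaquettes_def by blast

lemma tetCI: "card T = 3 \<Longrightarrow> u \<in> verts K \<Longrightarrow> v0 \<notin> comp T u \<Longrightarrow> comp T u \<in> tetC"
  unfolding tet_cells_def cells_def by blast

lemma tetCE:
  assumes "c \<in> tetC"
  obtains T u where "card T = 3" "u \<in> verts K" "c = comp T u" "v0 \<notin> c" "c \<subseteq> verts K" "stable T c"
  using assms comp_verts comp_stable unfolding tet_cells_def cells_def by blast

lemma outP_tetP: "outP \<subseteq> tetP" and inP_tetP: "inP \<subseteq> tetP"
  unfolding outer_plaquettes_def inner_plaquettes_def by auto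

lemma tetP_N: "tetP \<subseteq> Pow N" and tetC_N: "tetC \<subseteq> Pow N"
  unfolding N_eq using tetPE tetCE by blast+

lemma outP_Q: "outP \<subseteq> Pow Q" and inP_I: "inP \<subseteq> Pow I"
  unfolding outer_plaquettes_def inner_plaquettes_def by auto

lemma v0_notin_I: "v0 \<notin> I" and I_N: "I \<subseteq> N" and Q_N: "Q \<subseteq> N" and QI_N: "Q \<union> I = N" "Q \<inter> I = {}"
  using v0_B B_verts by (auto simp: I_eq N_eq Q_eq)

lemma stable_in_xor_span_comps:
  assumes "S \<subseteq> verts K" "stable T S" "\<And>u. u \<in> S \<Longrightarrow> comp T u \<subseteq> S \<Longrightarrow> comp T u \<in> xor_span G"
  shows "S \<in> xor_span G"
proof -
  have "comp T ` S \<subseteq> xor_span G"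
    using assms comp_least[of _ S T] by blast
  then show ?thesis
    using stable_in_comps_span[OF assms(1,2)] xor_span_least by blast
qed

section \<open>The code of the tetrahedral colex\<close>

lemma odd_Q: "odd (card Q)"
proof -
  have "even (card B)" using even_stable_color[OF B_verts B_stable, of Red] by simp
  moreover have "card B = Suc (card Q)"
    using card_Suc_Diff1[OF finite_B v0_B] by (simp add: Q_eq)
  ultimately show ?thesis by simp
qed

lemma Q_Int: "v0 \<notin> p \<Longrightarrow> p \<inter> Q = p \<inter> B"
  unfolding Q_eq by blast

text \<open>A plaquette and \<open>B\<close> share a color by counting, and a plaquette avoiding
  \<open>v0\<close> meets \<open>Q\<close> as it meets \<open>B\<close>.\<close>

lemma Q_perp: "Q \<in> perp N tetP"
proof -
  have "even (card (Q \<inter> p))" if p: "p \<in> tetP" for p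
  proof -
    obtain T where "card T = 2" "p \<subseteq> verts K" "stable T p" "v0 \<notin> p" using p by (rule tetPE)
    then show ?thesis
      using even_Int_stable[of p T RGB B] B_stable Q_Int[of p] by (simp add: Int_commute)
  qed
  then show ?thesis unfolding perp_def using Q_N by blast
qed

lemma even_tetC: "c \<in> tetC \<Longrightarrow> c' \<in> tetC \<Longrightarrow> even (card (c \<inter> c'))"
  by (elim tetCE) (auto intro: even_Int_stable)

lemma tetC_perp: "tetC \<subseteq> perp N tetP"
proof
  fix c assume c: "c \<in> tetC"
  have "even (card (c \<inter> p))" if "p \<in> tetP" for p
    using c that by (elim tetCE tetPE) (auto intro: even_Int_stable)
  then show "c \<in> perp N tetP" unfolding perp_def using c tetC_N by blast
qed

lemma tetC_span: "tetC \<subseteq> xor_span tetP"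
proof
  fix c assume "c \<in> tetC"
  then obtain T u where c: "card T = 3" "u \<in> verts K" "c = comp T u" "v0 \<notin> c" "c \<subseteq> verts K" "stable T c"
    by (rule tetCE)
  obtain T' where T': "T' \<subseteq> T" "card T' = 2" using pair_in_RGB[OF c(1)] by blast
  show "c \<in> xor_span tetP"
  proof (rule stable_in_xor_span_comps[OF c(5) stable_mono[OF c(6) T'(1)]])
    fix w assume "w \<in> c" "comp T' w \<subseteq> c"
    then show "comp T' w \<in> xor_span tetP" using xor_span_base tetPI[OF T'(2)] c by blast
  qed
qed

text \<open>The case of all four colors on the 3-sphere, where the faces of codimension one are the
  cells.\<close>

lemma even_perp_tetC:
  assumes A: "A \<in> perp N tetP" "even (card A)"
  shows "A \<in> xor_span tetC"
proof -
  have W: "comp UNIV v0 = verts K" using comp_UNIV v0 by blast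
  have "A \<in> xor_span {comp (UNIV - {k}) u | k u. k \<in> UNIV \<and> u \<in> comp UNIV v0 \<and> v0 \<notin> comp (UNIV - {k}) u}"
  proof (rule punctured_decomposition[of "faces K" "sphere (0 :: real^4) 1"])
    show "down_closed (faces K)" unfolding down_closed_def by blast
    show "realization (faces K) homeomorphic sphere (0 :: real^4) 1"
      using tetra unfolding tetrahedral_3colex_def by blast
    show "2 \<le> card (UNIV :: color set)" by (simp add: card_UNIV_color)
    show "fst a \<subseteq> UNIV \<and> snd a \<subseteq> comp UNIV v0" if "a \<in> faces K" for a
      using face_eq_comp[OF that] comp_verts W by blast
    show "({k}, comp {k} u) \<in> faces K" if "u \<in> comp UNIV v0" for k u
      using face_compI[of "{k}" u] that W by simp
    show "A \<subseteq> comp UNIV v0 - {v0}" using A(1) W unfolding perp_def N_eq by simp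
    show "even (card (A \<inter> comp T u))"
      if "card T = 2" "u \<in> comp UNIV v0" "v0 \<notin> comp T u" for T u
      using A(1) tetPI[OF that(1) _ that(3)] that(2) W unfolding perp_def by simp
  qed (use A sphere_topology v0 in auto)
  moreover have "xor_span {comp (UNIV - {k}) u | k u. k \<in> UNIV \<and> u \<in> comp UNIV v0 \<and> v0 \<notin> comp (UNIV - {k}) u}
      \<subseteq> xor_span tetC"
  proof (rule xor_span_least, rule subsetI)
    fix c assume "c \<in> {comp (UNIV - {k}) u | k u. k \<in> UNIV \<and> u \<in> comp UNIV v0 \<and> v0 \<notin> comp (UNIV - {k}) u}"
    then obtain k u where c: "c = comp (UNIV - {k}) u" "u \<in> verts K" "v0 \<notin> c" using W by auto
    have "card (UNIV - {k}) = 3" by (simp add: card_UNIV_color card_Diff_singleton)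
    then show "c \<in> xor_span tetC" using c tetCI xor_span_base by blast
  qed
  ultimately show ?thesis by blast
qed

lemmas tet_generator =
  odd_generator[OF finite_qubits(1) Q_perp odd_Q tetC_perp tetC_span even_perp_tetC tetP_N]

section \<open>The outer code\<close>

lemma realization_empty: "realization {} = {}"
  unfolding realization_def by simp

lemma inner_ball: "realization (inner_faces K v0) homeomorphic cball (0 :: real^3) 1"
proof -
  have "\<exists>f g. homeomorphism (realization (inner_faces K v0)) (cball (0 :: real^3) 1) f g \<and>
      f ` (\<Union>c\<in>boundary_cells K v0. region K v0 c) = sphere 0 1"
    using nonpath unfolding nonpathological_def by (elim conjE)
  then show ?thesis unfolding homeomorphic_def by blast
qed

lemma region_disc:
  assumes "c \<in> boundary_cells K v0"
  shows "region K v0 c homeomorphic cball (0 :: real^2) 1"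
proof -
  have "\<forall>c\<in>boundary_cells K v0. region K v0 c homeomorphic cball (0 :: real^2) 1"
    using nonpath unfolding nonpathological_def by (elim conjE)
  then show ?thesis using assms ..
qed

section \<open>How cells meet the facet\<close>

lemma inner_nonempty: "I \<noteq> {}"
proof
  assume "I = {}"
  then have "inner_faces K v0 = {}"
    unfolding inner_faces_def using face_nonempty by auto
  then have "({} :: ('v face \<Rightarrow> real) set) homeomorphic cball (0 :: real^3) 1"
    using inner_ball by (simp only: realization_empty)
  then show False by (simp add: homeomorphic_empty)
qed

lemma not_stable_UNIV: "S \<subseteq> B \<Longrightarrow> S \<noteq> {} \<Longrightarrow> \<not> stable UNIV S"
proof
  assume S: "S \<subseteq> B" "S \<noteq> {}" "stable UNIV S"
  then obtain u where u: "u \<in> S" by blast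
  then have "verts K \<subseteq> S"
    using comp_least[of u S UNIV] comp_UNIV[of u] S B_verts by blast
  then show False using S(1) inner_nonempty I_eq by blast
qed

lemma card_UNIV_minus: "card (UNIV - {k :: color}) = 3"
  by (simp add: card_UNIV_color card_Diff_singleton)

text \<open>Cells are compared with \<open>B\<close> as vertex sets, so one with yellow edges might
  coincide with it. Then \<open>B\<close> would be closed under all four colors and, the graph being
  connected, leave no inner vertices.\<close>

lemma boundary_cell:
  assumes v: "v \<in> B" and k: "k \<in> RGB"
  shows "(UNIV - {k}, comp (UNIV - {k}) v) \<in> boundary_cells K v0"
proof -
  have "comp (UNIV - {k}) v \<noteq> B"
  proof
    assume "comp (UNIV - {k}) v = B"
    then have "stable (UNIV - {k}) B" using comp_stable[of v] v B_verts by (metis subsetD)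
    then have "stable ((UNIV - {k}) \<union> RGB) B" using stable_Un_colors B_stable by blast
    moreover have "(UNIV - {k}) \<union> RGB = UNIV" using k by blast
    ultimately show False using not_stable_UNIV[of B] v0_B by auto
  qed
  then show ?thesis
    unfolding boundary_cells_def
    using face_compI[of "UNIV - {k}" v] card_UNIV_minus v B_verts comp_self by auto
qed

lemma region_connected:
  assumes c: "c \<in> boundary_cells K v0"
    and f: "\<And>u j. u \<in> I \<Longrightarrow> nb j u \<in> I \<Longrightarrow> u \<in> snd c \<Longrightarrow> j \<in> fst c \<Longrightarrow> f u = f (nb j u)"
    and u: "u \<in> snd c" "u \<in> I" and v: "v \<in> snd c" "v \<in> I"
  shows "(f u :: bool) = f v"
proof -
  let ?F = "{a \<in> inner_faces K v0. face_le a c}"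
  have cf: "c \<in> faces K" using c unfolding boundary_cells_def by blast
  have F: "down_closed ?F"
    unfolding down_closed_def inner_faces_def face_le_def by auto
  have conn: "connected (realization ?F)"
    using region_disc[OF c] homeomorphic_connectedness convex_connected convex_cball
    unfolding region_def by blast
  have point: "({}, {w}) \<in> ?F" if "w \<in> snd c" "w \<in> I" for w
    using subface[OF cf that(1), of "{}"] that(2) by (auto simp: comp_empty inner_faces_def)
  show ?thesis
  proof (rule connected_faces_const[OF F conn _ point[OF u] _ point[OF v]])
    fix a w j assume a: "a \<in> ?F" "w \<in> snd a" "j \<in> fst a"
    then have af: "a \<in> faces K" "snd a \<subseteq> I" "face_le a c" unfolding inner_faces_def by auto
    have "nb j w \<in> snd a"
      using face_eq_comp[OF af(1) a(2)] comp_step[OF comp_self] a(3) by auto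
    then show "f w = f (nb j w)"
      using f[of w j] af a unfolding face_le_def by blast
  qed simp_all
qed

lemma region_nonempty:
  assumes c: "c \<in> boundary_cells K v0"
  shows "snd c \<inter> I \<noteq> {}"
proof
  assume empty: "snd c \<inter> I = {}"
  have "{a \<in> inner_faces K v0. face_le a c} = {}"
    unfolding inner_faces_def face_le_def using empty face_nonempty by blast
  then have "({} :: ('v face \<Rightarrow> real) set) homeomorphic cball (0 :: real^2) 1"
    using region_disc[OF c] by (simp only: region_def realization_empty)
  then show False by (simp add: homeomorphic_empty)
qed

lemma B_not_plaquette:
  assumes T: "T \<subseteq> RGB" "card T = 2" and v: "v \<in> B"
  shows "comp T v \<noteq> B"
proof -
  obtain m where m: "m \<in> RGB" "T = RGB - {m}" using pair_eq_RGB_minus[OF T] by blast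
  obtain i j where ij: "T = {i, j}" "i \<noteq> j" using T(2) by (meson card_2_iff)
  have "RGB = {i, j, m}" using ij(1) m by blast
  moreover have "i \<noteq> m" "j \<noteq> m" using ij m by blast+
  moreover have "B = comp RGB v" unfolding rgb_cell_def using comp_eq v v0 unfolding rgb_cell_def by metis
  ultimately show ?thesis using cell_not_plaquette[of v i j m] v B_verts ij by auto
qed

text \<open>The intersection is a plaquette of unknown colors \<open>T\<close> and is also closed
  under \<open>RGB - {k}\<close>. For any other \<open>T\<close> it is closed under at least three
  colors. All four are excluded by connectedness; all but \<open>k\<close> would put the cell inside
  \<open>B\<close>, against its disc of inner vertices; red, green and blue would make
  \<open>B\<close> a single plaquette.\<close>

lemma cell_Int_B:
  assumes v: "v \<in> B" and k: "k \<in> RGB"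
  shows "comp (UNIV - {k}) v \<inter> B = comp (RGB - {k}) v"
proof -
  let ?c = "comp (UNIV - {k}) v"
  have vK: "v \<in> verts K" using v B_verts by blast
  have bc: "(UNIV - {k}, ?c) \<in> boundary_cells K v0" by (rule boundary_cell[OF v k])
  have "?c \<in> cells K" unfolding cells_def using card_UNIV_minus vK by blast
  moreover have "?c \<noteq> B" using bc unfolding boundary_cells_def by simp
  moreover have "v \<in> ?c \<inter> B" using v comp_self by blast
  ultimately have "?c \<inter> B \<in> plaquettes K"
    using nonpath unfolding nonpathological_def by (metis emptyE)
  then obtain T w where T: "card T = 2" "w \<in> verts K" "?c \<inter> B = comp T w"
    unfolding plaquettes_def by blast
  have p: "?c \<inter> B = comp T v"
    using comp_eq[of v T w] T v comp_self by auto
  have T_stable: "stable T (?c \<inter> B)" unfolding p by (rule comp_stable[OF vK])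
  have "stable (RGB - {k}) ?c" by (rule stable_mono[OF comp_stable[OF vK]]) blast
  moreover have "stable (RGB - {k}) B" by (rule stable_mono[OF B_stable]) blast
  ultimately have "stable (RGB - {k}) (?c \<inter> B)" by (rule stable_Int)
  then have st: "stable (T \<union> (RGB - {k})) (?c \<inter> B)" using stable_Un_colors T_stable by blast
  have "T = RGB - {k}"
  proof (rule ccontr)
    assume neq: "T \<noteq> RGB - {k}"
    have card_k: "card (RGB - {k}) = 2" using k by auto
    show False
    proof (cases "Yellow \<in> T")
      case Y: True
      show False
      proof (cases "k \<in> T")
        case True
        then have "T \<union> (RGB - {k}) = UNIV" using Y UNIV_color by auto
        then show False using not_stable_UNIV[of "?c \<inter> B"] st \<open>v \<in> ?c \<inter> B\<close> by auto
      next
        case False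
        have "UNIV - {k} \<subseteq> T \<union> (RGB - {k})" using Y UNIV_color by auto
        then have "?c \<subseteq> ?c \<inter> B"
          using comp_least[OF vK \<open>v \<in> ?c \<inter> B\<close>] stable_mono[OF st] by blast
        then show False using region_nonempty[OF bc] I_eq by auto
      qed
    next
      case False
      then have TR: "T \<subseteq> RGB" using RGB_Yellow by blast
      have "k \<in> T"
      proof (rule ccontr)
        assume "k \<notin> T"
        then have "T \<subseteq> RGB - {k}" using TR by blast
        then have "T = RGB - {k}" using card_subset_eq[of "RGB - {k}" T] card_k T(1) by simp
        then show False using neq by simp
      qed
      then have "RGB \<subseteq> T \<union> (RGB - {k})" by blast
      then have "B \<subseteq> ?c \<inter> B"
        using B_least[of v "?c \<inter> B"] v \<open>v \<in> ?c \<inter> B\<close> stable_mono[OF st] by blast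
      then have "comp T v = B" using p by blast
      then show False using B_not_plaquette[OF TR T(1) v] by simp
    qed
  qed
  then show ?thesis using p by simp
qed

text \<open>
  A plaquette of \<open>Q\<close> that uses yellow edges is not a plaquette of the facet, but it still meets the
  plaquettes of the facet evenly, because each of these is cut out of \<open>B\<close> by a cell with yellow edges.
\<close>

lemma even_outP_Yellow:
  assumes "card T = 2" "card T' = 2" "u \<in> verts K" "u' \<in> verts K"
    "comp T u \<subseteq> B" "comp T' u' \<subseteq> B" "Yellow \<in> T" "Yellow \<notin> T'"
  shows "even (card (comp T u \<inter> comp T' u'))"
proof -
  have "T' \<subseteq> RGB" using assms(8) RGB_Yellow by blast
  then obtain k where k: "k \<in> RGB" "T' = RGB - {k}" using pair_eq_RGB_minus assms(2) by blast
  have "u' \<in> B" using comp_self assms(6) by blast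
  then have "comp T' u' = comp (UNIV - {k}) u' \<inter> B" using cell_Int_B k by simp
  then have eq: "comp T u \<inter> comp T' u' = comp T u \<inter> comp (UNIV - {k}) u'" using assms(5) by blast
  have "stable {Yellow} (comp T u)" "stable {Yellow} (comp (UNIV - {k}) u')"
    using stable_mono[OF comp_stable] assms(3,4,7) k(1) RGB_Yellow by auto
  then show ?thesis
    unfolding eq using even_stable[of _ Yellow] stable_Int comp_verts[OF assms(3)]
    by (metis Int_lower1 subset_trans)
qed

text \<open>A shared color pairs up the intersection. Disjoint color pairs exhaust the four colors,
  so exactly one of them contains yellow.\<close>

lemma even_outP:
  assumes p: "p \<in> outP" and p': "p' \<in> outP"
  shows "even (card (p \<inter> p'))"
proof -
  have "p \<in> tetP" "p' \<in> tetP" and sub: "p \<subseteq> B" "p' \<subseteq> B"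
    using p p' outP_tetP outP_Q Q_eq by auto
  from this(1,2) obtain T u T' u' where T: "card T = 2" "u \<in> verts K" "p = comp T u" "p \<subseteq> verts K" "stable T p"
    and T': "card T' = 2" "u' \<in> verts K" "p' = comp T' u'" "stable T' p'"
    by (elim tetPE) blast
  show ?thesis
  proof (cases "T \<inter> T' = {}")
    case False
    then obtain k where k: "k \<in> T" "k \<in> T'" by blast
    then have "stable {k} (p \<inter> p')" using T(5) T'(4) unfolding stable_def by blast
    then show ?thesis using even_stable T(4) by blast
  next
    case True
    then have "card (T \<union> T') = card (UNIV :: color set)"
      using T(1) T'(1) by (simp add: card_Un_disjoint card_UNIV_color)
    then have "T \<union> T' = UNIV" by (intro card_subset_eq) auto
    then consider "Yellow \<in> T" "Yellow \<notin> T'" | "Yellow \<in> T'" "Yellow \<notin> T"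
      using True by blast
    then show ?thesis
    proof cases
      case 1
      then show ?thesis using even_outP_Yellow[OF T(1) T'(1) T(2) T'(2)] sub T(3) T'(3) by simp
    next
      case 2
      then show ?thesis
        using even_outP_Yellow[OF T'(1) T(1) T'(2) T(2)] sub T(3) T'(3) by (simp add: Int_commute)
    qed
  qed
qed

lemma outPI: "T \<subseteq> RGB \<Longrightarrow> card T = 2 \<Longrightarrow> u \<in> B \<Longrightarrow> v0 \<notin> comp T u \<Longrightarrow> comp T u \<in> outP"
proof -
  assume T: "T \<subseteq> RGB" "card T = 2" and u: "u \<in> B" "v0 \<notin> comp T u"
  have uK: "u \<in> verts K" using u(1) B_verts by blast
  have "comp T u \<subseteq> B"
    using comp_least[OF uK u(1)] stable_mono[OF B_stable T(1)] by blast
  then show ?thesis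
    using tetPI[OF T(2) uK u(2)] u(2) unfolding outer_plaquettes_def Q_eq by blast
qed

lemma outP_perp: "outP \<subseteq> perp Q outP"
  unfolding perp_def using outP_Q even_outP by blast

lemma Q_perp_outP: "Q \<in> perp Q outP"
  using Q_perp outP_tetP unfolding perp_def by blast

text \<open>The case of three colors on the boundary sphere of the facet cell, where the faces of
  codimension one are the plaquettes.\<close>

lemma even_perp_outP:
  assumes A: "A \<in> perp Q outP" "even (card A)"
  shows "A \<in> xor_span outP"
proof -
  let ?c = "(RGB, comp RGB v0)"
  have c: "?c \<in> faces K" "card (fst ?c) = 3" using face_compI[OF _ v0] by auto
  have B: "comp RGB v0 = B" unfolding rgb_cell_def ..
  have "A \<in> xor_span {comp (RGB - {k}) u | k u. k \<in> RGB \<and> u \<in> comp RGB v0 \<and> v0 \<notin> comp (RGB - {k}) u}"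
  proof (rule punctured_decomposition[OF down_closed_proper_faces[OF c(1)]
        cell_boundary_sphere[OF c] sphere_topology(1,2) v0])
    show "fst a \<subseteq> RGB \<and> snd a \<subseteq> comp RGB v0" if "a \<in> proper_faces ?c" for a
      using that unfolding proper_faces_def face_le_def by simp
    show "({k}, comp {k} u) \<in> proper_faces ?c" if "k \<in> RGB" "u \<in> comp RGB v0" for k u
    proof -
      have "{k} \<subset> RGB" using that(1) by blast
      then show ?thesis using proper_facesI[OF c(1), of u "{k}"] that(2) by simp
    qed
    show "A \<subseteq> comp RGB v0 - {v0}" using A(1) unfolding perp_def Q_eq B by blast
    show "even (card (A \<inter> comp T u))"
      if "T \<subseteq> RGB" "card T = 2" "u \<in> comp RGB v0" "v0 \<notin> comp T u" for T u
      using A(1) outPI[OF that(1,2) _ that(4)] that(3) B unfolding perp_def by simp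
  qed (use A in simp_all)
  moreover have "xor_span {comp (RGB - {k}) u | k u. k \<in> RGB \<and> u \<in> comp RGB v0 \<and> v0 \<notin> comp (RGB - {k}) u}
      \<subseteq> xor_span outP"
  proof (rule xor_span_least, rule subsetI)
    fix p assume "p \<in> {comp (RGB - {k}) u | k u. k \<in> RGB \<and> u \<in> comp RGB v0 \<and> v0 \<notin> comp (RGB - {k}) u}"
    then obtain k u where p: "p = comp (RGB - {k}) u" "k \<in> RGB" "u \<in> B" "v0 \<notin> p" using B by auto
    have "card (RGB - {k}) = 2" using p(2) by auto
    then show "p \<in> xor_span outP" using p outPI[of "RGB - {k}" u] xor_span_base by blast
  qed
  ultimately show ?thesis by blast
qed

lemma outP_span: "outP \<subseteq> xor_span outP"
  using xor_span_base by blast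

lemmas out_generator =
  odd_generator[OF finite_qubits(2) Q_perp_outP odd_Q outP_perp outP_span even_perp_outP outP_Q]

section \<open>The inner code\<close>

lemma down_closed_inner_faces: "down_closed (inner_faces K v0)"
  unfolding down_closed_def inner_faces_def face_le_def by auto

lemma inner_point: "u \<in> I \<Longrightarrow> ({}, {u}) \<in> inner_faces K v0"
  using face_compI[of "{}" u] unfolding inner_faces_def I_eq by (simp add: comp_empty)

lemma inner_edge: "u \<in> I \<Longrightarrow> nb j u \<in> I \<Longrightarrow> ({j}, comp {j} u) \<in> inner_faces K v0"
  using face_compI[of "{j}" u] comp_edge[of u j] unfolding inner_faces_def I_eq by auto

text \<open>Inner and interface cells can be treated alike, since a cell avoiding \<open>Q\<close>
  is its own restriction.\<close>

lemma inS_eq: "inS = {c \<inter> I | c. c \<in> tetC \<and> c \<inter> I \<noteq> {}}"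
proof (intro equalityI subsetI)
  fix s assume "s \<in> inS"
  then consider "s \<in> inner_cells K v0" | c where "c \<in> interface_cells K v0" "s = c \<inter> I" by blast
  then show "s \<in> {c \<inter> I | c. c \<in> tetC \<and> c \<inter> I \<noteq> {}}"
  proof cases
    case 1
    then have s: "s \<in> tetC" "s \<subseteq> I" unfolding inner_cells_def by auto
    then have "s \<noteq> {}" using comp_self unfolding tet_cells_def cells_def by auto
    moreover have "s = s \<inter> I" using s(2) by blast
    ultimately show ?thesis using s(1) by blast
  next
    case 2
    then show ?thesis unfolding interface_cells_def by blast
  qed
next
  fix s assume "s \<in> {c \<inter> I | c. c \<in> tetC \<and> c \<inter> I \<noteq> {}}"
  then obtain c where c: "s = c \<inter> I" "c \<in> tetC" "c \<inter> I \<noteq> {}" by blast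
  show "s \<in> inS"
  proof (cases "c \<inter> Q = {}")
    case True
    then have "c \<subseteq> I" using c(2) tetC_N QI_N by blast
    then have "s = c" "c \<in> inner_cells K v0" using c unfolding inner_cells_def by auto
    then show ?thesis by blast
  next
    case False
    then have "c \<in> interface_cells K v0" using c unfolding interface_cells_def by blast
    then show ?thesis using c(1) by blast
  qed
qed

lemma inS_I: "inS \<subseteq> Pow I"
  unfolding inS_eq by blast

lemma inS_cases:
  assumes "s \<in> inS"
  obtains T c where "card T = 3" "s = c \<inter> I" "c \<in> tetC" "c \<subseteq> verts K" "stable T c"
proof -
  obtain c where c: "s = c \<inter> I" "c \<in> tetC" using assms unfolding inS_eq by blast
  from c(2) obtain T where "card T = 3" "c \<subseteq> verts K" "stable T c" by (rule tetCE)
  then show thesis using that c by blast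
qed

text \<open>Two cells share at least two colors, one of them not yellow. Its edges do not leave
  \<open>I\<close>, so the pairing survives the restriction.\<close>

lemma even_inS:
  assumes s: "s \<in> inS" and s': "s' \<in> inS"
  shows "even (card (s \<inter> s'))"
proof -
  obtain T c where c: "card T = 3" "s = c \<inter> I" "c \<subseteq> verts K" "stable T c"
    using s by (rule inS_cases)
  obtain T' c' where c': "card T' = 3" "s' = c' \<inter> I" "stable T' c'"
    using s' by (rule inS_cases)
  have "stable (T \<inter> T') (c \<inter> c')"
    using stable_Int[OF stable_mono[OF c(4), of "T \<inter> T'"] stable_mono[OF c'(3), of "T \<inter> T'"]]
    by simp
  moreover have "2 \<le> card (T \<inter> T')" using card_Int_colors[of T T'] c(1) c'(1) by simp
  ultimately have "even (card ((c \<inter> c') \<inter> I))"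
    using even_Int_stable[of "c \<inter> c'" "T \<inter> T'" RGB I] c(3) I_stable by auto
  moreover have "s \<inter> s' = (c \<inter> c') \<inter> I" using c(2) c'(2) by blast
  ultimately show ?thesis by simp
qed

lemma inS_perp: "inS \<subseteq> perp I inP"
proof
  fix s assume s: "s \<in> inS"
  then obtain T c where c: "card T = 3" "s = c \<inter> I" "c \<subseteq> verts K" "stable T c"
    by (rule inS_cases)
  have "even (card (s \<inter> p))" if p: "p \<in> inP" for p
  proof -
    have "p \<in> tetP" "p \<subseteq> I" using p inP_tetP inP_I by auto
    from this(1) obtain T' where "card T' = 2" "stable T' p" by (rule tetPE)
    then have "even (card (c \<inter> p))" using even_Int_stable[OF c(3,4)] c(1) by simp
    moreover have "s \<inter> p = c \<inter> p" using c(2) \<open>p \<subseteq> I\<close> by blast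
    ultimately show ?thesis by simp
  qed
  then show "s \<in> perp I inP" unfolding perp_def using c(2) by blast
qed

lemma inS_span: "inS \<subseteq> xor_span inP"
proof
  fix s assume "s \<in> inS"
  then obtain T c where c: "card T = 3" "s = c \<inter> I" "c \<in> tetC" "c \<subseteq> verts K" "stable T c"
    by (rule inS_cases)
  obtain T' where T': "T' \<subseteq> T" "T' \<subseteq> RGB" "card T' = 2" using pair_in_RGB[OF c(1)] by blast
  show "s \<in> xor_span inP"
  proof (rule stable_in_xor_span_comps)
    show "s \<subseteq> verts K" using c by blast
    show "stable T' s"
      unfolding c(2) by (rule stable_Int[OF stable_mono[OF c(5) T'(1)] stable_mono[OF I_stable T'(2)]])
    fix u assume u: "u \<in> s" "comp T' u \<subseteq> s"
    then have "comp T' u \<subseteq> I" "u \<in> verts K" using c(2,4) by auto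
    then have "comp T' u \<in> inP"
      using tetPI[OF T'(3)] v0_notin_I unfolding inner_plaquettes_def by blast
    then show "comp T' u \<in> xor_span inP" by (rule xor_span_base)
  qed
qed

text \<open>A cell inside \<open>I\<close> is connected by its own edges. A cell meeting
  \<open>B\<close> loses some of them, and its inner part stays connected because its region is a
  disc. The cell \<open>B\<close> itself has no inner vertices.\<close>

lemma cell_inner_const:
  assumes w: "w \<in> verts K"
    and f: "\<And>u j. u \<in> I \<Longrightarrow> nb j u \<in> I \<Longrightarrow> j \<noteq> k \<Longrightarrow> f u = f (nb j u)"
    and uv: "u \<in> comp (UNIV - {k}) w" "u \<in> I" "v \<in> comp (UNIV - {k}) w" "v \<in> I"
  shows "(f u :: bool) = f v"
proof (cases "comp (UNIV - {k}) w \<inter> B = {}")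
  case True
  let ?c = "comp (UNIV - {k}) w"
  have sub: "?c \<subseteq> I" using True comp_verts[OF w] I_eq by blast
  have "f x = f w" if "x \<in> ?c" for x
    using that w
  proof (induction rule: comp_induct)
    case (step x j)
    have "nb j x \<in> ?c" using comp_step step by blast
    then show ?case using f[of x j] step sub by auto
  qed simp
  then show ?thesis using uv by simp
next
  case False
  let ?c = "comp (UNIV - {k}) w"
  obtain b where b: "b \<in> ?c" "b \<in> B" using False by blast
  have cb: "comp (UNIV - {k}) b = ?c" by (rule comp_eq[OF b(1) w])
  have "k \<noteq> Yellow"
  proof
    assume "k = Yellow"
    then have "?c = B"
      using cb comp_eq[of b RGB v0] b(2) v0 UNIV_minus_Yellow unfolding rgb_cell_def by simp
    then show False using uv I_eq by blast
  qed
  then have "(UNIV - {k}, ?c) \<in> boundary_cells K v0"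
    using boundary_cell[OF b(2)] cb RGB_Yellow by metis
  then show ?thesis
    by (rule region_connected[of _ f]) (use f uv in auto)
qed

text \<open>The space is now the inner ball. Edges leaving \<open>I\<close> are not among its faces,
  so the potentials are controlled only along edges with both ends inner.\<close>

lemma perp_inP_decomposition:
  assumes A: "A \<in> perp I inP"
  shows "\<exists>y. (\<forall>k. \<forall>u\<in>I. \<forall>j\<in>UNIV - {k}. nb j u \<in> I \<longrightarrow> (u \<in> y k \<longleftrightarrow> nb j u \<in> y k)) \<and>
    (\<forall>v\<in>I. v \<in> A \<longleftrightarrow> odd (card {k. v \<in> y k}))"
proof -
  let ?F = "inner_faces K v0"
  have conn: "connected (realization ?F)"
    using inner_ball homeomorphic_connectedness convex_connected convex_cball by blast
  have "\<exists>y. (\<forall>k\<in>UNIV. \<forall>u\<in>I. \<forall>j\<in>UNIV - {k}. nb j u \<in> I \<longrightarrow> (u \<in> y k \<longleftrightarrow> nb j u \<in> y k)) \<and>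
    (\<forall>v\<in>I. v \<in> A \<longleftrightarrow> odd (card {k \<in> UNIV. v \<in> y k}))"
  proof (rule decomposition[OF down_closed_inner_faces inner_ball])
    show "simply_connected (cball (0 :: real^3) 1)" "locally path_connected (cball (0 :: real^3) 1)"
      by (simp_all add: convex_imp_simply_connected convex_imp_locally_path_connected)
    fix a assume a: "a \<in> ?F" "card (fst a) = 2"
    then have af: "a \<in> faces K" "snd a \<subseteq> I" unfolding inner_faces_def by auto
    obtain u where u: "u \<in> snd a" using face_nonempty[OF af(1)] by blast
    have "snd a \<in> inP"
      using face_eq_comp[OF af(1) u] tetPI[OF a(2), of u] af(2) v0_notin_I
      unfolding inner_plaquettes_def by auto
    then show "even (card (A \<inter> snd a))" using A unfolding perp_def by blast
  next
    fix f :: "'v \<Rightarrow> bool"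
    assume f: "\<And>u j. u \<in> I \<Longrightarrow> j \<in> UNIV \<Longrightarrow> nb j u \<in> I \<Longrightarrow> f u = f (nb j u)"
    have "f u = f v" if "u \<in> I" "v \<in> I" for u v
    proof (rule connected_faces_const[OF down_closed_inner_faces conn _
          inner_point[OF that(1)] _ inner_point[OF that(2)]])
      fix a w j assume a: "a \<in> ?F" "w \<in> snd a" "j \<in> fst a"
      then have af: "a \<in> faces K" "snd a \<subseteq> I" unfolding inner_faces_def by auto
      have "nb j w \<in> snd a"
        using face_eq_comp[OF af(1) a(2)] comp_step[OF comp_self] a(3) by auto
      then show "f w = f (nb j w)" using f[of w j] af a by blast
    qed simp_all
    then show "\<forall>u\<in>I. \<forall>v\<in>I. f u = f v" by blast
  qed (use inner_edge in auto)
  then show ?thesis by simp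
qed

text \<open>
  The cells through \<open>v0\<close> are not available. The constants \<open>z k\<close> remove them from the sum, at the price
  of complementing the yellow summand, which involves no cell through \<open>v0\<close> because \<open>B\<close> has no inner
  vertices.
\<close>

lemma perp_inP_subset: "perp I inP \<subseteq> xor_span inS"
proof
  fix A assume A: "A \<in> perp I inP"
  then have AI: "A \<subseteq> I" unfolding perp_def by blast
  obtain y where y0:
    "\<forall>k. \<forall>u\<in>I. \<forall>j\<in>UNIV - {k}. nb j u \<in> I \<longrightarrow> (u \<in> y k \<longleftrightarrow> nb j u \<in> y k)"
    and odd_y: "\<forall>v\<in>I. v \<in> A \<longleftrightarrow> odd (card {k. v \<in> y k})"
    using perp_inP_decomposition[OF A] by blast
  let ?c = "\<lambda>k w. comp (UNIV - {k}) w"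
  have y: "u \<in> y k \<longleftrightarrow> v \<in> y k"
    if "w \<in> verts K" "u \<in> ?c k w" "u \<in> I" "v \<in> ?c k w" "v \<in> I" for k u v w
    by (rule cell_inner_const[of w k "\<lambda>u. u \<in> y k"]) (use y0 that in auto)
  \<comment> \<open>The constant value of \<open>y k\<close> on the inner vertices of the cell
    through \<open>v0\<close> without color \<open>k\<close>, and false if there are none, as for
    yellow.\<close>
  define \<zeta> where "\<zeta> k \<longleftrightarrow> (\<exists>u\<in>?c k v0 \<inter> I. u \<in> y k)" for k
  \<comment> \<open>The yellow entry is chosen to make the number of complemented summands even, so
    that their sum is still \<open>A\<close>.\<close>
  define z where "z k \<longleftrightarrow> (if k = Yellow then odd (card {k \<in> RGB. \<zeta> k}) else \<zeta> k)" for k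
  have even_z: "even (card {k. z k})"
  proof -
    have "{k \<in> UNIV - {Yellow}. z k} = {k \<in> RGB. \<zeta> k}"
      unfolding z_def UNIV_minus_Yellow by auto
    then have "odd (card {k \<in> UNIV. z k}) \<longleftrightarrow> (odd (card {k \<in> RGB. \<zeta> k}) \<noteq> z Yellow)"
      using odd_card_split[of UNIV Yellow z] by simp
    then show ?thesis unfolding z_def by simp
  qed
  define x where "x k = {u \<in> I. (u \<in> y k) \<noteq> z k}" for k
  have x_v0: "x k \<inter> ?c k v0 = {}" for k
  proof (cases "k = Yellow")
    case True
    then have "?c k v0 = B" unfolding rgb_cell_def using UNIV_minus_Yellow by simp
    then show ?thesis unfolding x_def I_eq by blast
  next
    case False
    have "u \<in> y k \<longleftrightarrow> \<zeta> k" if "u \<in> ?c k v0" "u \<in> I" for u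
      using y[OF v0 that] that unfolding \<zeta>_def by blast
    then show ?thesis using False unfolding x_def z_def by auto
  qed
  have "x k \<in> xor_span inS" for k
  proof -
    \<comment> \<open>Completes \<open>x k\<close> to whole cells. These add only outer vertices, so
      the restriction of \<open>S\<close> to \<open>I\<close> is \<open>x k\<close> again, and the
      components of \<open>S\<close> restrict to generators.\<close>
    define S where "S = (\<Union>u\<in>x k. ?c k u)"
    have xI: "x k \<subseteq> I" unfolding x_def by blast
    have S: "S \<subseteq> verts K" unfolding S_def using comp_verts xI I_eq by blast
    have S_stable: "stable (UNIV - {k}) S"
      using comp_stable xI I_eq unfolding S_def stable_def by blast
    have "S \<inter> I = x k"
    proof
      show "x k \<subseteq> S \<inter> I" using comp_self xI unfolding S_def by blast
      show "S \<inter> I \<subseteq> x k"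
      proof
        fix v assume v: "v \<in> S \<inter> I"
        then obtain u where u: "u \<in> x k" "v \<in> ?c k u" unfolding S_def by blast
        then have uI: "u \<in> I" "u \<in> verts K" using xI I_eq by auto
        have "u \<in> y k \<longleftrightarrow> v \<in> y k" using y[OF uI(2) comp_self uI(1) u(2)] v by blast
        then show "v \<in> x k" using u(1) v unfolding x_def by blast
      qed
    qed
    moreover
    have sub: "(\<lambda>c. c \<inter> I) ` ?c k ` S \<subseteq> xor_span inS"
    proof
      fix s assume "s \<in> (\<lambda>c. c \<inter> I) ` ?c k ` S"
      then obtain v where v: "v \<in> S" "s = ?c k v \<inter> I" by blast
      then obtain u where u: "u \<in> x k" "v \<in> ?c k u" unfolding S_def by blast
      then have uI: "u \<in> I" "u \<in> verts K" using xI I_eq by auto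
      have s: "s = ?c k u \<inter> I" using v(2) comp_eq[OF u(2) uI(2)] by simp
      have "v0 \<notin> ?c k u" using x_v0[of k] u(1) comp_sym[OF _ uI(2)] by blast
      then have "?c k u \<in> tetC" using tetCI[OF card_UNIV_minus uI(2)] by blast
      moreover have "u \<in> ?c k u \<inter> I" using uI comp_self by blast
      ultimately have "s \<in> inS" unfolding inS_eq s by blast
      then show "s \<in> xor_span inS" by (rule xor_span_base)
    qed
    have "S \<inter> I \<in> xor_span inS"
      by (rule subsetD[OF xor_span_least[OF sub] xor_span_Int[OF stable_in_comps_span[OF S S_stable]]])
    ultimately show ?thesis by simp
  qed
  then have "{u. odd (card {k \<in> UNIV. u \<in> x k})} \<in> xor_span inS"
    by (intro odd_sum_in_span finite_colors)
  moreover have "{u. odd (card {k \<in> UNIV. u \<in> x k})} = A"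
  proof (rule Set.set_eqI)
    fix u
    show "u \<in> {u. odd (card {k \<in> UNIV. u \<in> x k})} \<longleftrightarrow> u \<in> A"
    proof (cases "u \<in> I")
      case True
      then have "{k \<in> UNIV. u \<in> x k} = {k \<in> UNIV. (u \<in> y k) \<noteq> z k}" unfolding x_def by blast
      then have "odd (card {k \<in> UNIV. u \<in> x k}) \<longleftrightarrow> odd (card {k. u \<in> y k})"
        using odd_card_xor[of UNIV "\<lambda>k. u \<in> y k" z] even_z by simp
      then show ?thesis using odd_y True by simp
    next
      case False
      then have empty: "{k \<in> UNIV. u \<in> x k} = {}" unfolding x_def by blast
      have "u \<notin> A" using False AI by blast
      then show ?thesis unfolding mem_Collect_eq empty by simp
    qed
  qed
  ultimately show "A \<in> xor_span inS" by simp
qed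

lemma perp_inP: "perp I inP = xor_span inS"
  using perp_inP_subset xor_span_subset_perp[OF finite_qubits(3) inS_perp] by blast

lemma xor_span_inS_center: "xor_span inS = xor_span inP \<inter> perp I inP"
  unfolding perp_inP using xor_span_least[OF inS_span] by blast

section \<open>Splitting\<close>

text \<open>Restriction is linear, so single cells suffice. The part of a cell in the facet is a
  union of plaquettes without yellow edges that avoid \<open>v0\<close>; its inner part is a
  generator or empty.\<close>

lemma tetC_split:
  assumes a: "a \<in> xor_span tetC"
  shows "a \<inter> Q \<in> xor_span outP" "a \<inter> I \<in> xor_span inS"
proof -
  have "(\<lambda>c. c \<inter> Q) ` tetC \<subseteq> xor_span outP"
  proof
    fix s assume "s \<in> (\<lambda>c. c \<inter> Q) ` tetC"
    then obtain c where s: "s = c \<inter> Q" "c \<in> tetC" by blast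
    from s(2) obtain T where c: "card T = 3" "v0 \<notin> c" "c \<subseteq> verts K" "stable T c"
      by (rule tetCE)
    obtain T' where T': "T' \<subseteq> T" "T' \<subseteq> RGB" "card T' = 2" using pair_in_RGB[OF c(1)] by blast
    have "c \<inter> B \<in> xor_span outP"
    proof (rule stable_in_xor_span_comps)
      show "c \<inter> B \<subseteq> verts K" using c(3) by blast
      show "stable T' (c \<inter> B)"
        by (rule stable_Int[OF stable_mono[OF c(4) T'(1)] stable_mono[OF B_stable T'(2)]])
      fix u assume "u \<in> c \<inter> B" "comp T' u \<subseteq> c \<inter> B"
      then show "comp T' u \<in> xor_span outP" using outPI[OF T'(2,3), of u] c(2) xor_span_base by blast
    qed
    then show "s \<in> xor_span outP" using s(1) Q_Int[OF c(2)] by simp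
  qed
  then show "a \<inter> Q \<in> xor_span outP" using xor_span_Int[OF a, of Q] xor_span_least by blast
  have "(\<lambda>c. c \<inter> I) ` tetC \<subseteq> xor_span inS"
  proof
    fix s assume "s \<in> (\<lambda>c. c \<inter> I) ` tetC"
    then have "s = {} \<or> s \<in> inS" unfolding inS_eq by blast
    then show "s \<in> xor_span inS" using xor_span.empty[of inS] xor_span_base[of s inS] by blast
  qed
  from subsetD[OF xor_span_least[OF this] xor_span_Int[OF a]] show "a \<inter> I \<in> xor_span inS" .
qed

lemma finite_members:
  "a \<in> tetP \<Longrightarrow> finite a" "a \<in> tetC \<Longrightarrow> finite a" "a \<in> outP \<Longrightarrow> finite a"
  "a \<in> inP \<Longrightarrow> finite a" "a \<in> inS \<Longrightarrow> finite a"
  using tetP_N tetC_N outP_Q inP_I inS_I finite_qubits by (meson PowD finite_subset subsetD)+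

lemma gauge_inclusion: "G_2 K v0 <#>\<^bsub>op_group\<^esub> G_in K v0 \<subseteq> G_3 K v0"
proof -
  have H: "subgroup (G_3 K v0) op_group"
    unfolding G_3_def by (rule XZ_subgroup) (rule finite_members)
  have mono: "XZ_group A \<subseteq> G_3 K v0" if "A \<subseteq> tetP" for A
    unfolding G_3_def XZ_group_def
    by (rule group.mono_generate[OF op_group_is_group]) (use that in blast)
  have "G_2 K v0 \<subseteq> G_3 K v0" "G_in K v0 \<subseteq> G_3 K v0"
    unfolding G_2_def G_in_def using mono outP_tetP inP_tetP by auto
  then show ?thesis
    unfolding set_mult_def using subgroup.m_closed[OF H] by blast
qed

lemma stabilizer_inclusion: "S_3 K v0 \<subseteq> S_2 K v0 <#>\<^bsub>op_group\<^esub> S_in K v0"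
proof
  fix P assume "P \<in> S_3 K v0"
  then obtain a b where P: "P = pauli_op 1 a b" "a \<in> xor_span tetC" "b \<in> xor_span tetC"
    unfolding S_3_def using XZ_group_upper_commuting[OF finite_members(2) even_tetC]
    unfolding pauli_ops_def by blast
  have N: "a \<subseteq> N" "b \<subseteq> N" using P xor_span_subset_Pow[OF tetC_N] by auto
  have fin: "finite (b \<inter> Q)" "finite (b \<inter> I)" using finite_qubits by auto
  \<comment> \<open>The outer X part and the inner Z part live on different qubits, so splitting the
    operator costs no sign.\<close>
  have disj: "(a \<inter> Q) \<inter> (b \<inter> I) = {}" using QI_N by blast
  have "sym_diff (a \<inter> Q) (a \<inter> I) = a" "sym_diff (b \<inter> Q) (b \<inter> I) = b"
    using N QI_N by blast+
  then have "pauli_op 1 (a \<inter> Q) (b \<inter> Q) \<otimes>\<^bsub>op_group\<^esub> pauli_op 1 (a \<inter> I) (b \<inter> I) = P"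
    unfolding P(1) pauli_op_mult[OF one_neq_zero one_neq_zero fin] disj by simp
  moreover have "pauli_op 1 (a \<inter> Q) (b \<inter> Q) \<in> S_2 K v0" "pauli_op 1 (a \<inter> I) (b \<inter> I) \<in> S_in K v0"
    unfolding S_2_def S_in_def
    by (intro XZ_group_lower tetC_split P finite_members; assumption)+
  ultimately show "P \<in> S_2 K v0 <#>\<^bsub>op_group\<^esub> S_in K v0"
    unfolding set_mult_def by blast
qed

section \<open>The three codes and their representative groups\<close>

lemma tet_code: "stabilizer_subsystem_code N (S_3 K v0) (G_3 K v0)"
  unfolding S_3_def G_3_def
  by (rule css_code[OF finite_qubits(1) tetC_N tetP_N even_tetC tet_generator(3)])

lemma outer_code: "stabilizer_subsystem_code Q (S_2 K v0) (G_2 K v0)"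
  unfolding S_2_def G_2_def
  by (rule css_code[OF finite_qubits(2) outP_Q outP_Q even_outP out_generator(3)])

lemma inner_code: "stabilizer_subsystem_code I (S_in K v0) (G_in K v0)"
  unfolding S_in_def G_in_def
  by (rule css_code[OF finite_qubits(3) inS_I inP_I even_inS xor_span_inS_center])

lemma generate_Q: "generate op_group {X_op Q, Z_op Q} = XZ_group {Q}"
  unfolding XZ_group_def by (simp add: insert_commute)

lemma xor_span_Q_Int: "Q \<notin> xor_span S \<Longrightarrow> xor_span {Q} \<inter> xor_span S = {{}}"
  unfolding xor_span_singleton using xor_span.empty[of S] by blast

lemma tet_representative: "representative_group N (S_3 K v0) (G_3 K v0) (XZ_group {Q})"
  unfolding S_3_def G_3_def
proof (rule css_representative_group[OF finite_qubits(1) tetC_N tetP_N])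
  show "{Q} \<subseteq> Pow N" using Q_N by blast
  show "xor_span {Q} \<inter> xor_span tetC = {{}}" by (rule xor_span_Q_Int[OF tet_generator(1)])
  show "perp N tetP = {sym_diff l s | l s. l \<in> xor_span {Q} \<and> s \<in> xor_span tetC}"
    unfolding xor_span_singleton by (rule tet_generator(2))
qed

lemma outer_representative: "representative_group Q (S_2 K v0) (G_2 K v0) (XZ_group {Q})"
  unfolding S_2_def G_2_def
proof (rule css_representative_group[OF finite_qubits(2) outP_Q outP_Q])
  show "{Q} \<subseteq> Pow Q" by blast
  show "xor_span {Q} \<inter> xor_span outP = {{}}" by (rule xor_span_Q_Int[OF out_generator(1)])
  show "perp Q outP = {sym_diff l s | l s. l \<in> xor_span {Q} \<and> s \<in> xor_span outP}"
    unfolding xor_span_singleton by (rule out_generator(2))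
qed

text \<open>The orthogonal complement is the stabilizer span itself, so the trivial group represents
  all classes.\<close>

lemma inner_representative: "representative_group I (S_in K v0) (G_in K v0) (XZ_group {})"
  unfolding S_in_def G_in_def
proof (rule css_representative_group[OF finite_qubits(3) inS_I inP_I])
  show "xor_span {} \<inter> xor_span inS = {{}}" unfolding xor_span_empty using xor_span.empty by blast
  show "perp I inP = {sym_diff l s | l s. l \<in> xor_span {} \<and> s \<in> xor_span inS}"
    unfolding xor_span_empty perp_inP by simp
qed simp

lemma tet_qubit: "logical_qubit N (S_3 K v0) (G_3 K v0) (X_op Q) (Z_op Q)"
  unfolding S_3_def G_3_def
  by (rule css_logical_qubit[OF finite_qubits(1) tetC_N tetP_N Q_N tet_generator(1,2)])

lemma outer_qubit: "logical_qubit Q (S_2 K v0) (G_2 K v0) (X_op Q) (Z_op Q)"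
  unfolding S_2_def G_2_def
  by (rule css_logical_qubit[OF finite_qubits(2) outP_Q outP_Q subset_refl out_generator(1,2)])

lemma XZ_group_mult_empty:
  fixes A :: "'v set set"
  assumes "\<And>a. a \<in> A \<Longrightarrow> finite a"
  shows "XZ_group A <#>\<^bsub>op_group\<^esub> XZ_group {} = XZ_group A"
proof -
  have "(XZ_group {} :: 'v operator set) = {\<one>\<^bsub>op_group\<^esub>}"
    using XZ_group_upper_commuting[of "{} :: 'v set set"] subgroup.one_closed[OF XZ_subgroup[of "{}"]]
    unfolding xor_span_empty pauli_ops_def one_pauli_op by auto
  moreover have "h \<otimes>\<^bsub>op_group\<^esub> \<one>\<^bsub>op_group\<^esub> = h" if "h \<in> XZ_group A" for h
    using subgroup.mem_carrier[OF XZ_subgroup that] assms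
      monoid.r_one[OF group.is_monoid[OF op_group_is_group]] by blast
  ultimately show ?thesis unfolding set_mult_def by auto
qed

lemma splits: "splits_by_gauge_fixing N (S_3 K v0) (G_3 K v0) Q (S_2 K v0) (G_2 K v0)
    I (S_in K v0) (G_in K v0)"
proof -
  have "XZ_group {Q} <#>\<^bsub>op_group\<^esub> XZ_group {} = XZ_group {Q}"
    by (rule XZ_group_mult_empty) (use finite_qubits in blast)
  then show ?thesis
    unfolding splits_by_gauge_fixing_def
    using tet_code outer_code inner_code QI_N gauge_inclusion stabilizer_inclusion
      tet_representative outer_representative inner_representative by metis
qed

lemma inner_trivial:
  "eq_up_to_phases (S_in K v0) (centralizer I (G_in K v0))"
  unfolding eq_up_to_phases_def S_in_def G_in_def
  using phases_XZ_group[of inS, OF finite_members(5)] phases_centralizer[OF finite_qubits(3) inP_I] perp_inP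
  by simp

end

theorem mainTheorem1:
  fixes K :: "'v colored_graph" and v0 :: 'v
  assumes "tetrahedral_3colex K v0"
    and "nonpathological K v0"
  shows
    "splits_by_gauge_fixing (tet_qubits K v0) (S_3 K v0) (G_3 K v0)
       (outer_qubits K v0) (S_2 K v0) (G_2 K v0) (inner_qubits K v0) (S_in K v0) (G_in K v0) \<and>
     (representative_group (tet_qubits K v0) (S_3 K v0) (G_3 K v0)
        (generate op_group {X_op (outer_qubits K v0), Z_op (outer_qubits K v0)}) \<and>
      logical_qubit (tet_qubits K v0) (S_3 K v0) (G_3 K v0)
        (X_op (outer_qubits K v0)) (Z_op (outer_qubits K v0)) \<and>
      representative_group (outer_qubits K v0) (S_2 K v0) (G_2 K v0)
        (generate op_group {X_op (outer_qubits K v0), Z_op (outer_qubits K v0)}) \<and>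
      logical_qubit (outer_qubits K v0) (S_2 K v0) (G_2 K v0)
        (X_op (outer_qubits K v0)) (Z_op (outer_qubits K v0))) \<and>
     (stabilizer_subsystem_code (inner_qubits K v0) (S_in K v0) (G_in K v0) \<and>
      phase (- 1) \<notin> S_in K v0 \<and>
      eq_up_to_phases (S_in K v0) (G_in K v0 \<inter> centralizer (inner_qubits K v0) (G_in K v0)) \<and>
      eq_up_to_phases (S_in K v0) (centralizer (inner_qubits K v0) (G_in K v0))) \<and>
     (G_2 K v0 <#>\<^bsub>op_group\<^esub> G_in K v0 \<subseteq> G_3 K v0 \<and>
      S_3 K v0 \<subseteq> S_2 K v0 <#>\<^bsub>op_group\<^esub> S_in K v0)"
proof -
  interpret tetrahedral K v0
    using assms by unfold_locales (auto simp: tetrahedral_3colex_def)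
  show ?thesis
    using splits tet_representative tet_qubit outer_representative outer_qubit inner_code
      inner_trivial gauge_inclusion stabilizer_inclusion
    unfolding generate_Q stabilizer_subsystem_code_def by blast
qed

end
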